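(* Let $\xi$ be an irrational real number, and suppose that for some integer $b\ge 2$ the base-$b$ expansion of $\xi$ is an automatic (resp. morphic) infinite word over the alphabet $\{0,1,\ldots,b-1\}$. Then $v_b(\xi)$ is finite and rational (resp. algebraic).
   Context: For a real $x$, $\|x\|$ denotes the distance from $x$ to the nearest integer. For an irrational real $\xi$ and integer $b\ge 2$, $v_b(\xi)$ is the supremum of the real numbers $v$ such that $\|b^n\xi\|<(b^n)^{-v}$ has infinitely many solutions in positive integers $n$. The base-$b$ expansion of $\xi$ is the digit sequence $d_1d_2d_3\cdots$ with $d_n\in\{0,\dots,b-1\}$, not ending in $(b-1)^\omega$, such that $\xi=\lfloor\xi\rfloor+\sum_{n\ge1}d_nb^{-n}$. Morphic/automatic words: Let $\Sigma$ be a finite alphabet and $\epsilon$ the empty word. A morphism $h:\Sigma^*\to\Sigma^*$ is prolongable on $a\in\Sigma$ if $h(a)=ax$ with $x\in\Sigma^+$ and $h^n(x)\ne\epsilon$ for all $n\ge0$; then $h^n(a)$ converges to the infinite word $h^\omega(a)=a\,x\,h(x)\,h^2(x)\cdots$, a fixed point of $h$, called a pure morphic word. A coding is a letter-to-letter morphism. An infinite word is morphic if it is the image under a coding of a pure morphic word, and automatic if it is the image under a coding of a pure morphic word $h^\omega(a)$ with $h$ uniform (i.e. $|h(c)|$ is the same for all letters $c$). *)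

theory Defs
  imports "HOL-Library.Extended_Real" "HOL-Computational_Algebra.Polynomial"
begin

definition dist_int :: "real \<Rightarrow> real" where
  "dist_int x = (INF k\<in>(\<int>::real set). \<bar>x - k\<bar>)"

definition irr_exp :: "nat \<Rightarrow> real \<Rightarrow> ereal" where
  "irr_exp b \<xi> = Sup {ereal v | v. infinite {n::nat. n > 0 \<and>
      dist_int (real b ^ n * \<xi>) < (real b ^ n) powr (- v)}}"

(* base-b digit d_n (n \<ge> 1) *)
definition digit :: "nat \<Rightarrow> real \<Rightarrow> nat \<Rightarrow> nat" where
  "digit b \<xi> n = nat (\<lfloor>real b ^ n * \<xi>\<rfloor> - int b * \<lfloor>real b ^ (n - 1) * \<xi>\<rfloor>)"

definition digit_word :: "nat \<Rightarrow> real \<Rightarrow> nat \<Rightarrow> nat" where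
  "digit_word b \<xi> k = digit b \<xi> (Suc k)"

definition morph :: "('a \<Rightarrow> 'a list) \<Rightarrow> 'a list \<Rightarrow> 'a list" where
  "morph h w = concat (map h w)"

definition prolongable :: "('a \<Rightarrow> 'a list) \<Rightarrow> 'a \<Rightarrow> bool" where
  "prolongable h a \<longleftrightarrow> (\<exists>x. h a = a # x \<and> x \<noteq> [] \<and> (\<forall>n. (morph h ^^ n) x \<noteq> []))"

definition is_fixpoint_word :: "('a \<Rightarrow> 'a list) \<Rightarrow> 'a \<Rightarrow> (nat \<Rightarrow> 'a) \<Rightarrow> bool" where
  "is_fixpoint_word h a w \<longleftrightarrow>
     (\<forall>n i. i < length ((morph h ^^ n) [a]) \<longrightarrow> w i = (morph h ^^ n) [a] ! i)"

(* letters of a finite alphabet are encoded as natural numbers *)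
definition pure_morphic_by :: "nat set \<Rightarrow> (nat \<Rightarrow> nat list) \<Rightarrow> nat \<Rightarrow> (nat \<Rightarrow> nat) \<Rightarrow> bool" where
  "pure_morphic_by \<Sigma> h a w \<longleftrightarrow> finite \<Sigma> \<and> a \<in> \<Sigma> \<and> (\<forall>c\<in>\<Sigma>. set (h c) \<subseteq> \<Sigma>)
     \<and> prolongable h a \<and> is_fixpoint_word h a w"

definition morphic :: "(nat \<Rightarrow> nat) \<Rightarrow> bool" where
  "morphic u \<longleftrightarrow> (\<exists>\<Sigma> h a w (\<tau>::nat \<Rightarrow> nat). pure_morphic_by \<Sigma> h a w \<and> u = \<tau> \<circ> w)"

definition automatic :: "(nat \<Rightarrow> nat) \<Rightarrow> bool" where
  "automatic u \<longleftrightarrow> (\<exists>\<Sigma> h a w (\<tau>::nat \<Rightarrow> nat). pure_morphic_by \<Sigma> h a w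
      \<and> (\<exists>k. \<forall>c\<in>\<Sigma>. length (h c) = k) \<and> u = \<tau> \<circ> w)"

end

theory Submission
  imports Defs "HOL-Complex_Analysis.Complex_Analysis" "HOL-Real_Asymp.Real_Asymp"
    "HOL-Computational_Algebra.Fundamental_Theorem_Algebra"
begin

text \<open>The distance from \<open>b ^ n * \<xi>\<close> to the nearest integer is \<open>b ^ (- l)\<close>, up to a factor
  \<open>b\<close>, where \<open>l\<close> is the length of the longer of the runs of the digits \<open>0\<close> and \<open>b - 1\<close>
  starting after the \<open>n\<close>-th digit. So the exponent is the upper limit of \<open>l / n\<close>.

  Let the expansion be a coding of a fixed point \<open>w\<close> of a morphism \<open>g\<close>, and let \<open>B\<close> be the set
  of letters coded by the digit in question. After passing to a power of \<open>g\<close>, the set \<open>D\<close> of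
  letters \<open>c\<close> with \<open>g c\<close> a word over \<open>B\<close> satisfies: \<open>c\<close> is in \<open>D\<close> iff \<open>g c\<close> is a word over
  \<open>D\<close>. Then each run of letters in \<open>D\<close> gives rise to exactly one run in the image, bounded by the
  last and the first letter outside \<open>D\<close> in the images of its two neighbours, and all runs are obtained
  in this way from the runs inside a single block \<open>g c\<close>. Among the blocks of \<open>c\<close> only the first
  occurrence matters, so finitely many pairs of sequences \<open>p\<close>, \<open>q\<close> of left and right ends remain,
  and one needs the upper limit of \<open>(q - p) / p\<close>.

  If \<open>g\<close> is uniform of length \<open>k\<close>, then \<open>p n / k ^ n\<close> and \<open>q n / k ^ n\<close> have rational limits. In
  general \<open>p\<close> and \<open>q\<close> satisfy a linear system with nonnegative integer coefficients. By state
  elimination and the renewal theorem, such sequences are on every residue class of some modulus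
  either eventually zero or asymptotic to \<open>C * n ^ k * \<theta> ^ n\<close>. As \<open>q\<close> is bounded by a multiple of
  \<open>p\<close>, the quotient \<open>q / p\<close> converges on each class. Limits of quotients of rational linear
  recurrence sequences are algebraic.\<close>

section \<open>Algebraic numbers\<close>

text \<open>The letters coded by a fixed digit are not preserved by the morphism, and blocks may be
  empty, so the image of a maximal run need not be a maximal run; the set \<open>D\<close> is the
  stationary substitute that a power of the morphism makes available. Moving a run inside a block to
  an earlier occurrence of its parent letter keeps the lengths of all descendants and only decreases
  their left ends, so the ratios can only increase. This is why finitely many runs decide the upper
  limit.

  Existence and arithmetic nature of the limits are separated. The growth analysis only yields
  convergence of \<open>q / p\<close>: its constants come out of infinite series and say nothing
  about algebraicity. That is obtained from the rational recurrences once the quotient is known to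
  converge, without a formula for the limit. Nonnegativity drives the growth analysis: for general
  recurrences, roots of equal modulus can make quotients oscillate, while sums, convolutions and
  series \<open>1 / (1 - F)\<close> of nonnegative sequences cannot cancel. This takes the place of
  Perron-Frobenius theory, and periodicity is confined to residue classes.\<close>

lemma homogeneous_system_nontrivial:
  fixes a :: "'i \<Rightarrow> 'j \<Rightarrow> 'k::field"
  assumes "finite I" "finite J" "card I < card J"
  shows "\<exists>c. (\<exists>j\<in>J. c j \<noteq> 0) \<and> (\<forall>i\<in>I. (\<Sum>j\<in>J. a i j * c j) = 0)"
  using assms
proof (induction I arbitrary: J a rule: finite_induct)
  case empty
  then obtain j where "j \<in> J" by (metis card.empty card_gt_0_iff equals0I)
  then show ?case by (intro exI[of _ "\<lambda>_. 1"]) auto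
next
  case (insert i0 I)
  show ?case
  proof (cases "\<forall>j\<in>J. a i0 j = 0")
    case True
    have "card I < card J" using insert by auto
    from insert.IH[OF insert.prems(1) this, of a] obtain c where
      "\<exists>j\<in>J. c j \<noteq> 0" "\<forall>i\<in>I. (\<Sum>j\<in>J. a i j * c j) = 0" by auto
    moreover have "(\<Sum>j\<in>J. a i0 j * c j) = 0" using True by simp
    ultimately show ?thesis by auto
  next
    case False
    then obtain j0 where j0: "j0 \<in> J" "a i0 j0 \<noteq> 0" by auto
    define J' where "J' = J - {j0}"
    have J': "finite J'" "j0 \<notin> J'" "J = insert j0 J'" using j0 insert.prems by (auto simp: J'_def)
    have "card I < card J'" using insert J' by auto
    \<comment> \<open>Gaussian elimination: multiples of equation \<open>i0\<close> remove the
      unknown \<open>j0\<close>, whose value is recovered from that equation afterwards.\<close>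
    from insert.IH[OF J'(1) this, of "\<lambda>i j. a i j - a i j0 * a i0 j / a i0 j0"]
    obtain c where c: "\<exists>j\<in>J'. c j \<noteq> 0"
      "\<And>i. i \<in> I \<Longrightarrow> (\<Sum>j\<in>J'. (a i j - a i j0 * a i0 j / a i0 j0) * c j) = 0" by auto
    define s where "s = (\<Sum>j\<in>J'. a i0 j * c j)"
    define c' where "c' = c(j0 := - s / a i0 j0)"
    have sum: "(\<Sum>j\<in>J. a i j * c' j) = (\<Sum>j\<in>J'. a i j * c j) - a i j0 * s / a i0 j0" for i
    proof -
      have "(\<Sum>j\<in>J. a i j * c' j) = a i j0 * c' j0 + (\<Sum>j\<in>J'. a i j * c' j)"
        using J' by simp
      also have "(\<Sum>j\<in>J'. a i j * c' j) = (\<Sum>j\<in>J'. a i j * c j)"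
        using J' by (intro sum.cong) (auto simp: c'_def)
      finally show ?thesis by (simp add: c'_def)
    qed
    have "(\<Sum>j\<in>J. a i j * c' j) = 0" if "i \<in> I" for i
    proof -
      have "(\<Sum>j\<in>J'. (a i j - a i j0 * a i0 j / a i0 j0) * c j)
          = (\<Sum>j\<in>J'. a i j * c j - a i j0 / a i0 j0 * (a i0 j * c j))"
        by (intro sum.cong) (auto simp: algebra_simps)
      also have "\<dots> = (\<Sum>j\<in>J'. a i j * c j) - a i j0 / a i0 j0 * s"
        unfolding sum_subtractf s_def sum_distrib_left ..
      finally show ?thesis using c(2)[OF that] by (simp add: sum)
    qed
    moreover have "(\<Sum>j\<in>J. a i0 j * c' j) = 0"
      unfolding sum using j0 by (simp add: s_def)
    moreover have "\<exists>j\<in>J. c' j \<noteq> 0" using c(1) J' by (auto simp: c'_def)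
    ultimately show ?thesis by auto
  qed
qed

text \<open>For finite \<open>I\<close>, multiplication by \<open>x\<close> maps the rational span
  of the \<open>s i\<close> into itself; put differently, \<open>s\<close> satisfies the eigenvector
  equation of a rational matrix with eigenvalue \<open>x\<close>. For a fixed family such
  \<open>x\<close> are closed under sums and products, which is how closure of the algebraic numbers
  is obtained.\<close>

definition rat_stable :: "'i set \<Rightarrow> ('i \<Rightarrow> 'a::field_char_0) \<Rightarrow> 'a \<Rightarrow> bool" where
  "rat_stable I s x \<longleftrightarrow>
     (\<exists>a. \<forall>i\<in>I. x * s i = (\<Sum>j\<in>I. of_rat (a i j) * s j))"

lemma rat_stable_add: "rat_stable I s x \<Longrightarrow> rat_stable I s y \<Longrightarrow> rat_stable I s (x + y)"
proof -
  assume "rat_stable I s x" "rat_stable I s y"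
  then obtain a b where "\<forall>i\<in>I. x * s i = (\<Sum>j\<in>I. of_rat (a i j) * s j)"
    "\<forall>i\<in>I. y * s i = (\<Sum>j\<in>I. of_rat (b i j) * s j)" by (auto simp: rat_stable_def)
  then have "\<forall>i\<in>I. (x + y) * s i = (\<Sum>j\<in>I. of_rat (a i j + b i j) * s j)"
    by (simp add: of_rat_add distrib_right sum.distrib)
  then show ?thesis unfolding rat_stable_def by (intro exI[of _ "\<lambda>i j. a i j + b i j"])
qed

lemma rat_stable_mult: "rat_stable I s x \<Longrightarrow> rat_stable I s y \<Longrightarrow> rat_stable I s (x * y)"
proof -
  assume "rat_stable I s x" "rat_stable I s y"
  then obtain a b where a: "\<And>i. i\<in>I \<Longrightarrow> x * s i = (\<Sum>j\<in>I. of_rat (a i j) * s j)"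
    and b: "\<And>i. i\<in>I \<Longrightarrow> y * s i = (\<Sum>j\<in>I. of_rat (b i j) * s j)" by (auto simp: rat_stable_def)
  have "x * y * s i = (\<Sum>k\<in>I. of_rat (\<Sum>j\<in>I. b i j * a j k) * s k)" if "i \<in> I" for i
  proof -
    have "x * y * s i = (\<Sum>j\<in>I. of_rat (b i j) * (x * s j))"
      by (simp add: b that mult.assoc sum_distrib_left mult.left_commute)
    also have "\<dots> = (\<Sum>j\<in>I. \<Sum>k\<in>I. of_rat (b i j) * (of_rat (a j k) * s k))"
      by (intro sum.cong) (auto simp: a sum_distrib_left)
    also have "\<dots> = (\<Sum>k\<in>I. \<Sum>j\<in>I. of_rat (b i j) * (of_rat (a j k) * s k))"
      by (rule sum.swap)
    finally show ?thesis
      by (simp add: of_rat_sum of_rat_mult sum_distrib_right mult.assoc)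
  qed
  then show ?thesis unfolding rat_stable_def
    by (intro exI[of _ "\<lambda>i k. \<Sum>j\<in>I. b i j * a j k"]) auto
qed

text \<open>The \<open>card I + 1\<close> numbers \<open>x ^ k * s i0\<close> have coordinate
  vectors \<open>b k\<close> in a space of dimension \<open>card I\<close>. A linear dependency of
  these vectors is a rational polynomial vanishing at \<open>x\<close>, because \<open>s i0\<close>
  can be cancelled.\<close>

lemma algebraic_rat_stable:
  fixes x :: "'a::field_char_0"
  assumes "finite I" "rat_stable I s x" "i0 \<in> I" "s i0 \<noteq> 0"
  shows "algebraic x"
proof -
  obtain a where a: "\<And>i. i \<in> I \<Longrightarrow> x * s i = (\<Sum>j\<in>I. of_rat (a i j) * s j)"
    using assms(2) by (auto simp: rat_stable_def)
  have "\<exists>b. x ^ k * s i0 = (\<Sum>j\<in>I. of_rat (b j) * s j)" for k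
  proof (induction k)
    case 0
    have "(\<Sum>j\<in>I. of_rat (if j = i0 then 1 else 0) * s j) = (\<Sum>j\<in>I. if j = i0 then s j else 0)"
      by (intro sum.cong) auto
    then show ?case using assms(1,3) by (intro exI[of _ "\<lambda>j. if j = i0 then 1 else 0"]) simp
  next
    case (Suc k)
    then obtain b where b: "x ^ k * s i0 = (\<Sum>j\<in>I. of_rat (b j) * s j)" by auto
    have "x ^ Suc k * s i0 = x * (\<Sum>j\<in>I. of_rat (b j) * s j)"
      using b by (simp add: mult.assoc)
    also have "\<dots> = (\<Sum>j\<in>I. of_rat (b j) * (x * s j))"
      by (simp add: sum_distrib_left mult.left_commute)
    also have "\<dots> = (\<Sum>j\<in>I. \<Sum>l\<in>I. of_rat (b j) * (of_rat (a j l) * s l))"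
      by (intro sum.cong) (auto simp: a sum_distrib_left)
    also have "\<dots> = (\<Sum>l\<in>I. \<Sum>j\<in>I. of_rat (b j) * (of_rat (a j l) * s l))"
      by (rule sum.swap)
    also have "\<dots> = (\<Sum>l\<in>I. of_rat (\<Sum>j\<in>I. b j * a j l) * s l)"
      by (simp add: of_rat_sum of_rat_mult sum_distrib_right mult.assoc)
    finally show ?case by (intro exI[of _ "\<lambda>l. \<Sum>j\<in>I. b j * a j l"])
  qed
  then obtain b where b: "\<And>k. x ^ k * s i0 = (\<Sum>j\<in>I. of_rat (b k j) * s j)" by metis
  obtain c where c: "\<exists>k\<in>{..card I}. c k \<noteq> 0"
    "\<And>j. j \<in> I \<Longrightarrow> (\<Sum>k\<le>card I. b k j * c k) = 0"
    using homogeneous_system_nontrivial[of I "{..card I}" "\<lambda>j k. b k j"] assms(1) by auto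
  define P where "P = (\<Sum>k\<le>card I. monom (of_rat (c k) :: 'a) k)"
  have coeff: "coeff P k = (if k \<le> card I then of_rat (c k) else 0)" for k
    by (simp add: P_def coeff_sum)
  have "poly P x * s i0 = (\<Sum>k\<le>card I. of_rat (c k) * (x ^ k * s i0))"
    by (simp add: P_def poly_sum poly_monom sum_distrib_right mult.assoc)
  also have "\<dots> = (\<Sum>k\<le>card I. \<Sum>j\<in>I. of_rat (c k) * (of_rat (b k j) * s j))"
    by (simp add: b sum_distrib_left)
  also have "\<dots> = (\<Sum>j\<in>I. \<Sum>k\<le>card I. of_rat (c k) * (of_rat (b k j) * s j))"
    by (rule sum.swap)
  also have "\<dots> = (\<Sum>j\<in>I. of_rat (\<Sum>k\<le>card I. b k j * c k) * s j)"
    by (intro sum.cong refl) (simp add: of_rat_sum of_rat_mult sum_distrib_left sum_distrib_right mult_ac)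
  also have "\<dots> = 0" by (simp add: c)
  finally have "poly P x = 0" using assms by simp
  moreover have "P \<noteq> 0"
  proof
    assume "P = 0"
    with c(1) coeff show False by (metis atMost_iff coeff_0 of_rat_eq_0_iff)
  qed
  ultimately show ?thesis by (intro algebraicI'[of P]) (auto simp: coeff)
qed

lemma algebraic_power_reduction:
  fixes x :: "'a::field_char_0"
  assumes "algebraic x"
  obtains d r where "d > 0" "x ^ d = (\<Sum>j<d. of_rat (r j) * x ^ j)"
proof -
  obtain p where p: "\<And>i. coeff p i \<in> \<rat>" "p \<noteq> 0" "poly p x = 0"
    using assms by (auto simp: algebraic_altdef)
  have "degree p > 0"
  proof (rule ccontr)
    assume "\<not> degree p > 0"
    then obtain c where "p = [:c:]" by (auto elim: degree_eq_zeroE)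
    then show False using p(2,3) by simp
  qed
  have "\<forall>i. \<exists>c. coeff p i = of_rat c" using p(1) by (meson Rats_cases)
  then obtain r where r: "\<And>i. coeff p i = of_rat (r i)" by metis
  have "(\<Sum>j<degree p. of_rat (r j) * x ^ j) + of_rat (r (degree p)) * x ^ degree p = 0"
  proof -
    have "0 = (\<Sum>j<Suc (degree p). coeff p j * x ^ j)"
      using p(3) unfolding poly_altdef lessThan_Suc_atMost by simp
    then show ?thesis by (simp only: sum.lessThan_Suc r)
  qed
  moreover have "r (degree p) \<noteq> 0" using p(2) r[of "degree p"] by auto
  ultimately have "x ^ degree p = - (\<Sum>j<degree p. of_rat (r j) * x ^ j) / of_rat (r (degree p))"
    by (metis add_eq_0_iff nonzero_mult_div_cancel_left of_rat_eq_0_iff)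
  also have "\<dots> = (\<Sum>j<degree p. of_rat (- r j / r (degree p)) * x ^ j)"
    by (simp add: sum_divide_distrib sum_negf of_rat_minus of_rat_divide)
  finally show ?thesis using \<open>degree p > 0\<close> by (intro that[of "degree p" "\<lambda>j. - r j / r (degree p)"])
qed

text \<open>Multiplication by \<open>x\<close> raises one exponent, and \<open>x ^ d\<close> is
  rewritten by its reduction. The second form has the factors exchanged, so that with
  \<open>x\<close> and \<open>y\<close> swapped it speaks of the same family of monomials as the
  first.\<close>

lemma rat_stable_power_products:
  fixes x y :: "'a::field_char_0"
  assumes "d > 0" "x ^ d = (\<Sum>j<d. of_rat (r j) * x ^ j)"
  shows "rat_stable ({..<d} \<times> {..<e}) (\<lambda>(i, j). x ^ i * y ^ j) x"
    and "rat_stable ({..<e} \<times> {..<d}) (\<lambda>(i, j). y ^ i * x ^ j) x"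
proof -
  have 1: "x * x ^ i = (\<Sum>k<d. of_rat (if Suc i < d then (if k = Suc i then 1 else 0) else r k) * x ^ k)"
    if "i < d" for i
  proof (cases "Suc i < d")
    case True
    have "(\<Sum>k<d. of_rat (if k = Suc i then 1 else 0) * x ^ k) = (\<Sum>k<d. if k = Suc i then x ^ k else 0)"
      by (intro sum.cong) auto
    then show ?thesis using True by simp
  next
    case False
    then have "Suc i = d" using that by simp
    then have "x * x ^ i = x ^ d" by auto
    then show ?thesis using False by (simp only: assms(2) if_False)
  qed
  define a where "a i k = (if Suc i < d then (if k = Suc i then 1 else 0) else r k)" for i k
  have a: "x * x ^ i = (\<Sum>k<d. of_rat (a i k) * x ^ k)" if "i < d" for i
    using 1[OF that] by (simp add: a_def)
  have "x * (x ^ i * y ^ j) = (\<Sum>(k, l)\<in>{..<d} \<times> {..<e}. of_rat (if l = j then a i k else 0) * (x ^ k * y ^ l))"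
    if "i < d" "j < e" for i j
  proof -
    have "(\<Sum>(k, l)\<in>{..<d} \<times> {..<e}. of_rat (if l = j then a i k else 0) * (x ^ k * y ^ l))
        = (\<Sum>k<d. \<Sum>l<e. if l = j then of_rat (a i k) * (x ^ k * y ^ l) else 0)"
      unfolding sum.cartesian_product[symmetric] by (intro sum.cong) auto
    also have "\<dots> = (\<Sum>k<d. of_rat (a i k) * x ^ k) * y ^ j"
      using that by (simp add: sum_distrib_right mult.assoc)
    finally show ?thesis using a[OF that(1)] by (simp add: mult.assoc)
  qed
  then show "rat_stable ({..<d} \<times> {..<e}) (\<lambda>(i, j). x ^ i * y ^ j) x"
    unfolding rat_stable_def
    by (intro exI[of _ "\<lambda>(i, j) (k, l). if l = j then a i k else 0"]) (auto simp: case_prod_beta cong: if_cong)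
  have "x * (y ^ j * x ^ i) = (\<Sum>(l, k)\<in>{..<e} \<times> {..<d}. of_rat (if l = j then a i k else 0) * (y ^ l * x ^ k))"
    if "i < d" "j < e" for i j
  proof -
    have "(\<Sum>(l, k)\<in>{..<e} \<times> {..<d}. of_rat (if l = j then a i k else 0) * (y ^ l * x ^ k))
        = (\<Sum>l<e. \<Sum>k<d. if l = j then of_rat (a i k) * (y ^ l * x ^ k) else 0)"
      unfolding sum.cartesian_product[symmetric] by (intro sum.cong) auto
    also have "\<dots> = (\<Sum>k<d. \<Sum>l<e. if l = j then of_rat (a i k) * (y ^ l * x ^ k) else 0)"
      by (rule sum.swap)
    also have "\<dots> = (\<Sum>k<d. of_rat (a i k) * x ^ k) * y ^ j"
      using that by (simp add: sum_distrib_left sum_distrib_right mult_ac)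
    finally show ?thesis using a[OF that(1)] by (simp add: mult_ac)
  qed
  then show "rat_stable ({..<e} \<times> {..<d}) (\<lambda>(i, j). y ^ i * x ^ j) x"
    unfolding rat_stable_def
    by (intro exI[of _ "\<lambda>(j, i) (l, k). if l = j then a i k else 0"]) (auto simp: case_prod_beta cong: if_cong)
qed

lemma
  fixes x y :: "'a::field_char_0"
  assumes "algebraic x" "algebraic y"
  shows algebraic_add: "algebraic (x + y)"
    and algebraic_mult: "algebraic (x * y)"
proof -
  obtain d r where d: "d > 0" "x ^ d = (\<Sum>j<d. of_rat (r j) * x ^ j)"
    using algebraic_power_reduction[OF assms(1)] by blast
  obtain e t where e: "e > 0" "y ^ e = (\<Sum>j<e. of_rat (t j) * y ^ j)"
    using algebraic_power_reduction[OF assms(2)] by blast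
  note x = rat_stable_power_products(1)[OF d, of e y]
  note y = rat_stable_power_products(2)[OF e, of d x]
  note alg = algebraic_rat_stable[of "{..<d} \<times> {..<e}" "\<lambda>(i, j). x ^ i * y ^ j" _ "(0, 0)"]
  show "algebraic (x + y)" using alg[OF _ rat_stable_add[OF x y]] d(1) e(1) by simp
  show "algebraic (x * y)" using alg[OF _ rat_stable_mult[OF x y]] d(1) e(1) by simp
qed

lemma algebraic_divide:
  fixes x y :: "'a::field_char_0"
  assumes "algebraic x" "algebraic y"
  shows "algebraic (x / y)"
  using algebraic_mult[OF assms(1) algebraic_inverse[OF assms(2)]] by (simp add: field_simps)

lemma algebraic_sum:
  fixes f :: "'b \<Rightarrow> 'a::field_char_0"
  assumes "\<And>i. i \<in> I \<Longrightarrow> algebraic (f i)"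
  shows "algebraic (sum f I)"
  using assms by (induction I rule: infinite_finite_induct) (auto intro: algebraic_add)

text \<open>Splitting off one linear factor at a time writes the coefficients as integer polynomials
  in the roots. The intended use is a monic divisor of a rational polynomial, whose own coefficients
  may be irrational.\<close>

lemma algebraic_coeff_of_roots:
  fixes p :: "complex poly"
  assumes "lead_coeff p = 1" "\<And>z. poly p z = 0 \<Longrightarrow> algebraic z"
  shows "algebraic (coeff p i)"
  using assms
proof (induction "degree p" arbitrary: p i)
  case 0
  then show ?case by (metis algebraic_0 algebraic_1 coeff_eq_0 gr0I)
next
  case (Suc n)
  then obtain z where z: "poly p z = 0"
    using alg_closed_imp_poly_has_root[of p] by auto
  then obtain q where q: "p = [:-z, 1:] * q" by (metis dvdE poly_eq_0_iff_dvd)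
  have "q \<noteq> 0" using Suc.hyps(2) q by auto
  then have "degree p = Suc (degree q)" unfolding q by (subst degree_mult_eq) auto
  moreover have "lead_coeff q = 1"
  proof -
    have "lead_coeff p = lead_coeff [:-z, 1:] * lead_coeff q" unfolding q by (rule lead_coeff_mult)
    then show ?thesis using Suc.prems(1) by simp
  qed
  moreover have "algebraic y" if "poly q y = 0" for y using Suc.prems(2)[of y] that q by simp
  ultimately have q_alg: "algebraic (coeff q j)" for j using Suc.hyps by auto
  have "coeff p i = - z * coeff q i + (case i of 0 \<Rightarrow> 0 | Suc j \<Rightarrow> coeff q j)"
    unfolding q by (simp add: coeff_pCons split: nat.splits)
  moreover have "algebraic (- z * coeff q i)"
    using algebraic_mult[OF algebraic_minus[OF Suc.prems(2)[OF z]] q_alg] .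
  moreover have "algebraic (case i of 0 \<Rightarrow> 0 | Suc j \<Rightarrow> coeff q j)"
    using q_alg by (auto split: nat.splits)
  ultimately show ?case by (metis algebraic_add)
qed

section \<open>Quotients of linear recurrence sequences\<close>

text \<open>The action of complex polynomials on sequences in which the variable acts as the left
  shift. A polynomial annihilating \<open>f\<close> is a linear recurrence for \<open>f\<close>, and
  division with remainder applies to recurrences.\<close>

definition shift_poly :: "complex poly \<Rightarrow> (nat \<Rightarrow> complex) \<Rightarrow> nat \<Rightarrow> complex" where
  "shift_poly P f n = (\<Sum>k\<le>degree P. coeff P k * f (n + k))"

lemma shift_poly_upto:
  assumes "degree P \<le> N"
  shows "shift_poly P f n = (\<Sum>k\<le>N. coeff P k * f (n + k))"
  unfolding shift_poly_def using assms
  by (intro sum.mono_neutral_left) (auto simp: coeff_eq_0)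

lemma shift_poly_0 [simp]: "shift_poly 0 f n = 0"
  by (simp add: shift_poly_def)

lemma shift_poly_add: "shift_poly (P + Q) f n = shift_poly P f n + shift_poly Q f n"
  by (subst (1 2 3) shift_poly_upto[of _ "max (degree P) (degree Q)"])
     (auto simp: degree_add_le distrib_right sum.distrib)

lemma shift_poly_smult: "shift_poly (smult c P) f n = c * shift_poly P f n"
  by (subst (1 2) shift_poly_upto[of _ "degree P"])
     (auto simp: degree_smult_le sum_distrib_left mult.assoc)

lemma shift_poly_pCons: "shift_poly (pCons a P) f n = a * f n + shift_poly P f (Suc n)"
proof -
  have "shift_poly (pCons a P) f n = (\<Sum>k\<le>Suc (degree P). coeff (pCons a P) k * f (n + k))"
    by (rule shift_poly_upto) (simp add: degree_pCons_le)
  also have "\<dots> = a * f n + shift_poly P f (Suc n)"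
    by (subst sum.atMost_Suc_shift) (simp add: shift_poly_def)
  finally show ?thesis .
qed

lemma shift_poly_mult: "shift_poly (P * Q) f n = shift_poly P (shift_poly Q f) n"
proof (induction P arbitrary: n)
  case (pCons a P)
  then show ?case
    by (simp add: shift_poly_add shift_poly_smult shift_poly_pCons)
qed simp

lemma shift_poly_lincomb:
  "shift_poly P (\<lambda>n. a * f n + b * g n) n = a * shift_poly P f n + b * shift_poly P g n"
  by (simp add: shift_poly_def sum.distrib sum_distrib_left algebra_simps)

lemma shift_poly_sum:
  "shift_poly P (\<lambda>n. \<Sum>j\<in>J. c j * f (n + j)) n = (\<Sum>j\<in>J. c j * shift_poly P f (n + j))"
  unfolding shift_poly_def sum_distrib_left
  by (subst sum.swap) (simp add: algebra_simps)

lemma shift_poly_eq_0_unique: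
  assumes "lead_coeff P = 1" "\<And>n. shift_poly P g n = 0" "\<And>i. i < degree P \<Longrightarrow> g i = 0"
  shows "g n = 0"
proof (induction n rule: less_induct)
  case (less n)
  show ?case
  proof (cases "n < degree P")
    case False
    define m where "m = n - degree P"
    have n: "n = m + degree P" using False by (simp add: m_def)
    have "shift_poly P g m = (\<Sum>k<degree P. coeff P k * g (m + k)) + g n"
      unfolding shift_poly_def n using assms(1) by (simp add: lessThan_Suc_atMost[symmetric])
    also have "(\<Sum>k<degree P. coeff P k * g (m + k)) = 0"
      using less n by simp
    finally show ?thesis using assms(2) by simp
  qed (use assms(3) in auto)
qed

text \<open>No leading coefficient is singled out: some coefficient being nonzero is exactly what a
  linear dependency among shifts provides.\<close>

definition rat_recurrent :: "(nat \<Rightarrow> nat) \<Rightarrow> bool" where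
  "rat_recurrent p \<longleftrightarrow> (\<exists>N (c::nat \<Rightarrow> rat). (\<exists>k\<le>N. c k \<noteq> 0) \<and> (\<forall>n. (\<Sum>k\<le>N. c k * of_nat (p (n + k))) = 0))"

lemma rat_recurrent_shift_poly:
  assumes "rat_recurrent p"
  obtains P :: "complex poly" where "P \<noteq> 0" "\<And>i. coeff P i \<in> \<rat>"
    "\<And>n. shift_poly P (\<lambda>n. of_nat (p n)) n = 0"
proof -
  obtain N and c :: "nat \<Rightarrow> rat" where c: "\<exists>k\<le>N. c k \<noteq> 0"
    "\<And>n. (\<Sum>k\<le>N. c k * of_nat (p (n + k))) = 0"
    using assms by (auto simp: rat_recurrent_def)
  define P where "P = (\<Sum>k\<le>N. monom (of_rat (c k) :: complex) k)"
  have coeff: "coeff P k = (if k \<le> N then of_rat (c k) else 0)" for k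
    by (simp add: P_def coeff_sum)
  have "degree P \<le> N" by (intro degree_le) (auto simp: coeff)
  then have "shift_poly P (\<lambda>n. of_nat (p n)) n = of_rat (\<Sum>k\<le>N. c k * of_nat (p (n + k)))" for n
    by (subst shift_poly_upto) (auto simp: coeff of_rat_sum of_rat_mult)
  then have "shift_poly P (\<lambda>n. of_nat (p n)) n = 0" for n using c(2) by simp
  moreover have "P \<noteq> 0" using c(1) coeff by (metis coeff_0 of_rat_eq_0_iff)
  moreover have "coeff P i \<in> \<rat>" for i by (simp add: coeff)
  ultimately show ?thesis using that by blast
qed

text \<open>Let \<open>D\<close> be the minimal polynomial of the sequence \<open>f = q - L p\<close>. It divides a rational
  polynomial, so its coefficients are algebraic, and \<open>D q = L D p\<close> exhibits \<open>L\<close> as a quotient of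
  algebraic numbers unless \<open>D p = 0\<close>. But in that case \<open>p\<close> is a linear combination of shifts of
  \<open>f\<close>, all of which are \<open>o(p)\<close>.\<close>

lemma algebraic_limit_ratio:
  fixes p q :: "nat \<Rightarrow> nat" and L :: real
  assumes p: "rat_recurrent p" and q: "rat_recurrent q"
    and pos: "\<And>n. p n > 0" and growth: "\<And>n. real (p (Suc n)) \<le> K * real (p n)"
    and lim: "(\<lambda>n. real (q n) / real (p n)) \<longlonglongrightarrow> L"
  shows "algebraic L"
proof -
  define P Q :: "nat \<Rightarrow> complex" where "P = (\<lambda>n. of_nat (p n))" and "Q = (\<lambda>n. of_nat (q n))"
  define f where "f n = 1 * Q n + (- of_real L) * P n" for n
  have f_eq: "f = (\<lambda>n. 1 * Q n + (- of_real L) * P n)" by (simp add: f_def fun_eq_iff)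
  obtain R1 where R1: "R1 \<noteq> 0" "\<And>i. coeff R1 i \<in> \<rat>" "\<And>n. shift_poly R1 P n = 0"
    using rat_recurrent_shift_poly[OF p] unfolding P_def by metis
  obtain R2 where R2: "R2 \<noteq> 0" "\<And>i. coeff R2 i \<in> \<rat>" "\<And>n. shift_poly R2 Q n = 0"
    using rat_recurrent_shift_poly[OF q] unfolding Q_def by metis
  define R where "R = R1 * R2"
  have R: "R \<noteq> 0" "shift_poly R f n = 0" for n
  proof -
    have z: "shift_poly S (\<lambda>_. 0) n = 0" for S n by (simp add: shift_poly_def)
    have "shift_poly R1 P = (\<lambda>_. 0)" "shift_poly R2 Q = (\<lambda>_. 0)"
      using R1 R2 by auto
    then have "shift_poly R P n = 0" "shift_poly R Q n = 0" for n
      using shift_poly_mult[of R2 R1 P n] shift_poly_mult[of R1 R2 Q n] z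
      by (simp_all add: R_def mult.commute)
    then have "shift_poly R f n = 0" unfolding f_eq shift_poly_lincomb by simp
    then show "R \<noteq> 0" "shift_poly R f n = 0" using R1 R2 by (simp_all add: R_def)
  qed
  have root_alg: "algebraic z" if "poly R z = 0" for z
  proof -
    have "poly R1 z = 0 \<or> poly R2 z = 0" using that by (simp add: R_def)
    then show ?thesis using R1 R2 algebraicI' by blast
  qed
  define kills where "kills S \<longleftrightarrow> S \<noteq> 0 \<and> (\<forall>n. shift_poly S f n = 0)" for S
  have "kills R" using R by (simp add: kills_def)
  define D0 where "D0 = arg_min degree kills"
  have D0: "kills D0" "\<And>S. kills S \<Longrightarrow> degree D0 \<le> degree S"
    unfolding D0_def using arg_min_natI[of kills R degree] arg_min_nat_le[of kills _ degree] \<open>kills R\<close>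
    by blast+
  define D where "D = smult (inverse (lead_coeff D0)) D0"
  have nz: "lead_coeff D0 \<noteq> 0" using D0(1) by (simp add: kills_def)
  have D: "D \<noteq> 0" "\<And>n. shift_poly D f n = 0" "lead_coeff D = 1" "degree D = degree D0"
    using D0(1) nz by (auto simp: kills_def D_def shift_poly_smult)
  have min: "degree D \<le> degree S" if "S \<noteq> 0" "\<And>n. shift_poly S f n = 0" for S
    using D0(2) that D(4) by (simp add: kills_def)
  have "D dvd R"
  proof -
    have "shift_poly (R mod D) f n = 0" for n
    proof -
      have z: "shift_poly (R div D * D) f n = 0"
        unfolding shift_poly_mult using D(2) by (simp add: shift_poly_def)
      have "shift_poly R f n = shift_poly (R div D * D) f n + shift_poly (R mod D) f n"
        by (subst shift_poly_add[symmetric]) simp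
      then show ?thesis using R z by simp
    qed
    then have "R mod D = 0"
      using min[of "R mod D"] D(1) degree_mod_less'[of D R] by fastforce
    then show ?thesis by auto
  qed
  then have D_alg: "algebraic (coeff D i)" for i
    using algebraic_coeff_of_roots[OF D(3)] root_alg by (metis dvd_trans poly_eq_0_iff_dvd)
  have DP_alg: "algebraic (shift_poly D P n)" and DQ_alg: "algebraic (shift_poly D Q n)" for n
    unfolding shift_poly_def P_def Q_def by (intro algebraic_sum algebraic_mult D_alg; simp)+
  have eq: "shift_poly D Q n = of_real L * shift_poly D P n" for n
    using D(2)[of n] unfolding f_eq shift_poly_lincomb by simp
  have "\<exists>n. shift_poly D P n \<noteq> 0"
  proof (rule ccontr)
    assume "\<not> (\<exists>n. shift_poly D P n \<noteq> 0)"
    then have DP: "shift_poly D P n = 0" for n by simp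
    define e where "e = degree D"
    \<comment> \<open>There are \<open>e + 1\<close> sequences, namely \<open>e\<close> shifts of
      \<open>f\<close> and \<open>P\<close> itself, and only \<open>e\<close> initial values to
      cancel. The resulting combination \<open>g\<close> is annihilated by \<open>D\<close>, so
      vanishing at the first \<open>e\<close> places makes it zero.\<close>
    obtain c where c: "\<exists>j\<in>{..e}. c j \<noteq> 0"
      "\<And>i. i \<in> {..<e} \<Longrightarrow> (\<Sum>j\<le>e. (if j < e then f (i + j) else P i) * c j) = 0"
      using homogeneous_system_nontrivial[of "{..<e}" "{..e}" "\<lambda>i j. if j < e then f (i + j) else P i"]
      by auto
    define g where "g n = 1 * (\<Sum>j<e. c j * f (n + j)) + c e * P n" for n
    have g_eq: "g = (\<lambda>n. 1 * (\<Sum>j<e. c j * f (n + j)) + c e * P n)" by (simp add: g_def fun_eq_iff)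
    have "shift_poly D g n = 0" for n
      unfolding g_eq shift_poly_lincomb shift_poly_sum using D(2) DP by simp
    moreover have "g i = 0" if "i < e" for i
      using c(2)[of i] that by (simp add: lessThan_Suc_atMost[symmetric] g_def mult.commute)
    ultimately have g0: "g n = 0" for n
      using shift_poly_eq_0_unique[OF D(3)] by (simp add: e_def)
    \<comment> \<open>Without \<open>P\<close> the relation would be a polynomial of degree below
      \<open>e\<close> annihilating \<open>f\<close>, against minimality.\<close>
    have "c e \<noteq> 0"
    proof
      assume ce: "c e = 0"
      define S where "S = (\<Sum>k<e. monom (c k) k)"
      have coeff: "coeff S k = (if k < e then c k else 0)" for k by (simp add: S_def coeff_sum)
      obtain j where j: "j < e" "c j \<noteq> 0" using c(1) ce by (metis atMost_iff le_neq_implies_less)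
      then have "S \<noteq> 0" using coeff by (metis coeff_0)
      moreover have dS: "degree S < e"
      proof -
        have "degree S \<le> e - 1" using j by (intro degree_le) (auto simp: coeff)
        then show ?thesis using j by linarith
      qed
      moreover have "shift_poly S f n = 0" for n
      proof -
        have "shift_poly S f n = (\<Sum>k\<le>e. coeff S k * f (n + k))"
          using dS by (intro shift_poly_upto) simp
        also have "\<dots> = g n" using ce by (simp add: lessThan_Suc_atMost[symmetric] g_def coeff)
        finally show ?thesis using g0 by simp
      qed
      ultimately show False using min[of S] by (simp add: e_def)
    qed
    have fP0: "(\<lambda>n. f n / P n) \<longlonglongrightarrow> 0"
    proof -
      have "(\<lambda>n. complex_of_real (real (q n) / real (p n) - L)) \<longlonglongrightarrow> of_real (L - L)"
        by (intro tendsto_of_real tendsto_diff lim tendsto_const)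
      moreover have "complex_of_real (real (q n) / real (p n) - L) = f n / P n" for n
        using pos[of n] by (simp add: f_def P_def Q_def field_simps)
      ultimately show ?thesis by simp
    qed
    \<comment> \<open>The growth bound enters here: \<open>P (n + 1) / P n\<close> is bounded, so a
      shift of \<open>f\<close> is still negligible against the unshifted \<open>P\<close>.\<close>
    have fP: "(\<lambda>n. f (n + j) / P n) \<longlonglongrightarrow> 0" for j
    proof (induction j)
      case (Suc j)
      have bd: "Bfun (\<lambda>n. P (Suc n) / P n) sequentially"
      proof (rule BfunI)
        show "\<forall>\<^sub>F n in sequentially. norm (P (Suc n) / P n) \<le> K"
          using growth pos by (auto simp: P_def norm_divide field_simps)
      qed
      have "(\<lambda>n. f (Suc n + j) / P (Suc n)) \<longlonglongrightarrow> 0"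
        using LIMSEQ_Suc[OF Suc.IH] by simp
      then have "Zfun (\<lambda>n. f (Suc n + j) / P (Suc n)) sequentially" by (simp add: tendsto_Zfun_iff)
      from bounded_bilinear.Zfun_prod_Bfun[OF bounded_bilinear_mult this bd]
      have "(\<lambda>n. f (Suc n + j) / P (Suc n) * (P (Suc n) / P n)) \<longlonglongrightarrow> 0" by (simp add: tendsto_Zfun_iff)
      moreover have "f (Suc n + j) / P (Suc n) * (P (Suc n) / P n) = f (n + Suc j) / P n" for n
        using pos[of "Suc n"] by (simp add: P_def)
      ultimately show ?case by (simp only:)
    qed (use fP0 in simp)
    have "(\<lambda>n. \<Sum>j<e. c j * (f (n + j) / P n)) \<longlonglongrightarrow> (\<Sum>j<e. c j * 0)"
      by (intro tendsto_sum tendsto_mult tendsto_const fP)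
    moreover have "(\<Sum>j<e. c j * (f (n + j) / P n)) = - c e" for n
    proof -
      have "(\<Sum>j<e. c j * (f (n + j) / P n)) = (\<Sum>j<e. c j * f (n + j)) / P n"
        by (simp add: sum_divide_distrib)
      also have "(\<Sum>j<e. c j * f (n + j)) = - c e * P n"
        using g0[of n] by (simp add: g_def eq_neg_iff_add_eq_0)
      finally show ?thesis using pos[of n] by (simp add: P_def)
    qed
    ultimately have "- c e = 0" by (simp add: LIMSEQ_const_iff)
    then show False using \<open>c e \<noteq> 0\<close> by simp
  qed
  then obtain n where n: "shift_poly D P n \<noteq> 0" by auto
  have "complex_of_real L = shift_poly D Q n / shift_poly D P n" using n by (simp add: eq)
  then have "algebraic (complex_of_real L)" using algebraic_divide[OF DQ_alg DP_alg] by metis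
  then show ?thesis by simp
qed

text \<open>Every shift of \<open>p\<close> is a combination of the \<open>y i n\<close> with
  coefficients \<open>b t i\<close> independent of \<open>n\<close>. The \<open>card I + 1\<close>
  coefficient vectors at the times \<open>m * k\<close> are dependent, and the dependency is a
  recurrence along the whole residue class.\<close>

lemma rat_recurrent_linear_system:
  fixes y :: "'i \<Rightarrow> nat \<Rightarrow> nat"
  assumes "finite I" "\<And>i n. i \<in> I \<Longrightarrow> y i (Suc n) = (\<Sum>j\<in>I. A i j * y j n)"
    and p: "\<And>n. p n = (\<Sum>i\<in>I. u i * y i n)"
  shows "rat_recurrent (\<lambda>n. p (m * n + r))"
proof -
  have "\<exists>b. \<forall>n. p (n + t) = (\<Sum>i\<in>I. b i * y i n)" for t
  proof (induction t)
    case (Suc t)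
    then obtain b where b: "\<And>n. p (n + t) = (\<Sum>i\<in>I. b i * y i n)" by auto
    have "p (n + Suc t) = (\<Sum>j\<in>I. (\<Sum>i\<in>I. b i * A i j) * y j n)" for n
    proof -
      have "p (n + Suc t) = (\<Sum>i\<in>I. b i * y i (Suc n))" using b[of "Suc n"] by simp
      also have "\<dots> = (\<Sum>i\<in>I. \<Sum>j\<in>I. b i * A i j * y j n)"
        by (intro sum.cong) (auto simp: assms(2) sum_distrib_left mult.assoc)
      also have "\<dots> = (\<Sum>j\<in>I. \<Sum>i\<in>I. b i * A i j * y j n)" by (rule sum.swap)
      finally show ?thesis by (simp add: sum_distrib_right)
    qed
    then show ?case by (intro exI[of _ "\<lambda>j. \<Sum>i\<in>I. b i * A i j"]) auto
  qed (use p in auto)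
  then obtain b where b: "\<And>t n. p (n + t) = (\<Sum>i\<in>I. b t i * y i n)" by metis
  obtain c :: "nat \<Rightarrow> rat" where c: "\<exists>k\<in>{..card I}. c k \<noteq> 0"
    "\<And>i. i \<in> I \<Longrightarrow> (\<Sum>k\<le>card I. of_nat (b (m * k) i) * c k) = 0"
    using homogeneous_system_nontrivial[of I "{..card I}" "\<lambda>i k. of_nat (b (m * k) i) :: rat"] assms(1)
    by auto
  have "(\<Sum>k\<le>card I. c k * of_nat (p (m * (n + k) + r))) = 0" for n
  proof -
    have "p (m * (n + k) + r) = (\<Sum>i\<in>I. b (m * k) i * y i (m * n + r))" for k
      using b[of "m * n + r" "m * k"] by (simp add: algebra_simps)
    then have "(\<Sum>k\<le>card I. c k * of_nat (p (m * (n + k) + r)))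
      = (\<Sum>k\<le>card I. \<Sum>i\<in>I. of_nat (y i (m * n + r)) * (of_nat (b (m * k) i) * c k))"
      by (simp add: sum_distrib_left mult_ac)
    also have "\<dots> = (\<Sum>i\<in>I. \<Sum>k\<le>card I. of_nat (y i (m * n + r)) * (of_nat (b (m * k) i) * c k))"
      by (rule sum.swap)
    also have "\<dots> = 0" using c(2) by (simp add: sum_distrib_left[symmetric])
    finally show ?thesis .
  qed
  then show ?thesis using c(1) unfolding rat_recurrent_def by auto
qed

section \<open>Sequences of polynomial-exponential growth\<close>

lemma tendsto_power_times_geometric:
  fixes x :: real
  assumes "0 \<le> x" "x < 1"
  shows "(\<lambda>n. real n ^ k * x ^ n) \<longlonglongrightarrow> 0"
proof (cases "k = 0")
  case True
  then show ?thesis using assms by (auto intro: LIMSEQ_power_zero)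
next
  case False
  \<comment> \<open>Taking \<open>k\<close>-th roots reduces the claim to the \<open>k\<close>-th
    power of the sequence \<open>n * y ^ n\<close>.\<close>
  define y where "y = root k x"
  have y: "0 \<le> y" "y < 1" "y ^ k = x" using False assms by (auto simp: y_def)
  have "(\<lambda>n. real n * y ^ n) \<longlonglongrightarrow> 0"
    using powser_times_n_limit_0[of y] y by simp
  then have "(\<lambda>n. (real n * y ^ n) ^ k) \<longlonglongrightarrow> 0 ^ k" by (rule tendsto_power)
  moreover have "(real n * y ^ n) ^ k = real n ^ k * x ^ n" for n
    using y(3) by (simp add: power_mult_distrib power_mult[symmetric] mult.commute[of n k])
      (metis power_mult)
  ultimately show ?thesis using False by (simp add: zero_power)
qed

text \<open>Asymptotic equivalence with \<open>C * n ^ k * \<theta> ^ n\<close>. The constant is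
  strictly positive, so the pairs of \<open>\<theta>\<close> and \<open>k\<close>, ordered
  lexicographically, compare the growth of two sequences.\<close>

definition grows :: "(nat \<Rightarrow> real) \<Rightarrow> real \<Rightarrow> nat \<Rightarrow> real \<Rightarrow> bool" where
  "grows f C k \<theta> \<longleftrightarrow> C > 0 \<and> \<theta> > 0 \<and> (\<lambda>n. f n / (real n ^ k * \<theta> ^ n)) \<longlonglongrightarrow> C"

text \<open>Because leading constants are positive, sums cannot cancel and the class is closed under
  addition. Eventually zero sequences form a case of their own, since \<open>C = 0\<close> would
  carry no information about the growth.\<close>

definition regular :: "(nat \<Rightarrow> real) \<Rightarrow> bool" where
  "regular f \<longleftrightarrow> (\<forall>\<^sub>F n in sequentially. f n = 0) \<or> (\<exists>C k \<theta>. grows f C k \<theta>)"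

lemma regular_cong:
  assumes "\<forall>\<^sub>F n in sequentially. f n = g n" "regular f"
  shows "regular g"
proof -
  from assms(2) consider "\<forall>\<^sub>F n in sequentially. f n = 0" | C k \<theta> where "grows f C k \<theta>"
    by (auto simp: regular_def)
  then show ?thesis
  proof cases
    case 1
    then have "\<forall>\<^sub>F n in sequentially. g n = 0" using assms(1) by eventually_elim simp
    then show ?thesis by (simp add: regular_def)
  next
    case 2
    have ev: "\<forall>\<^sub>F n in sequentially. f n / (real n ^ k * \<theta> ^ n) = g n / (real n ^ k * \<theta> ^ n)"
      using assms(1) by eventually_elim simp
    then have "grows g C k \<theta>" using 2 tendsto_cong[OF ev, of C] unfolding grows_def by blast
    then show ?thesis by (auto simp: regular_def)
  qed
qed

lemma regular_eventually_0: "\<forall>\<^sub>F n in sequentially. f n = 0 \<Longrightarrow> regular f"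
  by (simp add: regular_def)

lemma regular_0 [simp]: "regular (\<lambda>_. 0)"
  by (simp add: regular_def)

lemma regular_cmult:
  assumes "c \<ge> 0" "regular f"
  shows "regular (\<lambda>n. c * f n)"
proof (cases "c = 0")
  case False
  from assms(2) consider "\<forall>\<^sub>F n in sequentially. f n = 0" | C k \<theta> where "grows f C k \<theta>"
    by (auto simp: regular_def)
  then show ?thesis
  proof cases
    case 1
    then show ?thesis by (intro regular_eventually_0) (auto elim: eventually_mono)
  next
    case 2
    have "(\<lambda>n. c * (f n / (real n ^ k * \<theta> ^ n))) \<longlonglongrightarrow> c * C"
      using 2 by (intro tendsto_mult) (auto simp: grows_def)
    then have "grows (\<lambda>n. c * f n) (c * C) k \<theta>" using 2 assms(1) False by (auto simp: grows_def)
    then show ?thesis by (auto simp: regular_def)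
  qed
qed simp

lemma growth_rate_cases:
  fixes \<theta> \<rho> :: real
  obtains "\<rho> < \<theta> \<or> \<rho> = \<theta> \<and> l < k" | "\<rho> = \<theta>" "k = (l::nat)" | "\<theta> < \<rho> \<or> \<rho> = \<theta> \<and> k < l"
  by linarith

lemma growth_rate_little_o:
  fixes \<theta> \<rho> :: real
  assumes "\<rho> > 0" "\<theta> > 0" "\<rho> < \<theta> \<or> \<rho> = \<theta> \<and> l < k"
  shows "(\<lambda>n. real n ^ l * \<rho> ^ n / (real n ^ k * \<theta> ^ n)) \<longlonglongrightarrow> 0"
  using assms(3)
proof
  assume less: "\<rho> < \<theta>"
  have "(\<lambda>n. real n ^ l * (\<rho> / \<theta>) ^ n) \<longlonglongrightarrow> 0"
    using less assms by (intro tendsto_power_times_geometric) auto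
  then show ?thesis
  proof (rule Lim_null_comparison[rotated])
    show "\<forall>\<^sub>F n in sequentially. norm (real n ^ l * \<rho> ^ n / (real n ^ k * \<theta> ^ n)) \<le> real n ^ l * (\<rho> / \<theta>) ^ n"
      using eventually_gt_at_top[of 0]
    proof eventually_elim
      case (elim n)
      have "1 * (real n ^ l * (\<rho> / \<theta>) ^ n) \<le> real n ^ k * (real n ^ l * (\<rho> / \<theta>) ^ n)"
        using elim assms by (intro mult_right_mono) auto
      then have "real n ^ l * (\<rho> / \<theta>) ^ n / real n ^ k \<le> real n ^ l * (\<rho> / \<theta>) ^ n"
        using elim by (simp add: divide_le_eq mult.commute)
      then show ?case using assms elim by (simp add: power_divide mult.commute)
    qed
  qed
next
  assume eq: "\<rho> = \<theta> \<and> l < k"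
  have "(\<lambda>n. inverse (real n) ^ (k - l)) \<longlonglongrightarrow> 0 ^ (k - l)"
    by (intro tendsto_power lim_inverse_n)
  moreover have "(0::real) ^ (k - l) = 0" using eq by simp
  ultimately have "(\<lambda>n. inverse (real n) ^ (k - l)) \<longlonglongrightarrow> 0" by (simp only:)
  then show ?thesis
  proof (rule Lim_transform_eventually)
    show "\<forall>\<^sub>F n in sequentially. inverse (real n) ^ (k - l) = real n ^ l * \<rho> ^ n / (real n ^ k * \<theta> ^ n)"
      using eventually_gt_at_top[of 0]
    proof eventually_elim
      case (elim n)
      have "real n ^ k = real n ^ l * real n ^ (k - l)"
        using eq by (simp add: power_add[symmetric])
      then show ?case using eq elim assms by (simp add: field_simps)
    qed
  qed
qed

lemma grows_little_o:
  assumes "grows f C k \<theta>" "grows g D l \<rho>" "\<rho> < \<theta> \<or> \<rho> = \<theta> \<and> l < k"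
  shows "(\<lambda>n. g n / (real n ^ k * \<theta> ^ n)) \<longlonglongrightarrow> 0"
proof -
  have "(\<lambda>n. g n / (real n ^ l * \<rho> ^ n) * (real n ^ l * \<rho> ^ n / (real n ^ k * \<theta> ^ n))) \<longlonglongrightarrow> D * 0"
    using assms by (intro tendsto_mult growth_rate_little_o) (auto simp: grows_def)
  then have "(\<lambda>n. g n / (real n ^ l * \<rho> ^ n) * (real n ^ l * \<rho> ^ n / (real n ^ k * \<theta> ^ n))) \<longlonglongrightarrow> 0"
    by simp
  then show ?thesis
  proof (rule Lim_transform_eventually)
    show "\<forall>\<^sub>F n in sequentially. g n / (real n ^ l * \<rho> ^ n) * (real n ^ l * \<rho> ^ n / (real n ^ k * \<theta> ^ n)) =
        g n / (real n ^ k * \<theta> ^ n)"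
      using eventually_gt_at_top[of 0] by eventually_elim (use assms in \<open>auto simp: grows_def\<close>)
  qed
qed

lemma grows_add_little_o:
  assumes "grows f C k \<theta>" "grows g D l \<rho>" "\<rho> < \<theta> \<or> \<rho> = \<theta> \<and> l < k"
  shows "grows (\<lambda>n. f n + g n) C k \<theta>"
  using tendsto_add[of _ C, OF _ grows_little_o[OF assms]] assms(1)
  by (simp add: grows_def add_divide_distrib)

lemma regular_add:
  assumes "regular f" "regular g"
  shows "regular (\<lambda>n. f n + g n)"
proof (cases "(\<forall>\<^sub>F n in sequentially. f n = 0) \<or> (\<forall>\<^sub>F n in sequentially. g n = 0)")
  case True
  then show ?thesis
  proof
    assume "\<forall>\<^sub>F n in sequentially. f n = 0"
    then have "\<forall>\<^sub>F n in sequentially. g n = f n + g n" by eventually_elim simp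
    then show ?thesis using assms(2) by (rule regular_cong)
  next
    assume "\<forall>\<^sub>F n in sequentially. g n = 0"
    then have "\<forall>\<^sub>F n in sequentially. f n = f n + g n" by eventually_elim simp
    then show ?thesis using assms(1) by (rule regular_cong)
  qed
next
  case False
  then obtain C k \<theta> D l \<rho> where g: "grows f C k \<theta>" "grows g D l \<rho>"
    using assms by (auto simp: regular_def)
  show ?thesis
  proof (cases \<rho> \<theta> l k rule: growth_rate_cases)
    case 1
    then show ?thesis using grows_add_little_o[OF g] by (auto simp: regular_def)
  next
    case 2
    have "grows (\<lambda>n. f n + g n) (C + D) k \<theta>"
      using g 2 tendsto_add[of "\<lambda>n. f n / (real n ^ k * \<theta> ^ n)" C] 
      by (auto simp: grows_def add_divide_distrib)
    then show ?thesis by (auto simp: regular_def)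
  next
    case 3
    then have "grows (\<lambda>n. g n + f n) D l \<rho>" using grows_add_little_o[OF g(2,1)] by auto
    then show ?thesis by (auto simp: regular_def add.commute)
  qed
qed

lemma regular_sum:
  assumes "\<And>i. i \<in> I \<Longrightarrow> regular (f i)"
  shows "regular (\<lambda>n. \<Sum>i\<in>I. f i n)"
  using assms by (induction I rule: infinite_finite_induct) (auto intro: regular_add)

lemma filterlim_affine: "m > 0 \<Longrightarrow> filterlim (\<lambda>n. m * n + r :: nat) at_top sequentially"
proof -
  assume "m > 0"
  then have "strict_mono (\<lambda>n. m * n + r)" by (auto simp: strict_mono_def)
  then show ?thesis by (rule filterlim_subseq)
qed

lemma regular_section:
  assumes "regular f" "m > 0"
  shows "regular (\<lambda>n. f (m * n + r))"
proof -
  note lim = filterlim_affine[OF assms(2), of r]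
  from assms(1) consider "\<forall>\<^sub>F n in sequentially. f n = 0" | C k \<theta> where "grows f C k \<theta>"
    by (auto simp: regular_def)
  then show ?thesis
  proof cases
    case 1
    then show ?thesis by (intro regular_eventually_0 eventually_compose_filterlim[OF _ lim])
  next
    case 2
    have "(\<lambda>n. f (m * n + r) / (real (m * n + r) ^ k * \<theta> ^ (m * n + r))) \<longlonglongrightarrow> C"
      using 2 filterlim_compose[OF _ lim] by (fastforce simp: grows_def)
    moreover have "(\<lambda>n. (real m + real r * inverse (real n)) ^ k) \<longlonglongrightarrow> (real m + real r * 0) ^ k"
      by (intro tendsto_intros lim_inverse_n)
    ultimately have "(\<lambda>n. f (m * n + r) / (real (m * n + r) ^ k * \<theta> ^ (m * n + r)) *
        (real m + real r * inverse (real n)) ^ k * \<theta> ^ r) \<longlonglongrightarrow> C * (real m + real r * 0) ^ k * \<theta> ^ r"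
      by (intro tendsto_mult tendsto_const)
    then have "(\<lambda>n. f (m * n + r) / (real n ^ k * (\<theta> ^ m) ^ n)) \<longlonglongrightarrow> C * (real m + real r * 0) ^ k * \<theta> ^ r"
    proof (rule Lim_transform_eventually)
      show "\<forall>\<^sub>F n in sequentially. f (m * n + r) / (real (m * n + r) ^ k * \<theta> ^ (m * n + r)) *
          (real m + real r * inverse (real n)) ^ k * \<theta> ^ r = f (m * n + r) / (real n ^ k * (\<theta> ^ m) ^ n)"
        using eventually_gt_at_top[of 0]
      proof eventually_elim
        case (elim n)
        have 1: "real m + real r * inverse (real n) = real (m * n + r) / real n"
          using elim by (simp add: field_simps)
        have 2: "\<theta> ^ (m * n + r) = (\<theta> ^ m) ^ n * \<theta> ^ r"
          by (simp add: power_add power_mult)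
        have "m * n + r > 0" using elim assms by simp
        define R where "R = real (m * n + r)"
        have "R > 0" using \<open>m * n + r > 0\<close> by (simp only: R_def of_nat_0_less_iff)
        moreover have "\<theta> > 0" using \<open>grows f C k \<theta>\<close> by (simp add: grows_def)
        ultimately show ?case unfolding 1 2 power_divide R_def[symmetric] by (simp add: field_simps)
      qed
    qed
    then have "grows (\<lambda>n. f (m * n + r)) (C * real m ^ k * \<theta> ^ r) k (\<theta> ^ m)"
      using 2 assms(2) by (simp add: grows_def)
    then show ?thesis by (auto simp: regular_def)
  qed
qed

lemma regular_unshift:
  assumes "regular (\<lambda>n. f (Suc n))"
  shows "regular f"
proof -
  from assms consider "\<forall>\<^sub>F n in sequentially. f (Suc n) = 0" | C k \<theta> where "grows (\<lambda>n. f (Suc n)) C k \<theta>"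
    by (auto simp: regular_def)
  then show ?thesis
  proof cases
    case 1
    then have "\<forall>\<^sub>F n in sequentially. f n = 0" by (simp add: eventually_sequentially_Suc[of "\<lambda>n. f n = 0"])
    then show ?thesis by (rule regular_eventually_0)
  next
    case 2
    have "(\<lambda>n. f (Suc n) / (real n ^ k * \<theta> ^ n) * (real n / real (Suc n)) ^ k / \<theta>) \<longlonglongrightarrow> C * 1 ^ k / \<theta>"
      using 2 by (intro tendsto_mult tendsto_divide tendsto_power tendsto_const LIMSEQ_n_over_Suc_n)
        (auto simp: grows_def)
    then have "(\<lambda>n. f (Suc n) / (real (Suc n) ^ k * \<theta> ^ Suc n)) \<longlonglongrightarrow> C * 1 ^ k / \<theta>"
    proof (rule Lim_transform_eventually)
      show "\<forall>\<^sub>F n in sequentially. f (Suc n) / (real n ^ k * \<theta> ^ n) * (real n / real (Suc n)) ^ k / \<theta>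
          = f (Suc n) / (real (Suc n) ^ k * \<theta> ^ Suc n)"
        using eventually_gt_at_top[of 0]
        by eventually_elim (simp add: power_divide del: of_nat_Suc)
    qed
    then have "(\<lambda>n. f n / (real n ^ k * \<theta> ^ n)) \<longlonglongrightarrow> C * 1 ^ k / \<theta>"
      by (rule LIMSEQ_imp_Suc)
    then have "grows f (C / \<theta>) k \<theta>" using 2 by (simp add: grows_def)
    then show ?thesis by (auto simp: regular_def)
  qed
qed

lemma regular_delay: "regular f \<Longrightarrow> regular (\<lambda>n. if n < i then 0 else f (n - i))"
proof (induction i)
  case (Suc i)
  then show ?case
    by (intro regular_unshift[of "\<lambda>n. if n < Suc i then 0 else f (n - Suc i)"]) (simp cong: if_cong)
qed simp

lemma grows_eventually_bounds:
  assumes "grows f C k \<theta>"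
  shows "\<forall>\<^sub>F n in sequentially. C / 2 * (real n ^ k * \<theta> ^ n) \<le> f n \<and> f n \<le> 2 * C * (real n ^ k * \<theta> ^ n)"
proof -
  have lim: "(\<lambda>n. f n / (real n ^ k * \<theta> ^ n)) \<longlonglongrightarrow> C" and pos: "C > 0" "\<theta> > 0"
    using assms by (auto simp: grows_def)
  have "\<forall>\<^sub>F n in sequentially. C / 2 < f n / (real n ^ k * \<theta> ^ n)"
    using pos by (intro order_tendstoD[OF lim]) auto
  moreover have "\<forall>\<^sub>F n in sequentially. f n / (real n ^ k * \<theta> ^ n) < 2 * C"
    using pos by (intro order_tendstoD[OF lim]) auto
  ultimately show ?thesis using eventually_gt_at_top[of 0]
  proof eventually_elim
    case (elim n)
    have "real n ^ k * \<theta> ^ n > 0" using elim pos by simp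
    then show ?case using elim by (auto simp: field_simps)
  qed
qed

text \<open>The factor \<open>Suc n\<close> instead of \<open>n\<close> keeps the bound positive at
  \<open>n = 0\<close>; the finitely many terms before the asymptotic regime are absorbed into
  \<open>M\<close>.\<close>

lemma grows_bound:
  assumes "grows f C k \<theta>"
  obtains M where "M > 0" "\<And>n. f n \<le> M * (real (Suc n) ^ k * \<theta> ^ n)"
proof -
  have pos: "C > 0" "\<theta> > 0" using assms by (auto simp: grows_def)
  obtain N where N: "\<And>n. n \<ge> N \<Longrightarrow> f n \<le> 2 * C * (real n ^ k * \<theta> ^ n)"
    using grows_eventually_bounds[OF assms] by (auto simp: eventually_sequentially)
  define M where "M = 2 * C + (\<Sum>n<N. \<bar>f n\<bar> / \<theta> ^ n)"
  have s: "(\<Sum>n<N. \<bar>f n\<bar> / \<theta> ^ n) \<ge> 0" using pos by (intro sum_nonneg) auto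
  have "f n \<le> M * (real (Suc n) ^ k * \<theta> ^ n)" for n
  proof (cases "n < N")
    case True
    have "\<bar>f n\<bar> / \<theta> ^ n \<le> (\<Sum>n<N. \<bar>f n\<bar> / \<theta> ^ n)"
      using True pos by (intro member_le_sum) auto
    also have "\<dots> \<le> M" using pos by (simp add: M_def)
    finally have "\<bar>f n\<bar> \<le> M * \<theta> ^ n" using pos by (simp add: divide_le_eq)
    also have "\<dots> \<le> M * (real (Suc n) ^ k * \<theta> ^ n)"
    proof -
      have "1 * \<theta> ^ n \<le> real (Suc n) ^ k * \<theta> ^ n" using pos by (intro mult_right_mono) auto
      then show ?thesis using pos s by (intro mult_left_mono) (auto simp: M_def)
    qed
    finally show ?thesis by linarith
  next
    case False
    then have "f n \<le> 2 * C * (real n ^ k * \<theta> ^ n)" using N by simp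
    also have "\<dots> \<le> M * (real (Suc n) ^ k * \<theta> ^ n)"
      using pos s by (intro mult_mono power_mono) (auto simp: M_def)
    finally show ?thesis .
  qed
  moreover have "M > 0" using pos s by (simp add: M_def)
  ultimately show ?thesis by (intro that[of M])
qed

section \<open>Convolutions\<close>

definition convolution :: "(nat \<Rightarrow> real) \<Rightarrow> (nat \<Rightarrow> real) \<Rightarrow> nat \<Rightarrow> real" where
  "convolution f g n = (\<Sum>i\<le>n. f i * g (n - i))"

lemma convolution_commute: "convolution f g = convolution g f"
proof
  fix n
  have "(\<Sum>i\<le>n. f i * g (n - i)) = (\<Sum>i\<le>n. g i * f (n - i))"
    by (rule sum.reindex_bij_witness[of _ "\<lambda>i. n - i" "\<lambda>i. n - i"]) (auto simp: mult.commute)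
  then show "convolution f g n = convolution g f n" by (simp add: convolution_def)
qed

lemma regular_convolution_finite:
  assumes "\<forall>\<^sub>F n in sequentially. f n = 0" "regular g" "\<And>n. f n \<ge> 0"
  shows "regular (convolution f g)"
proof -
  obtain N where N: "\<And>n. n \<ge> N \<Longrightarrow> f n = 0" using assms(1) by (auto simp: eventually_sequentially)
  have "regular (\<lambda>n. \<Sum>i<N. f i * (if n < i then 0 else g (n - i)))"
    using assms by (intro regular_sum regular_cmult regular_delay) auto
  moreover have "convolution f g = (\<lambda>n. \<Sum>i<N. f i * (if n < i then 0 else g (n - i)))"
  proof
    fix n
    have "convolution f g n = (\<Sum>i\<le>n. f i * (if n < i then 0 else g (n - i)))"
      by (simp add: convolution_def)
    also have "\<dots> = (\<Sum>i\<le>n + N. f i * (if n < i then 0 else g (n - i)))"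
      by (intro sum.mono_neutral_left) auto
    also have "\<dots> = (\<Sum>i<N. f i * (if n < i then 0 else g (n - i)))"
      by (intro sum.mono_neutral_right) (auto simp: N)
    finally show "convolution f g n = (\<Sum>i<N. f i * (if n < i then 0 else g (n - i)))" .
  qed
  ultimately show ?thesis by simp
qed

text \<open>Divided by \<open>n ^ k * \<theta> ^ n\<close>, the \<open>j\<close>-th term of the
  convolution tends to \<open>C * g j / \<theta> ^ j\<close>, and these limits are summable since
  \<open>g\<close> has the smaller rate. Dominated convergence, in the form of Tannery's theorem,
  allows the limit to be taken termwise.\<close>

lemma grows_convolution_less:
  assumes f: "grows f C k \<theta>" and g: "grows g D l \<rho>" and "\<rho> < \<theta>"
    and nn: "\<And>n. f n \<ge> 0" "\<And>n. g n \<ge> 0"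
  shows "\<exists>E. grows (convolution f g) E k \<theta>"
proof -
  have pos: "C > 0" "D > 0" "\<theta> > 0" "\<rho> > 0" using f g by (auto simp: grows_def)
  obtain M where M: "M > 0" "\<And>n. f n \<le> M * (real (Suc n) ^ k * \<theta> ^ n)" using grows_bound[OF f] by blast
  obtain M' where M': "M' > 0" "\<And>n. g n \<le> M' * (real (Suc n) ^ l * \<rho> ^ n)" using grows_bound[OF g] by blast
  have summ: "summable (\<lambda>j. g j / \<theta> ^ j)"
  proof -
    \<comment> \<open>Any ratio strictly between \<open>\<rho> / \<theta>\<close> and 1 serves: the
      gap to \<open>\<rho> / \<theta>\<close> absorbs the polynomial factor, the gap to 1 gives a
      convergent geometric series.\<close>
    define x where "x = (\<rho> / \<theta> + 1) / 2"
    have x: "0 < x" "x < 1" "\<rho> / \<theta> < x" using pos \<open>\<rho> < \<theta>\<close> by (auto simp: x_def field_simps)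
    have "(\<lambda>n. real n ^ l * (\<rho> / \<theta> / x) ^ n) \<longlonglongrightarrow> 0"
    proof (intro tendsto_power_times_geometric)
      show "\<rho> / \<theta> / x < 1" using x by (subst divide_less_eq_1_pos) auto
    qed (use x pos in auto)
    from LIMSEQ_Suc[OF this] have lim0: "(\<lambda>n. real (Suc n) ^ l * (\<rho> / \<theta> / x) ^ Suc n) \<longlonglongrightarrow> 0" .
    then have "\<forall>\<^sub>F n in sequentially. real (Suc n) ^ l * (\<rho> / \<theta> / x) ^ Suc n < \<rho> / \<theta> / x"
      using pos x by (intro order_tendstoD(2)[OF lim0]) auto
    then have "\<forall>\<^sub>F n in sequentially. norm (g n / \<theta> ^ n) \<le> M' * x ^ n"
    proof eventually_elim
      case (elim n)
      have "(real (Suc n) ^ l * (\<rho> / \<theta> / x) ^ n) * (\<rho> / \<theta> / x) < 1 * (\<rho> / \<theta> / x)"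
        using elim by (simp add: mult_ac)
      then have 1: "real (Suc n) ^ l * (\<rho> / \<theta> / x) ^ n < 1"
        using pos x by (subst (asm) mult_less_cancel_right_pos) auto
      have "g n / \<theta> ^ n \<le> M' * (real (Suc n) ^ l * \<rho> ^ n) / \<theta> ^ n"
        using M'(2) pos by (intro divide_right_mono) auto
      also have "\<dots> = M' * x ^ n * (real (Suc n) ^ l * (\<rho> / \<theta> / x) ^ n)"
        using pos x by (simp add: power_divide power_mult_distrib)
      also have "\<dots> \<le> M' * x ^ n * 1" using 1 M' x by (intro mult_left_mono) auto
      finally show ?case using nn pos by simp
    qed
    moreover have "summable (\<lambda>n. M' * x ^ n)" using x by (intro summable_mult summable_geometric) auto
    ultimately show ?thesis by (rule summable_comparison_test_ev)
  qed
  define t where "t n j = (if j \<le> n then f (n - j) / (real n ^ k * \<theta> ^ (n - j)) * (g j / \<theta> ^ j) else 0)" for n j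
  have lim: "((\<lambda>n. t n j) \<longlongrightarrow> C * (g j / \<theta> ^ j)) sequentially" for j
  proof -
    have "(\<lambda>n. f n / (real n ^ k * \<theta> ^ n) * (real n / (real n + real j)) ^ k) \<longlonglongrightarrow> C * 1 ^ k"
    proof (intro tendsto_mult tendsto_power)
      show "(\<lambda>n. real n / (real n + real j)) \<longlonglongrightarrow> 1" by real_asymp
    qed (use f in \<open>auto simp: grows_def\<close>)
    then have "(\<lambda>n. f n / (real (n + j) ^ k * \<theta> ^ n)) \<longlonglongrightarrow> C * 1 ^ k"
    proof (rule Lim_transform_eventually)
      show "\<forall>\<^sub>F n in sequentially. f n / (real n ^ k * \<theta> ^ n) * (real n / (real n + real j)) ^ k
         = f n / (real (n + j) ^ k * \<theta> ^ n)"
        using eventually_gt_at_top[of 0] by eventually_elim (simp add: power_divide)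
    qed
    then have "(\<lambda>n. f n / (real (n + j) ^ k * \<theta> ^ n) * (g j / \<theta> ^ j)) \<longlonglongrightarrow> C * 1 ^ k * (g j / \<theta> ^ j)"
      by (intro tendsto_mult tendsto_const)
    moreover have "t (n + j) j = f n / (real (n + j) ^ k * \<theta> ^ n) * (g j / \<theta> ^ j)" for n
      by (simp add: t_def)
    ultimately have "(\<lambda>n. t (n + j) j) \<longlonglongrightarrow> C * (g j / \<theta> ^ j)" by simp
    then show ?thesis by (rule LIMSEQ_offset)
  qed
  \<comment> \<open>The factor \<open>2 ^ k\<close> comes from
    \<open>Suc (n - j) \<le> 2 * n\<close> for \<open>n \<ge> 1\<close>.\<close>
  have bound: "\<forall>\<^sub>F (j, n) in at_top \<times>\<^sub>F at_top. norm (t n j) \<le> M * 2 ^ k * (g j / \<theta> ^ j)"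
  proof -
    have "norm (t n j) \<le> M * 2 ^ k * (g j / \<theta> ^ j)" if "n \<ge> 1" for n j
    proof (cases "j \<le> n")
      case True
      have "f (n - j) / (real n ^ k * \<theta> ^ (n - j)) \<le> M * (real (Suc (n - j)) ^ k * \<theta> ^ (n - j)) / (real n ^ k * \<theta> ^ (n - j))"
        using M(2) pos by (intro divide_right_mono) auto
      also have "\<dots> = M * (real (Suc (n - j)) / real n) ^ k" using pos by (simp add: power_divide)
      also have "\<dots> \<le> M * 2 ^ k"
        using M(1) that True by (intro mult_left_mono power_mono) (auto simp: divide_le_eq)
      finally have "f (n - j) / (real n ^ k * \<theta> ^ (n - j)) * (g j / \<theta> ^ j) \<le> M * 2 ^ k * (g j / \<theta> ^ j)"
        using nn pos by (intro mult_right_mono) auto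
      moreover have "t n j \<ge> 0" using nn pos by (simp add: t_def)
      ultimately show ?thesis using True by (simp add: t_def)
    qed (use nn pos M in \<open>auto simp: t_def\<close>)
    then have "\<forall>\<^sub>F (j, n) in at_top \<times>\<^sub>F at_top. n \<ge> (1::nat) \<longrightarrow> norm (t n j) \<le> M * 2 ^ k * (g j / \<theta> ^ j)"
      by (intro always_eventually) auto
    moreover have "\<forall>\<^sub>F (j::nat, n) in at_top \<times>\<^sub>F at_top. n \<ge> (1::nat)"
      using eventually_prod2[of "at_top :: nat filter" "\<lambda>n. n \<ge> (1::nat)" at_top]
      by (simp add: case_prod_beta eventually_ge_at_top)
    ultimately show ?thesis by eventually_elim auto
  qed
  have "((\<lambda>n. suminf (t n)) \<longlongrightarrow> (\<Sum>j. C * (g j / \<theta> ^ j))) sequentially"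
    using tannerys_theorem[OF lim bound summable_mult[OF summ] sequentially_bot] by blast
  moreover have "suminf (t n) = convolution f g n / (real n ^ k * \<theta> ^ n)" for n
  proof -
    have "suminf (t n) = (\<Sum>j\<le>n. t n j)" by (intro suminf_finite) (auto simp: t_def)
    also have "\<dots> = (\<Sum>j\<le>n. g j * f (n - j) / (real n ^ k * \<theta> ^ n))"
    proof (intro sum.cong refl)
      fix j assume "j \<in> {..n}"
      then have j: "j \<le> n" by simp
      have "\<theta> ^ n = \<theta> ^ (n - j) * \<theta> ^ j" using j by (simp add: power_add[symmetric])
      then show "t n j = g j * f (n - j) / (real n ^ k * \<theta> ^ n)" using j by (simp add: t_def mult_ac)
    qed
    also have "\<dots> = convolution g f n / (real n ^ k * \<theta> ^ n)"
      by (simp add: convolution_def sum_divide_distrib)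
    finally show ?thesis by (simp add: convolution_commute[of f])
  qed
  moreover have "(\<Sum>j. C * (g j / \<theta> ^ j)) > 0"
  proof -
    obtain j where j: "D / 2 * (real j ^ l * \<rho> ^ j) \<le> g j" "j > 0"
      using eventually_conj[OF grows_eventually_bounds[OF g] eventually_gt_at_top[of 0]]
      by (auto simp: eventually_sequentially)
    have "0 < D / 2 * (real j ^ l * \<rho> ^ j)" using pos j by simp
    then have "g j > 0" using j by linarith
    then show ?thesis using pos nn summ
      by (intro suminf_pos2[where i = j] summable_mult) auto
  qed
  ultimately show ?thesis using pos by (auto simp: grows_def)
qed

text \<open>The averaging principle of Toeplitz: the mass on any fixed finite set of indices
  vanishes, and beyond it \<open>e\<close> is small.\<close>

lemma tendsto_weighted_null:
  fixes w :: "nat \<Rightarrow> nat \<Rightarrow> real" and e :: "nat \<Rightarrow> real"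
  assumes nn: "\<And>n i. w n i \<ge> 0" and total: "\<And>n. (\<Sum>i\<le>n. w n i) \<le> 1"
    and null: "\<And>i. (\<lambda>n. w n i) \<longlonglongrightarrow> 0" and e: "e \<longlonglongrightarrow> 0"
  shows "(\<lambda>n. \<Sum>i\<le>n. w n i * e i) \<longlonglongrightarrow> 0"
proof (rule tendstoI)
  fix \<epsilon> :: real assume \<epsilon>: "\<epsilon> > 0"
  have "\<forall>\<^sub>F i in sequentially. norm (e i) < \<epsilon> / 2"
    using tendstoD[OF e, of "\<epsilon> / 2"] \<epsilon> by (simp add: dist_norm)
  then obtain N where N: "\<And>i. i \<ge> N \<Longrightarrow> norm (e i) < \<epsilon> / 2" by (auto simp: eventually_sequentially)
  have "(\<lambda>n. \<Sum>i<N. w n i * norm (e i)) \<longlonglongrightarrow> (\<Sum>i<N. 0 * norm (e i))"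
    by (intro tendsto_sum tendsto_mult null tendsto_const)
  then have "\<forall>\<^sub>F n in sequentially. (\<Sum>i<N. w n i * norm (e i)) < \<epsilon> / 2"
    using \<epsilon> by (intro order_tendstoD) auto
  then show "\<forall>\<^sub>F n in sequentially. dist (\<Sum>i\<le>n. w n i * e i) 0 < \<epsilon>"
  proof eventually_elim
    case (elim n)
    have "norm (\<Sum>i\<le>n. w n i * e i) \<le> (\<Sum>i\<le>n. w n i * norm (e i))"
      using nn by (intro order_trans[OF norm_sum] sum_mono) (auto simp: abs_mult)
    also have "\<dots> \<le> (\<Sum>i\<le>n. (if i < N then w n i * norm (e i) else 0) + w n i * (\<epsilon> / 2))"
    proof (intro sum_mono)
      fix i
      show "w n i * norm (e i) \<le> (if i < N then w n i * norm (e i) else 0) + w n i * (\<epsilon> / 2)"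
        using nn[of n i] \<epsilon> mult_left_mono[OF less_imp_le[OF N[of i]] nn[of n i]] by (cases "i < N") auto
    qed
    also have "\<dots> = (\<Sum>i\<le>n. if i < N then w n i * norm (e i) else 0) + (\<Sum>i\<le>n. w n i) * (\<epsilon> / 2)"
      by (simp add: sum.distrib sum_distrib_right sum_divide_distrib)
    also have "(\<Sum>i\<le>n. if i < N then w n i * norm (e i) else 0) \<le> (\<Sum>i<N. w n i * norm (e i))"
    proof -
      have "(\<Sum>i\<le>n. if i < N then w n i * norm (e i) else 0) = (\<Sum>i\<in>{..n} \<inter> {..<N}. w n i * norm (e i))"
        by (subst sum.inter_restrict) (auto intro: sum.cong)
      also have "\<dots> \<le> (\<Sum>i<N. w n i * norm (e i))" using nn by (intro sum_mono2) auto
      finally show ?thesis .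
    qed
    also have "(\<Sum>i\<le>n. w n i) * (\<epsilon> / 2) \<le> 1 * (\<epsilon> / 2)"
      using total \<epsilon> by (intro mult_right_mono) auto
    finally show ?case using elim by (simp add: dist_norm)
  qed
qed

lemma fps_choose_eq: "Abs_fps (\<lambda>n. real (n + k choose k)) = inverse (1 - fps_X) ^ Suc k"
proof (induction k)
  case 0
  have "(1 - fps_X) * Abs_fps (\<lambda>n. 1) = (1 :: real fps)"
    by (rule fps_ext) (auto simp: algebra_simps fps_X_mult_nth)
  then show ?case by (simp add: fps_inverse_unique[symmetric])
next
  case (Suc k)
  have "(1 - fps_X) * Abs_fps (\<lambda>n. real (n + Suc k choose Suc k)) = Abs_fps (\<lambda>n. real (n + k choose k))"
  proof (rule fps_ext)
    fix n
    show "fps_nth ((1 - fps_X) * Abs_fps (\<lambda>n. real (n + Suc k choose Suc k))) n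
        = fps_nth (Abs_fps (\<lambda>n. real (n + k choose k))) n"
      by (cases n) (simp_all add: left_diff_distrib)
  qed
  then have "inverse (1 - fps_X) * ((1 - fps_X) * Abs_fps (\<lambda>n. real (n + Suc k choose Suc k)))
      = inverse (1 - fps_X) ^ Suc (Suc k)"
    using Suc by simp
  moreover have "inverse (1 - fps_X) * (1 - fps_X) = (1 :: real fps)" by (rule inverse_mult_eq_1) simp
  ultimately show ?case by (simp add: mult.assoc[symmetric])
qed

text \<open>The coefficients of \<open>(1 - X) ^ -(k + 1)\<close> and
  \<open>(1 - X) ^ -(l + 1)\<close> convolve to those of the product. Up to the constant
  \<open>fact k\<close>, these binomials are an exact model for \<open>n ^ k\<close>.\<close>

lemma convolution_choose:
  "(\<Sum>i\<le>n. real (i + k choose k) * real (n - i + l choose l)) = real (n + (k + l + 1) choose (k + l + 1))"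
proof -
  have "Abs_fps (\<lambda>n. real (n + k choose k)) * Abs_fps (\<lambda>n. real (n + l choose l))
      = Abs_fps (\<lambda>n. real (n + (k + l + 1) choose (k + l + 1)))"
    unfolding fps_choose_eq by (simp add: power_add[symmetric] mult_ac)
  from arg_cong[OF this, of "\<lambda>F. fps_nth F n"] show ?thesis
    by (simp add: fps_mult_nth atLeast0AtMost)
qed

lemma choose_asymptotic: "(\<lambda>n. real (n + k choose k) / real n ^ k) \<longlonglongrightarrow> 1 / fact k"
proof (induction k)
  case (Suc k)
  have "(\<lambda>n. (real n + real (Suc k)) / (real n * real (Suc k))) \<longlonglongrightarrow> inverse (1 + real k)"
    by real_asymp
  then have "(\<lambda>n. real (n + k choose k) / real n ^ k * ((real n + real (Suc k)) / (real n * real (Suc k))))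
      \<longlonglongrightarrow> 1 / fact k * inverse (1 + real k)"
    by (intro tendsto_mult Suc)
  moreover have "real (n + k choose k) / real n ^ k * ((real n + real (Suc k)) / (real n * real (Suc k)))
     = real (n + Suc k choose Suc k) / real n ^ Suc k" for n
  proof -
    have "Suc k * (Suc (n + k) choose Suc k) = Suc (n + k) * (n + k choose k)"
      by (rule Suc_times_binomial_eq[symmetric, simplified mult.commute])
    then have "real (Suc k) * real (n + Suc k choose Suc k) = (real n + real (Suc k)) * real (n + k choose k)"
      by (metis add_Suc_right of_nat_add of_nat_mult)
    then have "real (n + Suc k choose Suc k) = (real n + real (Suc k)) * real (n + k choose k) / real (Suc k)"
      by (simp add: field_simps del: of_nat_Suc)
    then show ?thesis by (simp add: mult_ac del: of_nat_Suc)
  qed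
  ultimately show ?case by (simp add: mult.commute inverse_eq_divide)
qed simp

text \<open>At equal rates no term dominates, and the mass spreads over all splittings of
  \<open>n\<close>. With binomials in place of powers the model convolution is exact, so the weights
  \<open>w n i\<close> have total 1 and the quotient is an average of the products
  \<open>a i * b (n - i)\<close>. The exponent \<open>k + l + 1\<close> reflects that the pole
  orders \<open>k + 1\<close> and \<open>l + 1\<close> add.\<close>

lemma grows_convolution_eq:
  assumes f: "grows f C k \<theta>" and g: "grows g D l \<theta>"
  shows "\<exists>E. grows (convolution f g) E (k + l + 1) \<theta>"
proof -
  have pos: "C > 0" "D > 0" "\<theta> > 0" using f g by (auto simp: grows_def)
  define B where "B k n = real (n + k choose k)" for k n
  have B_pos: "B k n > 0" for k n by (simp add: B_def)
  have B_mono: "B k m \<le> B k n" if "m \<le> n" for k m n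
    unfolding B_def using that by (simp add: binomial_right_mono)
  define a b where "a n = f n / \<theta> ^ n / B k n" and "b n = g n / \<theta> ^ n / B l n" for n
  have quot: "(\<lambda>n. h n / \<theta> ^ n / B j n) \<longlonglongrightarrow> c * fact j" if "grows h c j \<theta>" for h c j
  proof -
    have "(\<lambda>n. h n / (real n ^ j * \<theta> ^ n) / (B j n / real n ^ j)) \<longlonglongrightarrow> c / (1 / fact j)"
      unfolding B_def
    proof (rule tendsto_divide[OF _ choose_asymptotic])
      show "(\<lambda>n. h n / (real n ^ j * \<theta> ^ n)) \<longlonglongrightarrow> c" using that by (simp add: grows_def)
    qed simp
    then have "(\<lambda>n. h n / \<theta> ^ n / B j n) \<longlonglongrightarrow> c / (1 / fact j)"
    proof (rule Lim_transform_eventually)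
      show "\<forall>\<^sub>F n in sequentially. h n / (real n ^ j * \<theta> ^ n) / (B j n / real n ^ j) = h n / \<theta> ^ n / B j n"
        using eventually_gt_at_top[of 0] by eventually_elim simp
    qed
    then show ?thesis by simp
  qed
  define A' B' where "A' = C * fact k" and "B' = D * fact l"
  have a: "a \<longlonglongrightarrow> A'" and b: "b \<longlonglongrightarrow> B'"
    using quot[OF f] quot[OF g] by (auto simp: a_def[abs_def] b_def[abs_def] A'_def B'_def)
  define w where "w n i = (if i \<le> n then B k i * B l (n - i) / B (k + l + 1) n else 0)" for n i
  have w_nn: "w n i \<ge> 0" for n i using B_pos by (simp add: w_def less_imp_le)
  have w_total: "(\<Sum>i\<le>n. w n i) = 1" for n
  proof -
    have "(\<Sum>i\<le>n. w n i) = (\<Sum>i\<le>n. B k i * B l (n - i)) / B (k + l + 1) n"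
      by (simp add: w_def sum_divide_distrib)
    also have "(\<Sum>i\<le>n. B k i * B l (n - i)) = B (k + l + 1) n"
      unfolding B_def by (rule convolution_choose)
    finally show ?thesis using B_pos[of "k + l + 1" n] by simp
  qed
  have B_ratio: "(\<lambda>n. B j n / B (k + l + 1) n) \<longlonglongrightarrow> 0" if "j < k + l + 1" for j
  proof -
    let ?J = "k + l + 1"
    have "(\<lambda>n. (B j n / real n ^ j) / (B ?J n / real n ^ ?J) * (real n ^ j * 1 ^ n / (real n ^ ?J * 1 ^ n))) \<longlonglongrightarrow>
      (1 / fact j) / (1 / fact ?J) * 0"
      using that unfolding B_def
      by (intro tendsto_mult tendsto_divide choose_asymptotic growth_rate_little_o) auto
    then have "(\<lambda>n. (B j n / real n ^ j) / (B ?J n / real n ^ ?J) * (real n ^ j * 1 ^ n / (real n ^ ?J * 1 ^ n))) \<longlonglongrightarrow> 0"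
      by simp
    then show ?thesis
    proof (rule Lim_transform_eventually)
      show "\<forall>\<^sub>F n in sequentially. (B j n / real n ^ j) / (B ?J n / real n ^ ?J) * (real n ^ j * 1 ^ n / (real n ^ ?J * 1 ^ n))
          = B j n / B ?J n"
        using eventually_gt_at_top[of 0] by eventually_elim (simp add: field_simps)
    qed
  qed
  have w_null: "(\<lambda>n. w n i) \<longlonglongrightarrow> 0" for i
  proof (rule Lim_null_comparison)
    show "(\<lambda>n. B k i * (B l n / B (k + l + 1) n)) \<longlonglongrightarrow> 0"
      using tendsto_mult[OF tendsto_const B_ratio[of l], of "B k i"] by simp
    have "norm (w n i) \<le> B k i * (B l n / B (k + l + 1) n)" for n
    proof (cases "i \<le> n")
      case True
      have "B k i * B l (n - i) / B (k + l + 1) n \<le> B k i * B l n / B (k + l + 1) n"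
        using B_pos B_mono by (intro divide_right_mono mult_left_mono) (auto intro: less_imp_le)
      then show ?thesis using True w_nn[of n i] by (simp add: w_def)
    next
      case False
      then show ?thesis using B_pos by (simp add: w_def less_imp_le)
    qed
    then show "\<forall>\<^sub>F n in sequentially. norm (w n i) \<le> B k i * (B l n / B (k + l + 1) n)"
      by (intro always_eventually) auto
  qed
  \<comment> \<open>The reflected weights: \<open>b\<close> is read at \<open>n - i\<close>, so the
    mass has to vanish also at each fixed index counted from the other end.\<close>
  define w' where "w' n i = (if i \<le> n then w n (n - i) else 0)" for n i
  have w'_eq: "w' n i = (if i \<le> n then B l i * B k (n - i) / B (k + l + 1) n else 0)" for n i
    by (auto simp: w'_def w_def)
  have w'_null: "(\<lambda>n. w' n i) \<longlonglongrightarrow> 0" for i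
  proof (rule Lim_null_comparison)
    show "(\<lambda>n. B l i * (B k n / B (k + l + 1) n)) \<longlonglongrightarrow> 0"
      using tendsto_mult[OF tendsto_const B_ratio[of k], of "B l i"] by simp
    have "norm (w' n i) \<le> B l i * (B k n / B (k + l + 1) n)" for n
    proof (cases "i \<le> n")
      case True
      have "B l i * B k (n - i) / B (k + l + 1) n \<le> B l i * B k n / B (k + l + 1) n"
        using B_pos B_mono by (intro divide_right_mono mult_left_mono) (auto intro: less_imp_le)
      moreover have "w' n i \<ge> 0" using w_nn by (simp add: w'_def)
      ultimately show ?thesis using True by (simp add: w'_eq)
    next
      case False
      then show ?thesis using B_pos by (simp add: w'_eq less_imp_le)
    qed
    then show "\<forall>\<^sub>F n in sequentially. norm (w' n i) \<le> B l i * (B k n / B (k + l + 1) n)"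
      by (intro always_eventually) auto
  qed
  have reflect: "(\<Sum>i\<le>n. w n i * h (n - i)) = (\<Sum>i\<le>n. w' n i * h i)" for n and h :: "nat \<Rightarrow> real"
  proof -
    show ?thesis
      by (rule sum.reindex_bij_witness[of _ "\<lambda>i. n - i" "\<lambda>i. n - i"]) (auto simp: w'_def)
  qed
  obtain M where M: "\<And>i. \<bar>a i\<bar> \<le> M" "M > 0"
    using convergent_imp_bounded[OF a] by (auto simp: bounded_pos)
  have e1: "(\<lambda>n. \<Sum>i\<le>n. w n i * (B' * (a i - A'))) \<longlonglongrightarrow> 0"
  proof (rule tendsto_weighted_null[OF w_nn _ w_null])
    have "(\<lambda>i. B' * (a i - A')) \<longlonglongrightarrow> B' * (A' - A')" by (intro tendsto_intros a)
    then show "(\<lambda>i. B' * (a i - A')) \<longlonglongrightarrow> 0" by simp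
  qed (simp add: w_total)
  have e2: "(\<lambda>n. \<Sum>i\<le>n. w' n i * (M * \<bar>b i - B'\<bar>)) \<longlonglongrightarrow> 0"
  proof (rule tendsto_weighted_null[OF _ _ w'_null])
    have "(\<lambda>i. M * \<bar>b i - B'\<bar>) \<longlonglongrightarrow> M * \<bar>B' - B'\<bar>" by (intro tendsto_intros b)
    then show "(\<lambda>i. M * \<bar>b i - B'\<bar>) \<longlonglongrightarrow> 0" by simp
    show "w' n i \<ge> 0" for n i using w_nn by (simp add: w'_def)
    show "(\<Sum>i\<le>n. w' n i) \<le> 1" for n using reflect[of n "\<lambda>_. 1"] w_total by simp
  qed
  have e3: "(\<lambda>n. \<Sum>i\<le>n. w n i * (a i * (b (n - i) - B'))) \<longlonglongrightarrow> 0"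
  proof (rule Lim_null_comparison[OF always_eventually e2], rule allI)
    fix n
    have "norm (\<Sum>i\<le>n. w n i * (a i * (b (n - i) - B'))) \<le> (\<Sum>i\<le>n. w n i * (M * \<bar>b (n - i) - B'\<bar>))"
      using M w_nn
      by (intro order_trans[OF norm_sum] sum_mono)
         (auto simp: abs_mult intro!: mult_mono)
    then show "norm (\<Sum>i\<le>n. w n i * (a i * (b (n - i) - B'))) \<le> (\<Sum>i\<le>n. w' n i * (M * \<bar>b i - B'\<bar>))"
      unfolding reflect[of n "\<lambda>i. M * \<bar>b i - B'\<bar>"] .
  qed
  \<comment> \<open>Splitting \<open>a i * b (n - i) - A' * B'\<close> as
    \<open>a i * (b (n - i) - B') + B' * (a i - A')\<close> leaves two averages of null sequences,
    the first one with \<open>a\<close> bounded by \<open>M\<close>.\<close>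
  have "(\<lambda>n. (\<Sum>i\<le>n. w n i * (a i * (b (n - i) - B'))) + (\<Sum>i\<le>n. w n i * (B' * (a i - A'))) + A' * B')
      \<longlonglongrightarrow> 0 + 0 + A' * B'"
    by (intro tendsto_add e3 e1 tendsto_const)
  moreover have "(\<Sum>i\<le>n. w n i * (a i * (b (n - i) - B'))) + (\<Sum>i\<le>n. w n i * (B' * (a i - A'))) + A' * B'
      = convolution f g n / \<theta> ^ n / B (k + l + 1) n" for n
  proof -
    have "A' * B' = (\<Sum>i\<le>n. w n i * (A' * B'))"
      unfolding sum_distrib_right[symmetric] w_total by simp
    then have "(\<Sum>i\<le>n. w n i * (a i * (b (n - i) - B'))) + (\<Sum>i\<le>n. w n i * (B' * (a i - A'))) + A' * B'
        = (\<Sum>i\<le>n. w n i * (a i * (b (n - i) - B'))) + (\<Sum>i\<le>n. w n i * (B' * (a i - A'))) + (\<Sum>i\<le>n. w n i * (A' * B'))"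
      by simp
    also have "\<dots> = (\<Sum>i\<le>n. w n i * (a i * b (n - i)))"
      unfolding sum.distrib[symmetric] by (intro sum.cong) (auto simp: algebra_simps)
    also have "\<dots> = (\<Sum>i\<le>n. f i * g (n - i) / (\<theta> ^ n * B (k + l + 1) n))"
    proof (intro sum.cong refl)
      fix i assume "i \<in> {..n}"
      then have i: "i \<le> n" by simp
      have "\<theta> ^ n = \<theta> ^ i * \<theta> ^ (n - i)" using i by (simp add: power_add[symmetric])
      then show "w n i * (a i * b (n - i)) = f i * g (n - i) / (\<theta> ^ n * B (k + l + 1) n)"
        using i B_pos[of k i] B_pos[of l "n - i"] by (simp add: w_def a_def b_def)
    qed
    finally show ?thesis by (simp add: convolution_def sum_divide_distrib)
  qed
  ultimately have lim: "(\<lambda>n. convolution f g n / \<theta> ^ n / B (k + l + 1) n) \<longlonglongrightarrow> A' * B'" by simp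
  have "(\<lambda>n. convolution f g n / \<theta> ^ n / B (k + l + 1) n * (B (k + l + 1) n / real n ^ (k + l + 1)))
      \<longlonglongrightarrow> A' * B' * (1 / fact (k + l + 1))"
    unfolding B_def by (intro tendsto_mult choose_asymptotic lim[unfolded B_def])
  moreover have "convolution f g n / \<theta> ^ n / B (k + l + 1) n * (B (k + l + 1) n / real n ^ (k + l + 1))
      = convolution f g n / (real n ^ (k + l + 1) * \<theta> ^ n)" for n
    using B_pos[of "k + l + 1" n] by simp
  ultimately have "(\<lambda>n. convolution f g n / (real n ^ (k + l + 1) * \<theta> ^ n))
      \<longlonglongrightarrow> A' * B' * (1 / fact (k + l + 1))" by (simp only:)
  then have "grows (convolution f g) (A' * B' * (1 / fact (k + l + 1))) (k + l + 1) \<theta>"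
    using pos by (simp add: grows_def A'_def B'_def del: fact_Suc)
  then show ?thesis by blast
qed

lemma regular_convolution:
  assumes "regular f" "regular g" "\<And>n. f n \<ge> 0" "\<And>n. g n \<ge> 0"
  shows "regular (convolution f g)"
proof -
  consider "\<forall>\<^sub>F n in sequentially. f n = 0" | "\<forall>\<^sub>F n in sequentially. g n = 0"
    | C k \<theta> D l \<rho> where "grows f C k \<theta>" "grows g D l \<rho>"
    using assms by (auto simp: regular_def)
  then show ?thesis
  proof cases
    case 1
    then show ?thesis using assms by (intro regular_convolution_finite)
  next
    case 2
    then show ?thesis using assms
      by (subst convolution_commute) (intro regular_convolution_finite)
  next
    case 3
    consider "\<rho> < \<theta>" | "\<rho> = \<theta>" | "\<theta> < \<rho>" by linarith
    then show ?thesis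
    proof cases
      case 1
      then show ?thesis using grows_convolution_less[OF 3 1 assms(3,4)] by (auto simp: regular_def)
    next
      case 2
      then show ?thesis using grows_convolution_eq[of f C k \<theta> g D l] 3 by (auto simp: regular_def)
    next
      case c: 3
      then show ?thesis using grows_convolution_less[OF 3(2,1) c assms(4,3)]
        by (subst convolution_commute) (auto simp: regular_def)
    qed
  qed
qed

section \<open>The renewal theorem\<close>

lemma power_eq_1_Gcd:
  fixes z :: complex
  assumes "\<And>n. n \<in> S \<Longrightarrow> z ^ n = 1" "Gcd S = (1::nat)"
  shows "z = 1"
proof -
  have "\<not> S \<subseteq> {0}" using assms(2) by (metis Gcd_0_iff zero_neq_one)
  then obtain n where n: "n \<in> S" "n > 0" by auto
  define d where "d = (LEAST d. d > 0 \<and> z ^ d = 1)"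
  have d: "d > 0" "z ^ d = 1"
    using LeastI[of "\<lambda>d. d > 0 \<and> z ^ d = 1" n] n assms(1) by (auto simp: d_def)
  have "d dvd k" if "k \<in> S" for k
  proof -
    have "z ^ k = z ^ (d * (k div d) + k mod d)" by simp
    also have "\<dots> = z ^ (k mod d)" unfolding power_add power_mult d(2) by simp
    finally have "z ^ (k mod d) = 1" using assms(1)[OF that] by simp
    then have "\<not> k mod d > 0"
      using not_less_Least[of "k mod d" "\<lambda>d. d > 0 \<and> z ^ d = 1"] d(1) by (auto simp: d_def[symmetric])
    then show ?thesis by auto
  qed
  then have "d dvd Gcd S" by (rule Gcd_greatest)
  then show ?thesis using assms(2) d(2) by simp
qed

text \<open>The zeros in a closed disc of radius \<open>r1 > 1\<close> form a compact set, so one of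
  least modulus exists unless there are none; that modulus exceeds 1.\<close>

lemma nonvanishing_larger_disc:
  fixes F :: "complex fps"
  assumes "fps_conv_radius F > 1" "\<And>z. norm z \<le> 1 \<Longrightarrow> eval_fps F z \<noteq> 0"
  obtains r where "r > 1" "\<And>z. ereal (norm z) < ereal r \<Longrightarrow> eval_fps F z \<noteq> 0"
proof -
  obtain r1 where r1: "1 < r1" "ereal r1 < fps_conv_radius F"
    using assms(1) ereal_dense2[of 1 "fps_conv_radius F"] by (auto simp: one_ereal_def)
  define K where "K = {z \<in> cball 0 r1. eval_fps F z = 0}"
  have cont: "continuous_on (cball 0 r1) (eval_fps F)"
    using r1 by (intro continuous_on_subset[OF continuous_on_eval_fps])
      (auto simp: eball_def intro: le_less_trans[of _ "ereal r1"])
  have "closed K" unfolding K_def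
    using continuous_closed_preimage_constant[OF cont closed_cball, of 0] by simp
  moreover have "bounded K" by (rule bounded_subset[OF bounded_cball[of 0 r1]]) (auto simp: K_def)
  ultimately have "compact K" unfolding compact_eq_bounded_closed by simp
  show ?thesis
  proof (cases "K = {}")
    case True
    then show ?thesis using r1 by (intro that[of r1]) (auto simp: K_def)
  next
    case False
    obtain z0 where z0: "z0 \<in> K" "\<And>z. z \<in> K \<Longrightarrow> norm z0 \<le> norm z"
      using continuous_attains_inf[OF \<open>compact K\<close> False continuous_on_norm[OF continuous_on_id]] by auto
    have "norm z0 > 1" using z0(1) assms(2)[of z0] by (force simp: K_def)
    moreover have "norm z0 \<le> r1" using z0(1) by (simp add: K_def)
    moreover have "eval_fps F z \<noteq> 0" if "ereal (norm z) < ereal (norm z0)" for z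
    proof -
      have "z \<notin> K" using z0(2)[of z] that by auto
      then show ?thesis using that \<open>norm z0 \<le> r1\<close> by (auto simp: K_def)
    qed
    ultimately show ?thesis by (intro that[of "norm z0"])
  qed
qed

text \<open>With \<open>G\<close> the generating function of \<open>g\<close> we have \<open>1 - G = (1 - z) H\<close>, where \<open>H\<close> has no
  zeros in the closed unit disc because \<open>G(z) = 1\<close> forces \<open>z ^ n = 1\<close> on the support of \<open>g\<close>. Hence
  \<open>1 / H\<close> converges beyond the unit disc, and its partial sums are the coefficients of
  \<open>1 / (1 - G)\<close>.\<close>

lemma renewal_theorem:
  fixes g :: "nat \<Rightarrow> real"
  assumes nn: "\<And>n. g n \<ge> 0" and g0: "g 0 = 0" and sum1: "g sums 1"
    and R: "R > 1" "summable (\<lambda>n. g n * R ^ n)" and Gcd: "Gcd {n. g n \<noteq> 0} = 1"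
  shows "\<exists>c>0. (\<lambda>n. fps_nth (inverse (1 - Abs_fps g)) n) \<longlonglongrightarrow> c"
proof -
  define G H where "G = Abs_fps (\<lambda>n. complex_of_real (g n))"
    and "H = Abs_fps (\<lambda>n. complex_of_real (1 - (\<Sum>i\<le>n. g i)))"
  have HG: "(1 - fps_X) * H = 1 - G"
  proof (rule fps_ext)
    fix n
    show "fps_nth ((1 - fps_X) * H) n = fps_nth (1 - G) n"
      by (cases n) (auto simp: G_def H_def left_diff_distrib g0)
  qed
  have summ: "summable g" using sum1 by (rule sums_summable)
  define T where "T = (\<Sum>n. g n * R ^ n)"
  have tail_nn: "1 - (\<Sum>i\<le>n. g i) \<ge> 0" for n
    using sum_le_suminf[OF summ, of "{..n}"] nn sum1 by (auto simp: sums_iff)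
  have tail: "(1 - (\<Sum>i\<le>n. g i)) * R ^ n \<le> T" for n
  proof -
    have eq: "1 - (\<Sum>i\<le>n. g i) = (\<Sum>i. g (i + Suc n))"
      using suminf_minus_initial_segment[OF summ, of "Suc n"] sum1
      by (simp add: sums_iff lessThan_Suc_atMost)
    have s1: "summable (\<lambda>i. g (i + Suc n))" using summ by (rule summable_ignore_initial_segment)
    have s2: "summable (\<lambda>i. g (i + Suc n) * R ^ (i + Suc n))"
      using summable_ignore_initial_segment[OF R(2), of "Suc n"] .
    have "(1 - (\<Sum>i\<le>n. g i)) * R ^ n = (\<Sum>i. g (i + Suc n) * R ^ n)"
      unfolding eq by (rule suminf_mult2[OF s1])
    also have "\<dots> \<le> (\<Sum>i. g (i + Suc n) * R ^ (i + Suc n))"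
      using R(1) nn by (intro suminf_le summable_mult2 s1 s2 mult_left_mono power_increasing) auto
    also have "\<dots> = T - (\<Sum>i<Suc n. g i * R ^ i)"
      unfolding T_def by (rule suminf_minus_initial_segment[OF R(2)])
    also have "\<dots> \<le> T" using nn R(1) by (simp add: sum_nonneg del: sum.lessThan_Suc)
    finally show ?thesis .
  qed
  have radG: "fps_conv_radius G > 1"
  proof -
    have "summable (\<lambda>n. fps_nth G n * of_real R ^ n)"
      using summable_of_real[OF R(2), where 'a = complex] by (simp add: G_def)
    then have "fps_conv_radius G \<ge> norm (complex_of_real R)"
      unfolding fps_conv_radius_def by (rule conv_radius_geI)
    moreover have "ereal 1 < ereal (norm (complex_of_real R))" using R by simp
    ultimately show ?thesis unfolding one_ereal_def by (rule less_le_trans[rotated])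
  qed
  \<comment> \<open>At \<open>R\<close> itself the terms of the series \<open>H\<close> are merely
    bounded, so absolute convergence is claimed at a radius strictly between 1 and
    \<open>R\<close>.\<close>
  define r where "r = (1 + R) / 2"
  have r: "1 < r" "r < R" using R by (auto simp: r_def)
  have radH: "fps_conv_radius H > 1"
  proof -
    have "summable (\<lambda>n. fps_nth H n * of_real r ^ n)"
    proof (rule summable_comparison_test)
      show "summable (\<lambda>n. T * (r / R) ^ n)" using r by (intro summable_mult summable_geometric) auto
      have "norm (fps_nth H n * of_real r ^ n) \<le> T * (r / R) ^ n" for n
      proof -
        have "norm (fps_nth H n * of_real r ^ n) = (1 - (\<Sum>i\<le>n. g i)) * r ^ n"
          using r tail_nn[of n] by (simp add: H_def norm_mult norm_power del: of_real_sum of_real_diff)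
        also have "\<dots> = (1 - (\<Sum>i\<le>n. g i)) * R ^ n * (r / R) ^ n"
          using R by (simp add: power_divide)
        also have "\<dots> \<le> T * (r / R) ^ n" using r tail by (intro mult_right_mono) auto
        finally show ?thesis .
      qed
      then show "\<exists>N. \<forall>n\<ge>N. norm (fps_nth H n * of_real r ^ n) \<le> T * (r / R) ^ n" by blast
    qed
    then have "fps_conv_radius H \<ge> norm (complex_of_real r)"
      unfolding fps_conv_radius_def by (rule conv_radius_geI)
    moreover have "ereal 1 < ereal (norm (complex_of_real r))" using r by simp
    ultimately show ?thesis unfolding one_ereal_def by (rule less_le_trans[rotated])
  qed
  have conv: "ereal (norm z) < fps_conv_radius F" if "norm z \<le> 1" "fps_conv_radius F > 1"
    for z :: complex and F :: "complex fps"
    using that by (metis ereal_less_eq(3) le_less_trans one_ereal_def)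
  \<comment> \<open>The sum of the tail probabilities is the mean of the distribution
    \<open>g\<close>; the limit found at the end is its reciprocal, as usual for renewal
    sequences.\<close>
  define h where "h = (\<Sum>n. 1 - (\<Sum>i\<le>n. g i))"
  have H1: "eval_fps H 1 = of_real h" "h > 0"
  proof -
    have s: "(\<lambda>n. fps_nth H n * 1 ^ n) sums eval_fps H 1" using conv[OF _ radH, of 1] by (intro sums_eval_fps) auto
    have s': "(\<lambda>n. 1 - (\<Sum>i\<le>n. g i)) sums Re (eval_fps H 1)"
      using sums_Re[OF s] by (simp add: H_def)
    then have h: "h = Re (eval_fps H 1)" by (simp add: h_def sums_iff)
    have "Im (eval_fps H 1) = 0"
      using sums_Im[OF s] by (simp add: H_def sums_iff)
    then show "eval_fps H 1 = of_real h" by (simp add: h complex_eq_iff)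
    show "h > 0" unfolding h_def using s' tail_nn
      by (intro suminf_pos2[where i = 0]) (auto simp: sums_iff g0)
  qed
  have nonzero: "eval_fps H z \<noteq> 0" if z: "norm z \<le> 1" for z
  proof
    assume 0: "eval_fps H z = 0"
    have "eval_fps ((1 - fps_X) * H) z = (1 - z) * eval_fps H z"
      using conv[OF z radH] by (subst eval_fps_mult) (auto simp: eval_fps_diff fps_conv_radius_diff
        intro!: less_le_trans[OF _ fps_conv_radius_diff])
    moreover have "eval_fps (1 - G) z = 1 - eval_fps G z"
      using conv[OF z radG] by (subst eval_fps_diff) auto
    ultimately have G1: "eval_fps G z = 1" using 0 HG by simp
    have "(\<lambda>n. Re (fps_nth G n * z ^ n)) sums Re (eval_fps G z)"
      using conv[OF z radG] by (intro sums_Re sums_eval_fps)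
    then have "(\<lambda>n. g n - g n * Re (z ^ n)) sums (1 - 1)"
      using G1 sum1 by (intro sums_diff) (auto simp: G_def)
    then have s: "(\<lambda>n. g n * (1 - Re (z ^ n))) sums 0" by (simp add: right_diff_distrib)
    have Re_le: "Re (z ^ n) \<le> 1" for n
    proof -
      have "Re (z ^ n) \<le> norm (z ^ n)" by (rule complex_Re_le_cmod)
      also have "\<dots> \<le> 1" using z by (simp add: norm_power power_le_one)
      finally show ?thesis .
    qed
    \<comment> \<open>Nonnegative terms with sum zero: where \<open>g n\<close> is positive,
      \<open>z ^ n\<close> has real part 1 and modulus at most 1, hence equals 1.\<close>
    have "g n * (1 - Re (z ^ n)) = 0" for n
      using s suminf_eq_zero_iff[of "\<lambda>n. g n * (1 - Re (z ^ n))"] nn Re_le by (auto simp: sums_iff)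
    then have Re1: "Re (z ^ n) = 1" if "g n \<noteq> 0" for n using that by auto
    have "z ^ n = 1" if "g n \<noteq> 0" for n
    proof -
      have "(norm (z ^ n))\<^sup>2 \<le> 1" using z by (simp add: norm_power power_le_one)
      then have "(Im (z ^ n))\<^sup>2 \<le> 0" using Re1[OF that] by (simp add: cmod_power2)
      then have "Im (z ^ n) = 0" by simp
      then show ?thesis using Re1[OF that] by (simp add: complex_eq_iff)
    qed
    then have "z = 1" using power_eq_1_Gcd[of "{n. g n \<noteq> 0}" z] Gcd by auto
    then show False using 0 H1 by simp
  qed
  obtain s where s: "s > 1" "\<And>z. ereal (norm z) < ereal s \<Longrightarrow> eval_fps H z \<noteq> 0"
    using nonvanishing_larger_disc[OF radH nonzero] by blast
  define U where "U = inverse H"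
  have "min (ereal s) (fps_conv_radius H) \<le> fps_conv_radius U"
    unfolding U_def by (rule fps_conv_radius_inverse) (rule s)
  moreover have "1 < min (ereal s) (fps_conv_radius H)" using s(1) radH by (simp add: one_ereal_def)
  ultimately have radU: "fps_conv_radius U > 1" by (rule less_le_trans[rotated])
  have U1: "eval_fps U 1 = of_real (1 / h)"
  proof -
    have "eval_fps U 1 = inverse (eval_fps H 1)"
      unfolding U_def using s conv[OF _ radH, of 1] by (intro eval_fps_inverse[of "ereal s"]) auto
    then show ?thesis by (simp add: H1 inverse_eq_divide)
  qed
  have "(\<lambda>n. fps_nth U n * 1 ^ n) sums eval_fps U 1" using conv[OF _ radU, of 1] by (intro sums_eval_fps) auto
  then have lim: "(\<lambda>n. \<Sum>i\<le>n. fps_nth U i) \<longlonglongrightarrow> of_real (1 / h)"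
    unfolding U1 by (simp add: sums_def_le)
  define W where "W = inverse (1 - Abs_fps g)"
  have "Abs_fps (\<lambda>n. complex_of_real (fps_nth W n)) * (1 - G) = 1"
  proof (rule fps_ext)
    fix n
    have "W * (1 - Abs_fps g) = 1" unfolding W_def by (rule inverse_mult_eq_1) (simp add: g0)
    then have "complex_of_real (fps_nth (W * (1 - Abs_fps g)) n) = of_real (fps_nth 1 n)" by simp
    moreover have "complex_of_real (fps_nth (W * (1 - Abs_fps g)) n)
        = fps_nth (Abs_fps (\<lambda>n. complex_of_real (fps_nth W n)) * (1 - G)) n"
      unfolding fps_mult_nth of_real_sum of_real_mult
      by (intro sum.cong refl arg_cong2[where f = "(*)"]) (simp_all add: G_def)
    ultimately show "fps_nth (Abs_fps (\<lambda>n. complex_of_real (fps_nth W n)) * (1 - G)) n = fps_nth 1 n"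
      by simp
  qed
  then have "Abs_fps (\<lambda>n. complex_of_real (fps_nth W n)) = inverse (1 - G)"
    by (metis fps_inverse_unique mult.commute)
  also have "\<dots> = U * inverse (1 - fps_X)"
    unfolding HG[symmetric] fps_inverse_mult U_def by simp
  finally have "complex_of_real (fps_nth W n) = fps_nth (U * inverse (1 - fps_X)) n" for n
    by (metis fps_nth_Abs_fps)
  then have "complex_of_real (fps_nth W n) = (\<Sum>i\<le>n. fps_nth U i)" for n
    unfolding fps_inverse_one_minus_fps_X by (simp add: fps_mult_nth atLeast0AtMost)
  then have "(\<lambda>n. complex_of_real (fps_nth W n)) \<longlonglongrightarrow> of_real (1 / h)" using lim by simp
  then have "(\<lambda>n. fps_nth W n) \<longlonglongrightarrow> 1 / h" unfolding tendsto_of_real_iff .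
  then show ?thesis using H1(2) unfolding W_def by (intro exI[of _ "1 / h"]) auto
qed

section \<open>Quasi-regular sequences\<close>

text \<open>Periodic systems produce sequences such as 1, 0, 1, 0, whose residue classes grow
  differently; one modulus has to serve all classes. Nonnegativity is included because convolutions
  and inverses rely on it. Offsets \<open>r \<ge> m\<close> are allowed so that shifted indices need
  no reduction.\<close>

definition quasi_regular :: "(nat \<Rightarrow> real) \<Rightarrow> bool" where
  "quasi_regular f \<longleftrightarrow> (\<forall>n. f n \<ge> 0) \<and> (\<exists>m>0. \<forall>r. regular (\<lambda>n. f (m * n + r)))"

lemma quasi_regularI:
  assumes "\<And>n. f n \<ge> 0" "m > 0" "\<And>r. r < m \<Longrightarrow> regular (\<lambda>n. f (m * n + r))"
  shows "quasi_regular f"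
proof -
  have "regular (\<lambda>n. f (m * n + r))" for r
  proof -
    have "regular (\<lambda>n. f (m * (1 * n + r div m) + r mod m))"
      using regular_section[OF assms(3)[of "r mod m"], of 1 "r div m"] assms(2) by simp
    moreover have "m * (1 * n + r div m) + r mod m = m * n + r" for n
      by (simp add: distrib_left)
    ultimately show ?thesis by simp
  qed
  then show ?thesis using assms by (auto simp: quasi_regular_def)
qed

lemma quasi_regular_common:
  assumes "quasi_regular f" "quasi_regular g"
  obtains m where "m > 0" "\<And>r. regular (\<lambda>n. f (m * n + r))" "\<And>r. regular (\<lambda>n. g (m * n + r))"
proof -
  obtain k l where k: "k > 0" "\<And>r. regular (\<lambda>n. f (k * n + r))"
    and l: "l > 0" "\<And>r. regular (\<lambda>n. g (l * n + r))"
    using assms by (auto simp: quasi_regular_def)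
  have "regular (\<lambda>n. f (k * (l * n + 0) + r))" for r by (rule regular_section[OF k(2) l(1)])
  moreover have "regular (\<lambda>n. g (l * (k * n + 0) + r))" for r by (rule regular_section[OF l(2) k(1)])
  ultimately show ?thesis using k(1) l(1)
    by (intro that[of "k * l"]) (simp_all add: mult_ac)
qed

lemma quasi_regular_nonneg: "quasi_regular f \<Longrightarrow> f n \<ge> 0"
  by (simp add: quasi_regular_def)

lemma quasi_regular_eventually_0:
  assumes "\<And>n. f n \<ge> 0" "\<forall>\<^sub>F n in sequentially. f n = 0"
  shows "quasi_regular f"
  using assms by (intro quasi_regularI[of f 1]) (auto intro: regular_eventually_0)

lemma quasi_regular_add:
  assumes "quasi_regular f" "quasi_regular g"
  shows "quasi_regular (\<lambda>n. f n + g n)"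
proof -
  obtain m where "m > 0" "\<And>r. regular (\<lambda>n. f (m * n + r))" "\<And>r. regular (\<lambda>n. g (m * n + r))"
    using quasi_regular_common[OF assms] by blast
  then show ?thesis
    by (intro quasi_regularI[of _ m] regular_add add_nonneg_nonneg) (auto intro: quasi_regular_nonneg assms)
qed

lemma quasi_regular_cmult:
  assumes "c \<ge> 0" "quasi_regular f"
  shows "quasi_regular (\<lambda>n. c * f n)"
proof -
  obtain m where "m > 0" "\<And>r. regular (\<lambda>n. f (m * n + r))"
    using assms(2) by (auto simp: quasi_regular_def)
  then show ?thesis
    using assms(1) quasi_regular_nonneg[OF assms(2)]
    by (intro quasi_regularI[of _ m] regular_cmult mult_nonneg_nonneg) auto
qed

lemma quasi_regular_sum:
  assumes "\<And>i. i \<in> I \<Longrightarrow> quasi_regular (f i)"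
  shows "quasi_regular (\<lambda>n. \<Sum>i\<in>I. f i n)"
  using assms
  by (induction I rule: infinite_finite_induct)
     (auto intro: quasi_regular_add quasi_regular_eventually_0)

text \<open>Writing the first index as \<open>m * a + r\<close> splits a residue class of the
  convolution into \<open>m\<close> convolutions of regular sequences.\<close>

lemma quasi_regular_convolution:
  assumes f: "quasi_regular f" and g: "quasi_regular g"
  shows "quasi_regular (convolution f g)"
proof -
  obtain m where m: "m > 0" "\<And>r. regular (\<lambda>n. f (m * n + r))" "\<And>r. regular (\<lambda>n. g (m * n + r))"
    using quasi_regular_common[OF assms] by blast
  note nn = quasi_regular_nonneg[OF f] quasi_regular_nonneg[OF g]
  show ?thesis
  proof (rule quasi_regularI[OF _ m(1)])
    show "convolution f g n \<ge> 0" for n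
      unfolding convolution_def using nn by (intro sum_nonneg mult_nonneg_nonneg)
    fix t assume "t < m"
    \<comment> \<open>The partner of \<open>m * a + r\<close> in the total \<open>m * N + t\<close>
      is \<open>m * (N - a) + t - r\<close>. For \<open>t < r\<close> and \<open>a = N\<close> it
      does not exist; the value 0 then removes the term instead of letting truncated subtraction
      produce one.\<close>
    define D where "D r n = (if m * n + t < r then 0 else g (m * n + t - r))" for r n
    have D_nn: "D r n \<ge> 0" for r n using nn by (simp add: D_def)
    have D_regular: "regular (D r)" if "r < m" for r
    proof (cases "t < r")
      case True
      have "D r (Suc n) = g (m * n + (m + t - r))" for n
        using that by (simp add: D_def algebra_simps)
      then show ?thesis using m(3) by (intro regular_unshift[of "D r"]) simp
    next
      case False
      then have "D r = (\<lambda>n. g (m * n + (t - r)))" by (auto simp: D_def fun_eq_iff)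
      then show ?thesis using m(3)[of "t - r"] by simp
    qed
    have "regular (\<lambda>N. \<Sum>r<m. convolution (\<lambda>a. f (m * a + r)) (D r) N)"
      using nn D_nn m by (intro regular_sum regular_convolution D_regular) auto
    moreover have "convolution f g (m * N + t) = (\<Sum>r<m. convolution (\<lambda>a. f (m * a + r)) (D r) N)" for N
    proof -
      define e where "e i = f i * (if m * N + t < i then 0 else g (m * N + t - i))" for i
      have "convolution f g (m * N + t) = (\<Sum>i\<le>m * N + t. e i)" by (simp add: convolution_def e_def)
      also have "\<dots> = (\<Sum>i<Suc N * m. e i)"
        using \<open>t < m\<close> by (intro sum.mono_neutral_left) (auto simp: e_def mult.commute)
      also have "\<dots> = (\<Sum>a<Suc N. \<Sum>i\<in>{a * m..<a * m + m}. e i)" by (rule sum.nat_group[symmetric])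
      also have "\<dots> = (\<Sum>a<Suc N. \<Sum>r<m. e (m * a + r))"
      proof (rule sum.cong[OF refl])
        fix a
        show "(\<Sum>i\<in>{a * m..<a * m + m}. e i) = (\<Sum>r<m. e (m * a + r))"
          by (rule sum.reindex_bij_witness[of _ "\<lambda>r. m * a + r" "\<lambda>i. i - m * a"]) (auto simp: mult.commute)
      qed
      also have "\<dots> = (\<Sum>r<m. \<Sum>a<Suc N. e (m * a + r))" by (rule sum.swap)
      also have "\<dots> = (\<Sum>r<m. convolution (\<lambda>a. f (m * a + r)) (D r) N)"
        unfolding convolution_def lessThan_Suc_atMost
      proof (rule sum.cong[OF refl], rule sum.cong[OF refl])
        fix r a assume "a \<in> {..N}"
        then obtain b where b: "N = a + b" by (auto simp: le_iff_add)
        show "e (m * a + r) = f (m * a + r) * D r (N - a)"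
          by (simp add: e_def D_def b distrib_left)
      qed
      finally show ?thesis .
    qed
    ultimately show "regular (\<lambda>n. convolution f g (m * n + t))" by simp
  qed
qed

lemma fps_nth_mult_convolution: "fps_nth (F * G) = convolution (fps_nth F) (fps_nth G)"
  by (simp add: fun_eq_iff fps_mult_nth convolution_def atLeast0AtMost)

text \<open>A sequence growing like \<open>C * n ^ k * \<theta> ^ n\<close> diverges at the radius
  \<open>1 / \<theta>\<close> itself, because its terms there stay bounded away from zero. So
  summability at \<open>X\<close> places \<open>X\<close> strictly inside the disc of
  convergence.\<close>

lemma regular_summable_enlarge:
  assumes "regular F" "X \<ge> 0" "summable (\<lambda>n. F n * X ^ n)" "\<And>n. F n \<ge> 0"
  shows "\<exists>Y>X. \<exists>M. \<forall>n. F n * Y ^ n \<le> M"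
proof -
  from assms(1) consider "\<forall>\<^sub>F n in sequentially. F n = 0" | C k \<theta> where "grows F C k \<theta>"
    by (auto simp: regular_def)
  then have "\<exists>Y>X. (\<lambda>n. F n * Y ^ n) \<longlonglongrightarrow> 0"
  proof cases
    case 1
    then have "\<forall>\<^sub>F n in sequentially. F n * (X + 1) ^ n = 0" by eventually_elim simp
    then have "(\<lambda>n. F n * (X + 1) ^ n) \<longlonglongrightarrow> 0" by (rule tendsto_eventually)
    then show ?thesis by (intro exI[of _ "X + 1"]) auto
  next
    case 2
    then have pos: "C > 0" "\<theta> > 0" by (auto simp: grows_def)
    have "\<theta> * X < 1"
    proof (rule ccontr)
      assume ge: "\<not> \<theta> * X < 1"
      have "\<forall>\<^sub>F n in sequentially. F n * X ^ n < C / 2"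
        using summable_LIMSEQ_zero[OF assms(3)] pos by (intro order_tendstoD(2)) auto
      with grows_eventually_bounds[OF 2] eventually_gt_at_top[of 0]
      have "\<forall>\<^sub>F n::nat in sequentially. False"
      proof eventually_elim
        case (elim n)
        have "1 * 1 \<le> real n ^ k * (\<theta> * X) ^ n"
          using ge elim(2) by (intro mult_mono one_le_power) auto
        then have "C / 2 * 1 \<le> C / 2 * (real n ^ k * (\<theta> * X) ^ n)"
          using pos by (intro mult_left_mono) auto
        also have "\<dots> = C / 2 * (real n ^ k * \<theta> ^ n) * X ^ n" by (simp add: power_mult_distrib)
        also have "\<dots> \<le> F n * X ^ n" using elim assms(2) by (intro mult_right_mono) auto
        finally show ?case using elim by simp
      qed
      then show False by simp
    qed
    define Y where "Y = (X + 1 / \<theta>) / 2"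
    have Y: "X < Y" "\<theta> * Y < 1" using \<open>\<theta> * X < 1\<close> pos assms(2)
      by (auto simp: Y_def field_simps)
    then have "Y > 0" using assms(2) by linarith
    have "(\<lambda>n. F n / (real n ^ k * \<theta> ^ n) * (real n ^ k * (\<theta> * Y) ^ n)) \<longlonglongrightarrow> C * 0"
      using 2 pos Y \<open>Y > 0\<close> by (intro tendsto_mult tendsto_power_times_geometric) (auto simp: grows_def)
    then have "(\<lambda>n. F n * Y ^ n) \<longlonglongrightarrow> C * 0"
    proof (rule Lim_transform_eventually)
      show "\<forall>\<^sub>F n in sequentially. F n / (real n ^ k * \<theta> ^ n) * (real n ^ k * (\<theta> * Y) ^ n) = F n * Y ^ n"
        using eventually_gt_at_top[of 0] by eventually_elim (use pos in \<open>simp add: power_mult_distrib\<close>)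
    qed
    then show ?thesis using Y by auto
  qed
  then obtain Y where Y: "Y > X" "(\<lambda>n. F n * Y ^ n) \<longlonglongrightarrow> 0" by auto
  obtain M where "\<And>n. norm (F n * Y ^ n) \<le> M"
    using convergent_imp_bounded[OF Y(2)] by (auto simp: bounded_iff)
  then have "\<forall>n. F n * Y ^ n \<le> M" by (metis abs_le_D1 real_norm_def)
  then show ?thesis using Y(1) by blast
qed

lemma quasi_regular_summable_enlarge:
  assumes "quasi_regular f" "x \<ge> 0" "summable (\<lambda>n. f n * x ^ n)"
  shows "\<exists>y>x. summable (\<lambda>n. f n * y ^ n)"
proof -
  obtain m where m: "m > 0" "\<And>r. regular (\<lambda>n. f (m * n + r))"
    using assms(1) by (auto simp: quasi_regular_def)
  note nn = quasi_regular_nonneg[OF assms(1)]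
  have "\<exists>Y>x ^ m. \<exists>M. \<forall>n. f (m * n + r) * Y ^ n \<le> M" for r
  proof (rule regular_summable_enlarge[OF m(2)])
    show "summable (\<lambda>n. f (m * n + r) * (x ^ m) ^ n)"
    proof (cases "x = 0")
      case True
      have "summable (\<lambda>n. f (m * n + r) * 0 ^ n)" by (rule summable_zero_power')
      then show ?thesis using True m by (simp add: zero_power)
    next
      case False
      have "summable (\<lambda>n. f (m * n + r) * x ^ (m * n + r))"
      proof (rule summable_reindex[OF assms(3), of "\<lambda>n. m * n + r", unfolded o_def])
        show "inj (\<lambda>n. m * n + r)" using m by (auto simp: inj_on_def)
      qed (use nn assms(2) in auto)
      then have "summable (\<lambda>n. f (m * n + r) * x ^ (m * n + r) * inverse (x ^ r))"
        by (rule summable_mult2)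
      then show ?thesis using False by (simp add: power_add power_mult mult.assoc)
    qed
  qed (use nn assms(2) in auto)
  then obtain Y M where Y: "\<And>r. Y r > x ^ m" "\<And>r n. f (m * n + r) * Y r ^ n \<le> M r" by metis
  \<comment> \<open>One radius for all residue classes: the smallest of the finitely many
    \<open>Y r\<close>, followed by an \<open>m\<close>-th root to return from steps of length
    \<open>m\<close> to single steps.\<close>
  define Z where "Z = Min (Y ` {..<m})"
  have "Y ` {..<m} \<noteq> {}" using m(1) by (simp add: lessThan_empty_iff)
  then have Z: "Z > x ^ m" "\<And>r. r < m \<Longrightarrow> Z \<le> Y r" using Y(1) by (auto simp: Z_def)
  have Z0: "Z > 0" using Z(1) assms(2) by (meson le_less_trans zero_le_power)
  define z where "z = root m Z"
  have z: "z ^ m = Z" "z > x" "z > 0"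
  proof -
    show "z ^ m = Z" using m Z0 by (simp add: z_def)
    show "z > 0" using m Z0 by (simp add: z_def)
    show "z > x" using \<open>z ^ m = Z\<close> Z(1) \<open>z > 0\<close> by (metis power_less_imp_less_base less_imp_le)
  qed
  define B where "B = (\<Sum>r<m. \<bar>M r\<bar> * z ^ r)"
  have bound: "f k * z ^ k \<le> B" for k
  proof -
    define r where "r = k mod m"
    have r: "r < m" using m by (simp add: r_def)
    have k: "k = m * (k div m) + r" by (simp add: r_def)
    have "f k * z ^ k = f (m * (k div m) + r) * (Z ^ (k div m) * z ^ r)"
      using z(1) k by (metis power_add power_mult)
    also have "\<dots> \<le> f (m * (k div m) + r) * (Y r ^ (k div m) * z ^ r)"
      using nn Z r Z0 z by (intro mult_left_mono mult_right_mono power_mono) auto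
    also have "\<dots> = f (m * (k div m) + r) * Y r ^ (k div m) * z ^ r" by simp
    also have "\<dots> \<le> \<bar>M r\<bar> * z ^ r"
      using z Y(2)[of "k div m" r] by (intro mult_right_mono) auto
    also have "\<dots> \<le> B" unfolding B_def
      using r z by (intro member_le_sum[of r "{..<m}" "\<lambda>r. \<bar>M r\<bar> * z ^ r"]) auto
    finally show ?thesis .
  qed
  define y where "y = (x + z) / 2"
  have y: "x < y" "y < z" "y > 0" using z assms(2) by (auto simp: y_def)
  have "summable (\<lambda>n. f n * y ^ n)"
  proof (rule summable_comparison_test)
    show "summable (\<lambda>n. B * (y / z) ^ n)" using y z by (intro summable_mult summable_geometric) auto
    have "norm (f n * y ^ n) \<le> B * (y / z) ^ n" for n
    proof -
      have "norm (f n * y ^ n) = f n * z ^ n * (y / z) ^ n"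
        using nn y z by (simp add: power_divide)
      also have "\<dots> \<le> B * (y / z) ^ n" using y z bound by (intro mult_right_mono) auto
      finally show ?thesis .
    qed
    then show "\<exists>N. \<forall>n\<ge>N. norm (f n * y ^ n) \<le> B * (y / z) ^ n" by blast
  qed
  then show ?thesis using y by blast
qed

text \<open>The largest \<open>\<rho>\<close> at which all partial sums are at most 1 gives sum
  exactly 1: if the sum were smaller, the series would still converge somewhat further out, and by
  continuity \<open>\<rho>\<close> could be enlarged. Here it matters that the series of
  \<open>f\<close> cannot converge at its own radius of convergence.\<close>

lemma quasi_regular_normalize:
  assumes f: "quasi_regular f" "f 0 = 0" "f n0 \<noteq> 0"
  obtains \<rho> y where "0 < \<rho>" "\<rho> < y" "(\<lambda>n. f n * \<rho> ^ n) sums 1" "summable (\<lambda>n. f n * y ^ n)"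
proof -
  note nn = quasi_regular_nonneg[OF f(1)]
  define A where "A = {x. x \<ge> 0 \<and> (\<forall>N. (\<Sum>n<N. f n * x ^ n) \<le> 1)}"
  have n0: "n0 > 0" "f n0 > 0" using f nn[of n0] by (auto intro: gr0I)
  have A0: "0 \<in> A"
  proof -
    have "(\<Sum>n<N. f n * 0 ^ n) \<le> 1" for N
      using f(2) by (intro order_trans[OF eq_refl[OF sum.neutral]]) (auto simp: power_0_left)
    then show ?thesis by (simp add: A_def)
  qed
  have "x \<le> 1 + 1 / f n0" if "x \<in> A" for x
  proof (cases "x \<le> 1")
    case False
    have "f n0 * x ^ n0 \<le> (\<Sum>n<Suc n0. f n * x ^ n)"
      using nn False by (intro member_le_sum) auto
    also have "\<dots> \<le> 1" using that unfolding A_def by blast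
    finally have 1: "f n0 * x ^ n0 \<le> 1" .
    have "x ^ 1 \<le> x ^ n0" using False n0 by (intro power_increasing) auto
    then have "f n0 * x \<le> f n0 * x ^ n0" using n0 by simp
    then have "f n0 * x \<le> 1" using 1 by linarith
    then have "x \<le> 1 / f n0" using n0 by (simp add: field_simps)
    then show ?thesis by simp
  next
    case True
    have "1 / f n0 > 0" using n0 by simp
    then show ?thesis using True by linarith
  qed
  then have bdd: "bdd_above A" by (rule bdd_aboveI)
  have A_eq: "A = {0..} \<inter> (\<Inter>N. {x. (\<Sum>n<N. f n * x ^ n) \<le> 1})" by (auto simp: A_def)
  have "closed A" unfolding A_eq
    by (intro closed_Int closed_atLeast closed_INT ballI closed_Collect_le continuous_intros)
  define \<rho> where "\<rho> = Sup A"
  have "\<rho> \<in> A" unfolding \<rho>_def using A0 bdd \<open>closed A\<close> by (intro closed_contains_Sup) auto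
  then have \<rho>: "\<rho> \<ge> 0" "\<And>N. (\<Sum>n<N. f n * \<rho> ^ n) \<le> 1" by (auto simp: A_def)
  have "(\<Sum>n\<le>N. f n * \<rho> ^ n) \<le> 1" for N
    using \<rho>(2)[of "Suc N"] unfolding lessThan_Suc_atMost .
  then have summ: "summable (\<lambda>n. f n * \<rho> ^ n)"
    using \<rho> nn by (intro bounded_imp_summable[where B = 1]) auto
  obtain y where y: "y > \<rho>" "summable (\<lambda>n. f n * y ^ n)"
    using quasi_regular_summable_enlarge[OF f(1) \<rho>(1) summ] by auto
  have le1: "(\<Sum>n. f n * \<rho> ^ n) \<le> 1" using \<rho> summ by (intro suminf_le_const) auto
  have eq1: "(\<Sum>n. f n * \<rho> ^ n) = 1"
  proof (rule ccontr)
    assume "\<not> ?thesis"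
    then have less: "(\<Sum>n. f n * \<rho> ^ n) < 1" using le1 by simp
    have "isCont (\<lambda>x. \<Sum>n. f n * x ^ n) \<rho>"
      using y \<rho> by (intro isCont_powser[OF y(2)]) auto
    then have "((\<lambda>x. \<Sum>n. f n * x ^ n) \<longlongrightarrow> (\<Sum>n. f n * \<rho> ^ n)) (at_right \<rho>)"
      unfolding isCont_def by (rule tendsto_mono[rotated]) (simp add: at_le)
    then have "\<forall>\<^sub>F x in at_right \<rho>. (\<Sum>n. f n * x ^ n) < 1" using less by (rule order_tendstoD)
    moreover have "\<forall>\<^sub>F x in at_right \<rho>. x < y" using y(1) by (rule eventually_at_right_real[THEN eventually_mono]) auto
    moreover have "\<forall>\<^sub>F x in at_right \<rho>. \<rho> < x" by (simp add: eventually_at_filter)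
    ultimately have "\<forall>\<^sub>F x in at_right \<rho>. (\<Sum>n. f n * x ^ n) < 1 \<and> x < y \<and> \<rho> < x"
      by eventually_elim auto
    then obtain x where x: "(\<Sum>n. f n * x ^ n) < 1" "x < y" "\<rho> < x"
      using eventually_happens'[of "at_right \<rho>"] by (auto simp: trivial_limit_at_right_real)
    have "summable (\<lambda>n. f n * x ^ n)" using x \<rho> by (intro powser_inside[OF y(2)]) auto
    then have "(\<Sum>n<N. f n * x ^ n) \<le> 1" for N
      using sum_le_suminf[of "\<lambda>n. f n * x ^ n" "{..<N}"] nn x \<rho> by fastforce
    then have "x \<in> A" using x \<rho> by (simp add: A_def)
    then show False using cSup_upper[OF _ bdd] x by (force simp: \<rho>_def)
  qed
  have "\<rho> \<noteq> 0"
  proof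
    assume "\<rho> = 0"
    then have "(\<lambda>n. f n * \<rho> ^ n) = (\<lambda>n. 0)" using f(2) by (auto simp: fun_eq_iff power_0_left)
    with eq1 have "(0::real) = 1" by (simp only: suminf_zero)
    then show False by simp
  qed
  then show ?thesis using that[of \<rho> y] \<rho> y eq1 summ by (auto simp: sums_iff)
qed

lemma fps_star_nonneg:
  fixes f :: "nat \<Rightarrow> real"
  assumes "\<And>n. f n \<ge> 0" "f 0 = 0"
  shows "fps_nth (inverse (1 - Abs_fps f)) n \<ge> 0"
proof (induction n rule: less_induct)
  case (less n)
  define S where "S = inverse (1 - Abs_fps f)"
  have "S * (1 - Abs_fps f) = 1" unfolding S_def by (rule inverse_mult_eq_1) (simp add: assms)
  then have "S = 1 + Abs_fps f * S" by (simp add: algebra_simps)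
  then have "fps_nth S n = fps_nth (1 + Abs_fps f * S) n" by simp
  also have "\<dots> = (if n = 0 then 1 else 0) + (\<Sum>i\<le>n. f i * fps_nth S (n - i))"
    by (simp add: fps_mult_nth atLeast0AtMost)
  also have "\<dots> \<ge> 0"
  proof (intro add_nonneg_nonneg sum_nonneg)
    fix i assume "i \<in> {..n}"
    show "f i * fps_nth S (n - i) \<ge> 0"
    proof (cases "i = 0")
      case False
      then have "n - i < n \<or> n = 0" by auto
      then show ?thesis using less[of "n - i"] assms \<open>i \<in> {..n}\<close> False by (auto simp: S_def)
    qed (simp add: assms)
  qed auto
  finally show ?case by (simp add: S_def)
qed

text \<open>The weights \<open>f n * \<rho> ^ n\<close> form a probability distribution supported on
  multiples of the gcd \<open>d\<close>. Rescaled by \<open>d\<close> it is aperiodic, so the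
  renewal theorem applies; undoing the scaling shows growth \<open>c * (1 / \<rho> ^ d) ^ n\<close>
  along the multiples of \<open>d\<close> and zero on the other classes.\<close>

lemma quasi_regular_star:
  assumes f: "quasi_regular f" "f 0 = 0"
  shows "quasi_regular (fps_nth (inverse (1 - Abs_fps f)))"
proof (cases "\<forall>n. f n = 0")
  case True
  then have "f = (\<lambda>_. 0)" by auto
  then have "inverse (1 - Abs_fps f) = 1" by (simp add: fps_zero_def[symmetric])
  then have "fps_nth (inverse (1 - Abs_fps f)) n = (if n = 0 then 1 else 0)" for n by simp
  then show ?thesis
    by (intro quasi_regular_eventually_0) (auto intro: eventually_mono[OF eventually_gt_at_top[of 0]])
next
  case False
  then obtain n0 where "f n0 \<noteq> 0" by auto
  then obtain \<rho> y where \<rho>: "0 < \<rho>" "\<rho> < y" "(\<lambda>n. f n * \<rho> ^ n) sums 1" "summable (\<lambda>n. f n * y ^ n)"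
    using quasi_regular_normalize[OF f] by blast
  note nn = quasi_regular_nonneg[OF f(1)]
  define d where "d = Gcd {n. f n \<noteq> 0}"
  have dvd: "d dvd n" if "f n \<noteq> 0" for n using that by (auto simp: d_def)
  have "n0 \<noteq> 0" using f(2) \<open>f n0 \<noteq> 0\<close> by metis
  then have d: "d > 0" using \<open>f n0 \<noteq> 0\<close> dvd[of n0] by (auto intro: gr0I)
  have smono: "strict_mono (\<lambda>n. d * n)" using d by (auto simp: strict_mono_def)
  have off: "f n = 0" if "n \<notin> range (\<lambda>n. d * n)" for n using that dvd[of n] by (auto elim: dvdE)
  define g where "g n = f (d * n) * \<rho> ^ (d * n)" for n
  have "\<exists>c>0. (\<lambda>n. fps_nth (inverse (1 - Abs_fps g)) n) \<longlonglongrightarrow> c"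
  proof (rule renewal_theorem)
    show "g n \<ge> 0" for n using nn \<rho> by (simp add: g_def)
    show "g 0 = 0" by (simp add: g_def f)
    show "g sums 1" unfolding g_def
      using sums_mono_reindex[OF smono, of "\<lambda>n. f n * \<rho> ^ n" 1] off \<rho>(3) by simp
    show "(y / \<rho>) ^ d > 1" using \<rho> d by (intro one_less_power) auto
    have "summable (\<lambda>n. f (d * n) * y ^ (d * n))"
      using summable_mono_reindex[OF smono, of "\<lambda>n. f n * y ^ n"] off \<rho>(4) by simp
    moreover have "f (d * n) * y ^ (d * n) = g n * ((y / \<rho>) ^ d) ^ n" for n
      using \<rho> by (simp add: g_def power_divide power_mult[symmetric])
    ultimately show "summable (\<lambda>n. g n * ((y / \<rho>) ^ d) ^ n)" by simp
    have "{n. f n \<noteq> 0} = (*) d ` {n. g n \<noteq> 0}"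
      using dvd \<rho> by (fastforce simp: g_def elim: dvdE)
    then have "d = d * Gcd {n. g n \<noteq> 0}" by (metis Gcd_mult d_def normalize_nat_def id_apply)
    then show "Gcd {n. g n \<noteq> 0} = 1" using d by simp
  qed
  then obtain c where c: "c > 0" "(\<lambda>n. fps_nth (inverse (1 - Abs_fps g)) n) \<longlonglongrightarrow> c" by auto
  define v where "v = fps_nth (inverse (1 - Abs_fps g))"
  \<comment> \<open>The candidate for the coefficients of the inverse, with both normalizations
    undone; uniqueness of inverses reduces the claim to the convolution identity below.\<close>
  define u where "u k = (if d dvd k then v (k div d) / \<rho> ^ k else 0)" for k
  have g0: "g 0 = 0" by (simp add: g_def f)
  have v_rec: "v n - (\<Sum>j\<le>n. g j * v (n - j)) = (if n = 0 then 1 else 0)" for n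
  proof -
    have "(1 - Abs_fps g) * inverse (1 - Abs_fps g) = 1"
      by (rule inverse_mult_eq_1') (simp add: g0)
    from arg_cong[OF this, of "\<lambda>F. fps_nth F n"] show ?thesis
      by (simp add: left_diff_distrib fps_mult_nth atLeast0AtMost v_def[symmetric])
  qed
  have "(1 - Abs_fps f) * Abs_fps u = 1"
  proof (rule fps_ext)
    fix k
    have "fps_nth ((1 - Abs_fps f) * Abs_fps u) k = u k - (\<Sum>i\<le>k. f i * u (k - i))"
      by (simp add: left_diff_distrib fps_mult_nth atLeast0AtMost)
    also have "\<dots> = (if k = 0 then 1 else 0)"
    proof (cases "d dvd k")
      case False
      have "f i * u (k - i) = 0" if "i \<le> k" for i
      proof (cases "f i = 0")
        case nz: False
        then have "\<not> d dvd k - i" using False dvd[OF nz] that by (metis dvd_diffD1 dvd_diff_nat le_add_diff_inverse dvd_add)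
        then show ?thesis by (simp add: u_def)
      qed simp
      then have "(\<Sum>i\<le>k. f i * u (k - i)) = 0" by (intro sum.neutral) auto
      moreover have "k \<noteq> 0" using False by (metis dvd_0_right)
      ultimately show ?thesis using False by (simp add: u_def)
    next
      case True
      then obtain n where k: "k = d * n" by auto
      have "(\<Sum>i\<le>k. f i * u (k - i)) = (\<Sum>i\<in>(*) d ` {..n}. f i * u (k - i))"
      proof (rule sum.mono_neutral_right)
        show "(*) d ` {..n} \<subseteq> {..k}" by (auto simp: k)
        show "\<forall>i\<in>{..k} - (*) d ` {..n}. f i * u (k - i) = 0"
        proof
          fix i assume i: "i \<in> {..k} - (*) d ` {..n}"
          have "f i = 0"
          proof (rule ccontr)
            assume "f i \<noteq> 0"
            then obtain j where "i = d * j" using dvd by blast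
            then show False using i d by (auto simp: k)
          qed
          then show "f i * u (k - i) = 0" by simp
        qed
      qed auto
      also have "\<dots> = (\<Sum>j\<le>n. f (d * j) * u (k - d * j))"
        using d by (subst sum.reindex) (auto simp: inj_on_def)
      also have "\<dots> = (\<Sum>j\<le>n. g j * v (n - j) / \<rho> ^ k)"
      proof (intro sum.cong refl)
        fix j assume "j \<in> {..n}"
        then obtain l where l: "n = j + l" by (auto simp: le_iff_add)
        have "u (k - d * j) = v l / \<rho> ^ (d * l)" using d by (simp add: k l distrib_left u_def)
        then show "f (d * j) * u (k - d * j) = g j * v (n - j) / \<rho> ^ k"
          using \<rho> by (simp add: k l g_def distrib_left power_add)
      qed
      also have "\<dots> = (\<Sum>j\<le>n. g j * v (n - j)) / \<rho> ^ k" by (simp add: sum_divide_distrib)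
      finally have "u k - (\<Sum>i\<le>k. f i * u (k - i)) = (v n - (\<Sum>j\<le>n. g j * v (n - j))) / \<rho> ^ k"
        using d by (simp add: u_def k diff_divide_distrib)
      also have "\<dots> = (if k = 0 then 1 else 0)" unfolding v_rec using d by (simp add: k)
      finally show ?thesis .
    qed
    finally show "fps_nth ((1 - Abs_fps f) * Abs_fps u) k = fps_nth 1 k" by simp
  qed
  then have inv: "inverse (1 - Abs_fps f) = Abs_fps u" by (rule fps_inverse_unique)
  show ?thesis
  proof (rule quasi_regularI[OF _ d])
    show "fps_nth (inverse (1 - Abs_fps f)) n \<ge> 0" for n using nn f(2) by (rule fps_star_nonneg)
    fix r assume "r < d"
    show "regular (\<lambda>n. fps_nth (inverse (1 - Abs_fps f)) (d * n + r))"
    proof (cases "r = 0")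
      case True
      have "u (d * n) / (real n ^ 0 * (1 / \<rho> ^ d) ^ n) = v n" for n
        using d \<rho> by (simp add: u_def power_divide power_mult)
      then have "grows (\<lambda>n. u (d * n)) c 0 (1 / \<rho> ^ d)"
        using c \<rho> by (simp add: grows_def v_def)
      then show ?thesis using True by (auto simp: inv regular_def)
    next
      case False
      then have "\<not> d dvd d * n + r" for n using \<open>r < d\<close> by (simp add: dvd_add_right_iff nat_dvd_not_less)
      then show ?thesis by (simp add: inv u_def)
    qed
  qed
qed

section \<open>Nonnegative linear systems\<close>

text \<open>Kleene's state elimination: \<open>X i j\<close> enumerates the weighted paths from \<open>i\<close> to \<open>j\<close> whose
  intermediate vertices lie in \<open>V\<close>.\<close>

lemma path_series:
  fixes A :: "'i \<Rightarrow> 'i \<Rightarrow> real"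
  assumes "finite V" "\<And>i j. A i j \<ge> 0"
  shows "\<exists>X. \<forall>i j. quasi_regular (fps_nth (X i j)) \<and>
    X i j = fps_X * (fps_const (A i j) + (\<Sum>k\<in>V. fps_const (A i k) * X k j))"
  using assms(1)
proof (induction V rule: finite_induct)
  case empty
  have "quasi_regular (fps_nth (fps_X * fps_const (A i j)))" for i j
    by (intro quasi_regular_eventually_0 eventually_mono[OF eventually_gt_at_top[of 1]])
       (auto simp: assms(2) fps_X_mult_nth split: nat.splits)
  then show ?case
  proof (intro exI[of _ "\<lambda>i j. fps_X * fps_const (A i j)"] allI conjI)
    show "fps_X * fps_const (A i j) = fps_X * (fps_const (A i j)
        + (\<Sum>k\<in>{}. fps_const (A i k) * (fps_X * fps_const (A k j))))" for i j by simp
  qed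
next
  case (insert v V)
  then obtain X where X: "\<And>i j. quasi_regular (fps_nth (X i j))"
    "\<And>i j. X i j = fps_X * (fps_const (A i j) + (\<Sum>k\<in>V. fps_const (A i k) * X k j))"
    by blast
  have X0: "fps_nth (X i j) 0 = 0" for i j by (subst X(2)) simp
  define S where "S = inverse (1 - X v v)"
  have S: "S * (1 - X v v) = 1" unfolding S_def by (rule inverse_mult_eq_1) (simp add: X0)
  have S_quasi: "quasi_regular (fps_nth S)"
    using quasi_regular_star[OF X(1) X0, of v v] by (simp add: S_def fps_nth_inverse)
  \<comment> \<open>A path that visits the new vertex \<open>v\<close> reaches it for the first
    time, loops there any number of times, which \<open>S\<close> accounts for, and then leaves it
    for good.\<close>
  define Y where "Y i j = X i j + X i v * (S * X v j)" for i j
  have Yv: "Y v j = S * X v j" for j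
  proof -
    have "Y v j = (1 + X v v * S) * X v j" by (simp add: Y_def algebra_simps)
    also have "1 + X v v * S = S" using S by (simp add: algebra_simps)
    finally show ?thesis .
  qed
  have "Y i j = fps_X * (fps_const (A i j) + (\<Sum>k\<in>insert v V. fps_const (A i k) * Y k j))" for i j
  proof -
    have "(\<Sum>k\<in>V. fps_const (A i k) * Y k j) = (\<Sum>k\<in>V. fps_const (A i k) * X k j)
        + (\<Sum>k\<in>V. fps_const (A i k) * X k v) * (S * X v j)"
      by (simp add: Y_def distrib_left sum.distrib sum_distrib_right mult.assoc)
    moreover have "fps_X * (\<Sum>k\<in>V. fps_const (A i k) * X k v) = X i v - fps_X * fps_const (A i v)"
      by (subst (2) X(2)) (simp add: distrib_left)
    moreover have "fps_X * (\<Sum>k\<in>V. fps_const (A i k) * X k j) = X i j - fps_X * fps_const (A i j)"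
      by (subst (2) X(2)) (simp add: distrib_left)
    ultimately show ?thesis using insert.hyps
      by (simp add: Yv distrib_left mult.assoc[symmetric]) (simp add: Y_def algebra_simps)
  qed
  moreover have "quasi_regular (fps_nth (Y i j))" for i j
  proof -
    have "fps_nth (Y i j) = (\<lambda>n. fps_nth (X i j) n + convolution (fps_nth (X i v)) (convolution (fps_nth S) (fps_nth (X v j))) n)"
      by (simp add: fun_eq_iff Y_def fps_nth_mult_convolution[symmetric])
    then show ?thesis
      using quasi_regular_add[OF X(1) quasi_regular_convolution[OF X(1) quasi_regular_convolution[OF S_quasi X(1)]]]
      by simp
  qed
  ultimately show ?case by blast
qed

lemma quasi_regular_linear_system:
  fixes y :: "'i \<Rightarrow> nat \<Rightarrow> nat"
  assumes "finite I" "\<And>i n. i \<in> I \<Longrightarrow> y i (Suc n) = (\<Sum>j\<in>I. A i j * y j n)" "i \<in> I"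
  shows "quasi_regular (\<lambda>n. real (y i n))"
proof -
  obtain X where X: "\<And>i j. quasi_regular (fps_nth (X i j))"
    "\<And>i j. X i j = fps_X * (fps_const (real (A i j)) + (\<Sum>k\<in>I. fps_const (real (A i k)) * X k j))"
    using path_series[OF assms(1), of "\<lambda>i j. real (A i j)", OF of_nat_0_le_iff] by blast
  \<comment> \<open>The powers of the matrix applied to the initial vector. The path series contain
    only paths of length at least 1, so the term for \<open>n = 0\<close> is added
    separately.\<close>
  define z where "z i n = (if n = 0 then real (y i 0) else 0) + (\<Sum>j\<in>I. real (y j 0) * fps_nth (X i j) n)" for i n
  have X_Suc: "fps_nth (X i j) (Suc n) = (if n = 0 then real (A i j) else 0) + (\<Sum>k\<in>I. real (A i k) * fps_nth (X k j) n)" for i j n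
    by (subst X(2)) (simp add: fps_sum_nth)
  have X_0: "fps_nth (X i j) 0 = 0" for i j by (subst X(2)) simp
  have z_Suc: "z i (Suc n) = (\<Sum>k\<in>I. real (A i k) * z k n)" for i n
  proof -
    have "(\<Sum>j\<in>I. real (y j 0) * (\<Sum>k\<in>I. real (A i k) * fps_nth (X k j) n))
        = (\<Sum>k\<in>I. \<Sum>j\<in>I. real (y j 0) * (real (A i k) * fps_nth (X k j) n))"
      unfolding sum_distrib_left by (rule sum.swap)
    then have "z i (Suc n) = (\<Sum>k\<in>I. real (y k 0) * (if n = 0 then real (A i k) else 0)) +
        (\<Sum>k\<in>I. \<Sum>j\<in>I. real (y j 0) * (real (A i k) * fps_nth (X k j) n))"
      by (simp add: z_def X_Suc distrib_left sum.distrib del: if_distrib)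
    also have "\<dots> = (\<Sum>k\<in>I. real (A i k) * z k n)"
      unfolding sum.distrib[symmetric]
      by (intro sum.cong) (auto simp: z_def distrib_left sum_distrib_left mult_ac)
    finally show ?thesis .
  qed
  have "\<forall>i\<in>I. real (y i n) = z i n" for n
  proof (induction n)
    case (Suc n)
    then show ?case using assms(2) by (simp add: z_Suc)
  qed (simp add: z_def X_0)
  then have eq: "(\<lambda>n. real (y i n)) = z i" using assms(3) by auto
  have "\<forall>\<^sub>F n in sequentially. (if n = 0 then real (y i 0) else 0) = 0"
    using eventually_gt_at_top[of 0] by eventually_elim simp
  then have "quasi_regular (\<lambda>n. (if n = 0 then real (y i 0) else 0) + (\<Sum>j\<in>I. real (y j 0) * fps_nth (X i j) n))"
    by (intro quasi_regular_add quasi_regular_sum quasi_regular_cmult X quasi_regular_eventually_0) auto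
  moreover have "z i = (\<lambda>n. (if n = 0 then real (y i 0) else 0) + (\<Sum>j\<in>I. real (y j 0) * fps_nth (X i j) n))"
    by (rule ext) (rule z_def)
  ultimately show ?thesis by (simp only: eq)
qed

text \<open>The quotient of two growth types has a limit in the extended sense; the bound by
  \<open>K\<close> rules out the only divergent case, a faster growing \<open>q\<close>.\<close>

lemma regular_ratio_convergent:
  assumes p: "regular p" and q: "regular q" and pos: "\<And>n. p n > 0"
    and bound: "\<And>n. 0 \<le> q n \<and> q n \<le> K * p n"
  shows "convergent (\<lambda>n. q n / p n)"
proof -
  have "p n \<noteq> 0" for n using pos[of n] by simp
  then have "\<not> (\<forall>\<^sub>F n in sequentially. p n = 0)" by simp
  then obtain C k \<theta> where C: "grows p C k \<theta>" using p by (auto simp: regular_def)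
  consider "\<forall>\<^sub>F n in sequentially. q n = 0" | D l \<rho> where "grows q D l \<rho>"
    using q by (auto simp: regular_def)
  then show ?thesis
  proof cases
    case 1
    then have "\<forall>\<^sub>F n in sequentially. q n / p n = 0" by eventually_elim simp
    then show ?thesis by (rule convergentI[OF tendsto_eventually])
  next
    case D: 2
    have conv: "(\<lambda>n. q n / p n) \<longlonglongrightarrow> d / C" if "(\<lambda>n. q n / (real n ^ k * \<theta> ^ n)) \<longlonglongrightarrow> d" for d
    proof -
      have "(\<lambda>n. q n / (real n ^ k * \<theta> ^ n) / (p n / (real n ^ k * \<theta> ^ n))) \<longlonglongrightarrow> d / C"
        using that C by (intro tendsto_divide) (auto simp: grows_def)
      then show ?thesis
      proof (rule Lim_transform_eventually)
        show "\<forall>\<^sub>F n in sequentially. q n / (real n ^ k * \<theta> ^ n) / (p n / (real n ^ k * \<theta> ^ n)) = q n / p n"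
          using eventually_gt_at_top[of 0] by eventually_elim (use C in \<open>auto simp: grows_def\<close>)
      qed
    qed
    show ?thesis
    proof (cases \<rho> \<theta> l k rule: growth_rate_cases)
      case 1
      then show ?thesis using conv[OF grows_little_o[OF C D]] by (auto intro: convergentI)
    next
      case 2
      then show ?thesis using conv[of D] D by (auto simp: grows_def intro: convergentI)
    next
      case 3
      have "(\<lambda>n. K * (p n / (real n ^ l * \<rho> ^ n))) \<longlonglongrightarrow> K * 0"
        using 3 by (intro tendsto_mult tendsto_const grows_little_o[OF D C]) auto
      moreover have "q n / (real n ^ l * \<rho> ^ n) \<le> K * (p n / (real n ^ l * \<rho> ^ n))" for n
        using bound[of n] D by (auto simp: grows_def intro!: divide_right_mono)
      ultimately have "D \<le> K * 0" using D
        by (intro LIMSEQ_le[of "\<lambda>n. q n / (real n ^ l * \<rho> ^ n)" D]) (auto simp: grows_def)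
      then show ?thesis using D by (simp add: grows_def)
    qed
  qed
qed

section \<open>Upper limits\<close>

text \<open>The upper limit is required to be a real number, so the definition also carries
  finiteness.\<close>

definition is_limsup :: "(nat \<Rightarrow> real) \<Rightarrow> real \<Rightarrow> bool" where
  "is_limsup x r \<longleftrightarrow>
     (\<forall>\<epsilon>>0. (\<forall>\<^sub>F n in sequentially. x n \<le> r + \<epsilon>) \<and> (\<exists>\<^sub>F n in sequentially. x n \<ge> r - \<epsilon>))"

lemma frequently_sequentially: "(\<exists>\<^sub>F n in sequentially. P n) \<longleftrightarrow> (\<forall>N. \<exists>n\<ge>N. P n)"
  by (auto simp: frequently_def eventually_sequentially)

lemma eventually_residues:
  assumes "m > 0" "\<And>r. r < m \<Longrightarrow> \<forall>\<^sub>F n in sequentially. P (m * n + (t + r))"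
  shows "\<forall>\<^sub>F n in sequentially. P (n::nat)"
proof -
  have "\<forall>\<^sub>F n in sequentially. \<forall>r\<in>{..<m}. P (m * n + (t + r))"
    using assms(2) by (intro eventually_ball_finite) auto
  then obtain N where N: "\<And>n r. n \<ge> N \<Longrightarrow> r < m \<Longrightarrow> P (m * n + (t + r))"
    by (auto simp: eventually_sequentially)
  have "P n" if n: "n \<ge> t + m * N" for n
  proof -
    have "N \<le> (n - t) div m" using n assms(1) by (simp add: less_eq_div_iff_mult_less_eq mult.commute)
    then have "P (m * ((n - t) div m) + (t + (n - t) mod m))" using assms(1) by (intro N) auto
    moreover have "m * ((n - t) div m) + (t + (n - t) mod m) = n" using n by simp
    ultimately show ?thesis by simp
  qed
  then show ?thesis by (auto simp: eventually_sequentially)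
qed

lemma is_limsup_residues:
  assumes m: "m > 0" and lim: "\<And>r. r < m \<Longrightarrow> (\<lambda>n. x (m * n + (t + r))) \<longlonglongrightarrow> L r"
  shows "is_limsup x (Max (L ` {..<m}))"
  unfolding is_limsup_def
proof (intro allI impI conjI)
  fix \<epsilon> :: real assume \<epsilon>: "\<epsilon> > 0"
  let ?M = "Max (L ` {..<m})"
  show "\<forall>\<^sub>F n in sequentially. x n \<le> ?M + \<epsilon>"
  proof (rule eventually_residues[OF m])
    fix r assume r: "r < m"
    then have "L r \<le> ?M" by (intro Max_ge) auto
    then have "L r < ?M + \<epsilon>" using \<epsilon> by simp
    then have "\<forall>\<^sub>F n in sequentially. x (m * n + (t + r)) < ?M + \<epsilon>"
      by (rule order_tendstoD(2)[OF lim[OF r]])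
    then show "\<forall>\<^sub>F n in sequentially. x (m * n + (t + r)) \<le> ?M + \<epsilon>"
      by (rule eventually_mono) simp
  qed
  have "?M \<in> L ` {..<m}" using m by (intro Max_in) auto
  then obtain r where r: "r < m" "?M = L r" by auto
  show "\<exists>\<^sub>F n in sequentially. x n \<ge> ?M - \<epsilon>"
    unfolding frequently_sequentially
  proof
    fix N
    have "\<forall>\<^sub>F n in sequentially. x (m * n + (t + r)) > L r - \<epsilon>"
      using \<epsilon> by (intro order_tendstoD(1)[OF lim[OF r(1)]]) auto
    with eventually_ge_at_top[of N] have "\<forall>\<^sub>F n in sequentially. n \<ge> N \<and> x (m * n + (t + r)) > L r - \<epsilon>"
      by eventually_elim auto
    then obtain n where n: "n \<ge> N" "x (m * n + (t + r)) > L r - \<epsilon>"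
      by (auto simp: eventually_sequentially)
    have "1 * n \<le> m * n" using m by (intro mult_right_mono) auto
    then have "m * n + (t + r) \<ge> N" using n by linarith
    then show "\<exists>n\<ge>N. x n \<ge> ?M - \<epsilon>" using n(2) r(2) by (intro exI[of _ "m * n + (t + r)"]) auto
  qed
qed

section \<open>Fixed points of morphisms\<close>

lemma morph_append: "morph h (u @ v) = morph h u @ morph h v"
  by (simp add: morph_def)

lemma morph_funpow_append: "(morph h ^^ n) (u @ v) = (morph h ^^ n) u @ (morph h ^^ n) v"
  by (induction n) (auto simp: morph_append)

lemma morph_funpow_Nil [simp]: "(morph h ^^ n) [] = []"
  by (induction n) (auto simp: morph_def)

lemma morph_single [simp]: "morph h [c] = h c"
  by (simp add: morph_def)

lemma morph_Nil [simp]: "morph h [] = []"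
  by (simp add: morph_def)

lemma morph_Cons: "morph h (c # u) = h c @ morph h u"
  by (simp add: morph_def)

lemma length_morph_funpow:
  "length ((morph h ^^ n) u) = (\<Sum>c\<leftarrow>u. length ((morph h ^^ n) [c]))"
proof (induction u)
  case (Cons c u)
  then show ?case using morph_funpow_append[of n h "[c]" u] by simp
qed simp

lemma set_morph_funpow: "set ((morph h ^^ n) u) = (\<Union>c\<in>set u. set ((morph h ^^ n) [c]))"
proof (induction u)
  case (Cons c u)
  then show ?case using morph_funpow_append[of n h "[c]" u] by simp
qed simp

lemma morph_of_funpow: "morph (\<lambda>c. (morph h ^^ m) [c]) = morph h ^^ m"
proof
  fix u
  show "morph (\<lambda>c. (morph h ^^ m) [c]) u = (morph h ^^ m) u"
  proof (induction u)
    case (Cons c u)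
    then show ?case using morph_funpow_append[of m h "[c]" u]
      by (simp add: morph_Cons)
  qed simp
qed

context
  fixes \<Sigma> :: "nat set" and h :: "nat \<Rightarrow> nat list" and a :: nat and w :: "nat \<Rightarrow> nat"
  assumes pm: "pure_morphic_by \<Sigma> h a w"
begin

lemma iterates_Suc:
  obtains x where "x \<noteq> []" "\<And>n. (morph h ^^ n) x \<noteq> []" "h a = a # x"
    "\<And>n. (morph h ^^ Suc n) [a] = (morph h ^^ n) [a] @ (morph h ^^ n) x"
proof -
  obtain x where x: "h a = a # x" "x \<noteq> []" "\<And>n. (morph h ^^ n) x \<noteq> []"
    using pm by (auto simp: pure_morphic_by_def prolongable_def)
  have "(morph h ^^ Suc n) [a] = (morph h ^^ n) [a] @ (morph h ^^ n) x" for n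
    using morph_funpow_append[of n h "[a]" x] x(1) by (simp add: funpow_swap1)
  then show ?thesis using x that by blast
qed

lemma length_iterates_less: "length ((morph h ^^ n) [a]) < length ((morph h ^^ Suc n) [a])"
  using iterates_Suc by (metis append_Nil2 length_append length_greater_0_conv less_add_same_cancel1)

lemma length_iterates_ge: "Suc n \<le> length ((morph h ^^ n) [a])"
proof (induction n)
  case (Suc n)
  then show ?case using length_iterates_less[of n] by linarith
qed simp

lemma map_prefix_iterate: "map w [0..<length ((morph h ^^ n) [a])] = (morph h ^^ n) [a]"
  using pm by (intro nth_equalityI) (auto simp: pure_morphic_by_def is_fixpoint_word_def)

text \<open>Every prefix lies in some iterate of \<open>a\<close>, and the image of that iterate is
  the next iterate, again a prefix of \<open>w\<close>.\<close>

lemma morph_prefix: "morph h (map w [0..<i]) = map w [0..<length (morph h (map w [0..<i]))]"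
proof -
  obtain n where n: "i \<le> length ((morph h ^^ n) [a])" using length_iterates_ge[of i] by (meson Suc_leD)
  have "(morph h ^^ n) [a] = map w [0..<length ((morph h ^^ n) [a])]"
    by (rule map_prefix_iterate[symmetric])
  also have "\<dots> = map w [0..<i] @ map w [i..<length ((morph h ^^ n) [a])]"
    unfolding map_append[symmetric]
    using n upt_add_eq_append[of 0 i "length ((morph h ^^ n) [a]) - i"] by simp
  finally have "(morph h ^^ Suc n) [a] = morph h (map w [0..<i]) @ morph h (map w [i..<length ((morph h ^^ n) [a])])"
    by (metis funpow.simps(2) o_apply morph_append)
  then have "map w [0..<length ((morph h ^^ Suc n) [a])]
      = morph h (map w [0..<i]) @ morph h (map w [i..<length ((morph h ^^ n) [a])])"
    unfolding map_prefix_iterate .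
  then obtain N v where N: "map w [0..<N] = morph h (map w [0..<i]) @ v" by blast
  define l where "l = length (morph h (map w [0..<i]))"
  have "N = length (map w [0..<N])" by simp
  also have "\<dots> = l + length v" unfolding N l_def by simp
  finally have "take l (map w [0..<N]) = map w [0..<l]" by (simp add: take_map)
  moreover have "take l (map w [0..<N]) = morph h (map w [0..<i])" unfolding N l_def by simp
  ultimately show ?thesis by (simp add: l_def)
qed

text \<open>Single letters may be erased, so the count cannot be done letter by letter. If
  \<open>i\<close> lies between the lengths of two consecutive iterates of \<open>a\<close>, the
  prefix contains the shorter iterate, and its image contains the longer one, which exceeds
  \<open>i\<close>.\<close>

lemma morph_prefix_longer:
  assumes "i \<ge> 1"
  shows "length (morph h (map w [0..<i])) > i"
proof -
  let ?l = "\<lambda>n. length ((morph h ^^ n) [a])"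
  define n where "n = (LEAST n. ?l n > i)"
  have n: "?l n > i" unfolding n_def using length_iterates_ge[of i] by (intro LeastI[of "\<lambda>n. ?l n > i" i]) simp
  have "n \<noteq> 0" using n assms by (intro notI) simp
  then obtain m where m: "n = Suc m" by (auto simp: gr0_conv_Suc)
  have "\<not> ?l m > i" using not_less_Least[of m "\<lambda>n. ?l n > i"] by (simp add: m n_def[symmetric])
  then have le: "?l m \<le> i" by simp
  have "map w [0..<i] = map w [0..<?l m] @ map w [?l m..<i]"
    unfolding map_append[symmetric] using le upt_add_eq_append[of 0 "?l m" "i - ?l m"] by simp
  then have "morph h (map w [0..<i]) = (morph h ^^ Suc m) [a] @ morph h (map w [?l m..<i])"
    unfolding map_prefix_iterate by (simp add: morph_append)
  then show ?thesis using n unfolding m by simp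
qed

lemma word_letters: "w i \<in> \<Sigma>"
proof -
  have "set ((morph h ^^ n) [a]) \<subseteq> \<Sigma>" for n
  proof (induction n)
    case (Suc n)
    then show ?case using pm by (fastforce simp: morph_def pure_morphic_by_def)
  qed (use pm in \<open>simp add: pure_morphic_by_def\<close>)
  moreover have "w i = (morph h ^^ i) [a] ! i" "i < length ((morph h ^^ i) [a])"
    using pm length_iterates_ge[of i] by (auto simp: pure_morphic_by_def is_fixpoint_word_def)
  ultimately show ?thesis by (metis nth_mem subsetD)
qed

lemma pure_morphic_power:
  assumes "m \<ge> 1"
  shows "pure_morphic_by \<Sigma> (\<lambda>c. (morph h ^^ m) [c]) a w"
proof -
  let ?g = "\<lambda>c. (morph h ^^ m) [c]"
  obtain x where x: "\<And>n. (morph h ^^ n) x \<noteq> []" "h a = a # x"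
    "\<And>n. (morph h ^^ Suc n) [a] = (morph h ^^ n) [a] @ (morph h ^^ n) x"
    using iterates_Suc by metis
  have letters: "set ((morph h ^^ n) [c]) \<subseteq> \<Sigma>" if "c \<in> \<Sigma>" for n c
  proof (induction n)
    case (Suc n)
    then show ?case using pm by (fastforce simp: morph_def pure_morphic_by_def)
  qed (use that in simp)
  have "\<exists>y. (morph h ^^ Suc n) [a] = a # x @ y" for n
  proof (induction n)
    case (Suc n)
    then show ?case using x(3)[of "Suc n"] by auto
  qed (simp add: x)
  then obtain y where y: "?g a = a # x @ y" using assms by (metis Suc_le_D One_nat_def)
  have "prolongable ?g a"
    unfolding prolongable_def
  proof (intro exI[of _ "x @ y"] conjI allI)
    show "x @ y \<noteq> []" using x(1)[of 0] by simp
    show "(morph ?g ^^ n) (x @ y) \<noteq> []" for n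
      unfolding morph_of_funpow funpow_mult morph_funpow_append using x(1) by simp
  qed (rule y)
  moreover have "is_fixpoint_word ?g a w"
    using pm unfolding is_fixpoint_word_def morph_of_funpow funpow_mult
    by (auto simp: pure_morphic_by_def is_fixpoint_word_def)
  ultimately show ?thesis using pm letters by (auto simp: pure_morphic_by_def)
qed

text \<open>The set of letters all of whose \<open>n\<close>-th iterates lie in \<open>B\<close> is obtained by iterating a map on
  a finite set, so some power of \<open>h\<close> makes it stationary.\<close>

lemma stationary_power:
  obtains m D where "m \<ge> 1" "\<And>c. c \<in> \<Sigma> \<Longrightarrow> c \<in> D \<longleftrightarrow> set ((morph h ^^ m) [c]) \<subseteq> B"
    "\<And>c. c \<in> \<Sigma> \<Longrightarrow> c \<in> D \<longleftrightarrow> set ((morph h ^^ m) [c]) \<subseteq> D"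
proof -
  define T where "T n = {c \<in> \<Sigma>. set ((morph h ^^ n) [c]) \<subseteq> B}" for n
  have closed: "set ((morph h ^^ n) [c]) \<subseteq> \<Sigma>" if "c \<in> \<Sigma>" for n c
  proof (induction n)
    case (Suc n)
    then show ?case using pm by (fastforce simp: morph_def pure_morphic_by_def)
  qed (use that in simp)
  have T_add: "T (k + n) = {c \<in> \<Sigma>. set ((morph h ^^ k) [c]) \<subseteq> T n}" for k n
  proof -
    have "set ((morph h ^^ (k + n)) [c]) = (\<Union>d\<in>set ((morph h ^^ k) [c]). set ((morph h ^^ n) [d]))" for c
      using set_morph_funpow[of n h "(morph h ^^ k) [c]"]
      by (subst add.commute) (simp add: funpow_add)
    then show ?thesis using closed by (fastforce simp: T_def)
  qed
  have "T n \<in> Pow \<Sigma>" for n by (auto simp: T_def)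
  moreover have "finite (Pow \<Sigma>)" using pm by (simp add: pure_morphic_by_def)
  ultimately have "finite (range T)" by (meson finite_subset image_subsetI)
  then have "\<not> inj T" using finite_imageD infinite_UNIV_nat by blast
  then obtain i j where "i < j" "T i = T j" by (metis injI linorder_neqE_nat)
  then obtain p where p: "p > 0" "T (i + p) = T i" by (metis less_imp_add_positive)
  have per: "T (i + n + p * k) = T (i + n)" for n k
  proof (induction k)
    case (Suc k)
    have "T (i + n + p * Suc k) = T ((n + p * k) + (i + p))" by (simp add: algebra_simps)
    also have "\<dots> = T ((n + p * k) + i)"
      by (simp only: T_add[of "n + p * k" "i + p"] T_add[of "n + p * k" i] p(2))
    finally show ?case using Suc by (simp add: algebra_simps)
  qed simp
  \<comment> \<open>A multiple of the period that is at least as large as the preperiod, so that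
    \<open>T (m + m) = T m\<close>.\<close>
  define m where "m = p * Suc i"
  have "m \<ge> i" using p(1) by (cases p) (auto simp: m_def)
  then obtain n where n: "m = i + n" by (auto simp: le_iff_add)
  have TT: "T (m + m) = T m" using per[of n "Suc i"] unfolding n[symmetric] m_def[symmetric] .
  have "m \<ge> 1" using p(1) by (simp add: m_def)
  moreover have "c \<in> T m \<longleftrightarrow> set ((morph h ^^ m) [c]) \<subseteq> B" if "c \<in> \<Sigma>" for c using that by (simp add: T_def)
  moreover have "c \<in> T m \<longleftrightarrow> set ((morph h ^^ m) [c]) \<subseteq> T m" if "c \<in> \<Sigma>" for c
    using T_add[of m m] that unfolding TT by blast
  ultimately show ?thesis using that by blast
qed

end

section \<open>Long runs in a fixed point\<close>

text \<open>Letters outside \<open>D\<close> serve as delimiters: each has a delimiter in its block,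
  while the block of a letter in \<open>D\<close> contains none. A letter of \<open>w\<close> with
  empty block belongs to \<open>D\<close> vacuously.\<close>

locale stationary_word =
  fixes w :: "nat \<Rightarrow> nat" and g :: "nat \<Rightarrow> nat list" and B D :: "nat set"
  assumes finite_letters: "finite (range w)"
    and prefix: "morph g (map w [0..<i]) = map w [0..<length (morph g (map w [0..<i]))]"
    and longer: "i \<ge> 1 \<Longrightarrow> length (morph g (map w [0..<i])) > i"
    and D_iff_B: "w i \<in> D \<longleftrightarrow> set (g (w i)) \<subseteq> B"
    and D_iff_D: "w i \<in> D \<longleftrightarrow> set (g (w i)) \<subseteq> D"
    and infinite_compl: "infinite {i. w i \<notin> B}"
begin

section \<open>Blocks of the fixed point\<close>

definition \<phi> :: "nat \<Rightarrow> nat" where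
  "\<phi> i = length (morph g (map w [0..<i]))"

lemma phi_0 [simp]: "\<phi> 0 = 0" by (simp add: \<phi>_def morph_def)

lemma phi_Suc: "\<phi> (Suc i) = \<phi> i + length (g (w i))"
  by (simp add: \<phi>_def morph_def)

lemma phi_mono: "i \<le> j \<Longrightarrow> \<phi> i \<le> \<phi> j"
  by (rule lift_Suc_mono_le[of \<phi>]) (auto simp: phi_Suc)

lemma phi_gt: "i \<ge> 1 \<Longrightarrow> \<phi> i > i"
  using longer by (simp add: \<phi>_def)

lemma phi_ge: "\<phi> i \<ge> i"
  using phi_gt[of i] by (cases "i = 0") auto

lemma phi_prefix: "morph g (map w [0..<i]) = map w [0..<\<phi> i]"
  unfolding \<phi>_def by (rule prefix)

lemma block: "g (w i) = map w [\<phi> i..<\<phi> (Suc i)]"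
proof -
  have "map w [0..<\<phi> (Suc i)] = map w [0..<\<phi> i] @ g (w i)"
    unfolding phi_prefix[symmetric] by (simp add: morph_append)
  moreover have "map w [0..<\<phi> (Suc i)] = map w [0..<\<phi> i] @ map w [\<phi> i..<\<phi> (Suc i)]"
    unfolding map_append[symmetric] phi_Suc by (simp add: upt_add_eq_append[of 0])
  ultimately show ?thesis by simp
qed

lemma block_nth: "t < length (g (w i)) \<Longrightarrow> w (\<phi> i + t) = g (w i) ! t"
  by (subst block) (simp add: phi_Suc)

lemma block_set: "set (g (w i)) = w ` {\<phi> i..<\<phi> (Suc i)}"
  by (subst block) simp

lemma letter_in_block: "\<phi> i \<le> k \<Longrightarrow> k < \<phi> (Suc i) \<Longrightarrow> w k \<in> set (g (w i))"
  by (simp add: block_set)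

text \<open>Blocks may be empty, so the block containing \<open>k\<close> is the one before the
  least \<open>j\<close> with \<open>k < \<phi> j\<close>, which exists as
  \<open>\<phi> j \<ge> j\<close>.\<close>

lemma in_block:
  obtains i where "\<phi> i \<le> k" "k < \<phi> (Suc i)"
proof -
  define j where "j = (LEAST j. k < \<phi> j)"
  have j: "k < \<phi> j" unfolding j_def using phi_ge[of "Suc k"] by (intro LeastI[of "\<lambda>j. k < \<phi> j" "Suc k"]) simp
  then have "j \<noteq> 0" by (intro notI) simp
  then obtain i where i: "j = Suc i" by (auto simp: gr0_conv_Suc)
  have "\<not> k < \<phi> i" using not_less_Least[of i "\<lambda>j. k < \<phi> j"] by (simp add: i j_def[symmetric])
  then show ?thesis using that[of i] j i by simp
qed

lemma block_order: "\<phi> i \<le> k \<Longrightarrow> l < \<phi> (Suc j) \<Longrightarrow> k \<le> l \<Longrightarrow> i \<le> j"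
  using phi_mono[of "Suc j" i] by linarith

definition K :: nat where "K = Max (length ` g ` range w)"

lemma block_length: "length (g (w i)) \<le> K"
  unfolding K_def using finite_letters by (intro Max_ge) auto

lemma phi_Suc_le: "\<phi> (Suc i) \<le> \<phi> i + K"
  using block_length[of i] by (simp add: phi_Suc)

lemma phi_le: "\<phi> i \<le> K * i"
proof (induction i)
  case (Suc i)
  then show ?case using phi_Suc_le[of i] by simp
qed simp

lemma delim_iff_block: "w i \<notin> D \<longleftrightarrow> (\<exists>k. \<phi> i \<le> k \<and> k < \<phi> (Suc i) \<and> w k \<notin> D)"
  unfolding D_iff_D[of i] block_set by (auto simp: image_subset_iff)

lemma delim_if_compl: "\<phi> i \<le> k \<Longrightarrow> k < \<phi> (Suc i) \<Longrightarrow> w k \<notin> B \<Longrightarrow> w i \<notin> D"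
  unfolding D_iff_B[of i] block_set by (auto simp: image_subset_iff)

lemma exists_compl: "\<exists>k\<ge>N. w k \<notin> B"
  using infinite_compl unfolding infinite_nat_iff_unbounded_le by auto

lemma exists_delim: "\<exists>k\<ge>N. w k \<notin> D"
proof -
  obtain k where k: "k \<ge> \<phi> N" "w k \<notin> B" using exists_compl by blast
  obtain i where i: "\<phi> i \<le> k" "k < \<phi> (Suc i)" using in_block by blast
  have "w i \<notin> D" using delim_if_compl i k by blast
  moreover have "N \<le> i" using block_order[of N k k i] i k by simp
  ultimately show ?thesis by blast
qed

text \<open>The first delimiter \<open>j\<close> lies in the block of some delimiter
  \<open>i\<close>, so \<open>i \<ge> j\<close>. For \<open>j \<ge> 1\<close> this is impossible,
  since the block of \<open>i\<close> starts beyond \<open>i\<close>.\<close>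

lemma delim_0: "w 0 \<notin> D"
proof
  assume "w 0 \<in> D"
  obtain k where k: "w k \<notin> D" using exists_delim by blast
  define j where "j = (LEAST j. w j \<notin> D)"
  have j: "w j \<notin> D" "\<And>i. i < j \<Longrightarrow> w i \<in> D"
    unfolding j_def using LeastI[of "\<lambda>j. w j \<notin> D", OF k] not_less_Least by auto
  obtain i where i: "\<phi> i \<le> j" "j < \<phi> (Suc i)" using in_block by blast
  then have "w i \<notin> D" using j(1) delim_iff_block by blast
  then have "j \<le> i" using j(2) by (metis not_le)
  moreover have "j \<ge> 1" using j(1) \<open>w 0 \<in> D\<close> by (cases j) auto
  ultimately show False using phi_gt[of i] i(1) by simp
qed

text \<open>A maximal run over \<open>D\<close>, possibly empty, encoded by the delimiters on both
  sides.\<close>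

definition consec :: "nat \<Rightarrow> nat \<Rightarrow> bool" where
  "consec p q \<longleftrightarrow> p < q \<and> w p \<notin> D \<and> w q \<notin> D \<and> (\<forall>k. p < k \<and> k < q \<longrightarrow> w k \<in> D)"

lemma consec_unique_right: "consec p q \<Longrightarrow> w d \<notin> D \<Longrightarrow> p < d \<Longrightarrow> q \<le> d"
  by (metis consec_def not_le)

section \<open>Delimiters inside the blocks of delimiters\<close>

definition offsets :: "nat \<Rightarrow> nat set" where
  "offsets c = {t. t < length (g c) \<and> g c ! t \<notin> D}"

text \<open>The left end of a run passes to the last delimiter of its block, the right end to the
  first one. Treating the choice of the offset as a parameter allows both to be analysed at
  once.\<close>

definition selects :: "(nat \<Rightarrow> nat) \<Rightarrow> bool" where
  "selects \<iota> \<longleftrightarrow> (\<forall>p. w p \<notin> D \<longrightarrow> \<iota> (w p) \<in> offsets (w p))"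

definition child :: "(nat \<Rightarrow> nat) \<Rightarrow> nat \<Rightarrow> nat" where
  "child \<iota> p = \<phi> p + \<iota> (w p)"

definition last_off :: "nat \<Rightarrow> nat" where "last_off c = Max (offsets c)"
definition first_off :: "nat \<Rightarrow> nat" where "first_off c = Min (offsets c)"

lemma offsets_finite: "finite (offsets c)"
  by (simp add: offsets_def)

lemma offsets_delim:
  assumes "w p \<notin> D"
  shows "offsets (w p) \<noteq> {}"
proof -
  obtain c where "c \<in> set (g (w p))" "c \<notin> D" using assms D_iff_D[of p] by auto
  then show ?thesis by (auto simp: offsets_def in_set_conv_nth)
qed

lemma offsets_iff: "t \<in> offsets (w p) \<longleftrightarrow> \<phi> p + t < \<phi> (Suc p) \<and> w (\<phi> p + t) \<notin> D"
  by (auto simp: offsets_def phi_Suc block_nth)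

lemma selects_last: "selects last_off"
  using offsets_delim by (auto simp: selects_def last_off_def intro!: Max_in offsets_finite)

lemma selects_first: "selects first_off"
  using offsets_delim by (auto simp: selects_def first_off_def intro!: Min_in offsets_finite)

abbreviation "F \<equiv> child last_off"
abbreviation "G \<equiv> child first_off"

lemma child_delim:
  assumes "selects \<iota>" "w p \<notin> D"
  shows "w (child \<iota> p) \<notin> D" "\<phi> p \<le> child \<iota> p" "child \<iota> p < \<phi> (Suc p)"
    "w (child \<iota> p) = g (w p) ! \<iota> (w p)" "\<iota> (w p) < length (g (w p))"
proof -
  have "\<iota> (w p) \<in> offsets (w p)" using assms by (auto simp: selects_def)
  then show "w (child \<iota> p) \<notin> D" "\<phi> p \<le> child \<iota> p" "child \<iota> p < \<phi> (Suc p)"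
     "w (child \<iota> p) = g (w p) ! \<iota> (w p)" "\<iota> (w p) < length (g (w p))"
    by (auto simp: child_def offsets_def block_nth phi_Suc)
qed

lemma F_max:
  assumes "\<phi> p \<le> k" "k < \<phi> (Suc p)" "w k \<notin> D"
  shows "k \<le> F p"
proof -
  have "k - \<phi> p \<in> offsets (w p)" using assms by (simp add: offsets_iff)
  then have "k - \<phi> p \<le> last_off (w p)" unfolding last_off_def by (intro Max_ge offsets_finite)
  then show ?thesis using assms(1) by (simp add: child_def)
qed

lemma G_min:
  assumes "\<phi> p \<le> k" "k < \<phi> (Suc p)" "w k \<notin> D"
  shows "G p \<le> k"
proof -
  have "k - \<phi> p \<in> offsets (w p)" using assms by (simp add: offsets_iff)
  then have "first_off (w p) \<le> k - \<phi> p" unfolding first_off_def by (intro Min_le offsets_finite)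
  then show ?thesis using assms(1) by (simp add: child_def)
qed

lemmas F_delim = child_delim[OF selects_last]
lemmas G_delim = child_delim[OF selects_first]

text \<open>A delimiter strictly between \<open>F p\<close> and \<open>G q\<close> would lie in the
  block of a delimiter, which can only be \<open>p\<close> or \<open>q\<close>; but
  \<open>F p\<close> is the last delimiter in the block of \<open>p\<close> and \<open>G q\<close>
  the first one in that of \<open>q\<close>.\<close>

lemma consec_children:
  assumes "consec p q"
  shows "consec (F p) (G q)"
proof -
  have pq: "p < q" "w p \<notin> D" "w q \<notin> D" "\<And>k. p < k \<Longrightarrow> k < q \<Longrightarrow> w k \<in> D"
    using assms by (auto simp: consec_def)
  have less: "F p < G q"
    using F_delim(3)[OF pq(2)] G_delim(2)[OF pq(3)] phi_mono[of "Suc p" q] pq(1) by linarith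
  have "w k \<in> D" if k: "F p < k" "k < G q" for k
  proof (rule ccontr)
    assume nD: "w k \<notin> D"
    obtain i where i: "\<phi> i \<le> k" "k < \<phi> (Suc i)" using in_block by blast
    have "w i \<notin> D" using delim_iff_block i nD by blast
    moreover have "p \<le> i" using block_order[of p "F p" k i] F_delim[OF pq(2)] i k by simp
    moreover have "i \<le> q" using block_order[of i k "G q" q] G_delim[OF pq(3)] i k by simp
    ultimately have "i = p \<or> i = q" using pq(4)[of i] by fastforce
    then show False using F_max[of p k] G_min[of q k] i nD k by auto
  qed
  then show ?thesis using less F_delim[OF pq(2)] G_delim[OF pq(3)] by (simp add: consec_def)
qed

definition base :: "nat \<Rightarrow> nat \<Rightarrow> bool" where
  "base p q \<longleftrightarrow> consec p q \<and> (\<exists>i. \<phi> i \<le> p \<and> q < \<phi> (Suc i))"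

lemma consec_iterate: "consec p q \<Longrightarrow> consec ((F ^^ n) p) ((G ^^ n) q)"
  by (induction n) (auto intro: consec_children)

text \<open>If the two ends lie in different blocks, these blocks belong to consecutive delimiters
  whose children are the given ends. The right end decreases in each step back because
  \<open>\<phi> j > j\<close>, so the descent stops at a run inside one block.\<close>

lemma consec_origin:
  assumes "consec P Q"
  shows "\<exists>n p q. base p q \<and> P = (F ^^ n) p \<and> Q = (G ^^ n) q"
  using assms
proof (induction Q arbitrary: P rule: less_induct)
  case (less Q)
  have PQ: "P < Q" "w P \<notin> D" "w Q \<notin> D" "\<And>k. P < k \<Longrightarrow> k < Q \<Longrightarrow> w k \<in> D"
    using less.prems by (auto simp: consec_def)
  obtain i where i: "\<phi> i \<le> P" "P < \<phi> (Suc i)" using in_block by blast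
  obtain j where j: "\<phi> j \<le> Q" "Q < \<phi> (Suc j)" using in_block by blast
  have "i \<le> j" using block_order[of i P Q j] i j PQ by simp
  show ?case
  proof (cases "i = j")
    case True
    then have "base P Q" using i j less.prems by (auto simp: base_def)
    then show ?thesis by (intro exI[of _ 0] exI[of _ P] exI[of _ Q]) simp
  next
    case False
    then have ij: "i < j" using \<open>i \<le> j\<close> by simp
    have wi: "w i \<notin> D" using delim_iff_block i PQ by blast
    have wj: "w j \<notin> D" using delim_iff_block j PQ by blast
    have "w k \<in> D" if k: "i < k" "k < j" for k
    proof (rule ccontr)
      assume "w k \<notin> D"
      then obtain l where l: "\<phi> k \<le> l" "l < \<phi> (Suc k)" "w l \<notin> D" using delim_iff_block by blast
      have "P < l" using i(2) l(1) phi_mono[of "Suc i" k] k by simp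
      moreover have "l < Q" using j(1) l(2) phi_mono[of "Suc k" j] k by simp
      ultimately show False using PQ(4) l(3) by blast
    qed
    then have "consec i j" using ij wi wj by (simp add: consec_def)
    moreover have "j < Q" using phi_gt[of j] j ij by simp
    ultimately obtain n p q where n: "base p q" "i = (F ^^ n) p" "j = (G ^^ n) q"
      using less.IH by blast
    have "P = F i"
    proof (rule ccontr)
      assume "P \<noteq> F i"
      then have "P < F i" using F_max[OF i PQ(2)] by simp
      moreover have "F i < Q" using F_delim(3)[OF wi] j(1) phi_mono[of "Suc i" j] ij by simp
      ultimately show False using PQ(4) F_delim(1)[OF wi] by blast
    qed
    moreover have "Q = G j"
    proof (rule ccontr)
      assume "Q \<noteq> G j"
      then have "G j < Q" using G_min[OF j PQ(3)] by simp
      moreover have "P < G j" using G_delim(2)[OF wj] i(2) phi_mono[of "Suc i" j] ij by simp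
      ultimately show False using PQ(4) G_delim(1)[OF wj] by blast
    qed
    ultimately show ?thesis using n by (intro exI[of _ "Suc n"] exI[of _ p] exI[of _ q]) simp
  qed
qed

section \<open>Positions of iterated children\<close>

definition len :: "nat \<Rightarrow> nat list \<Rightarrow> nat" where
  "len m z = length ((morph g ^^ m) z)"

lemma len_append: "len m (u @ v) = len m u + len m v"
  by (simp add: len_def morph_funpow_append)

lemma len_Suc: "len (Suc m) z = len m (morph g z)"
  by (simp add: len_def funpow_swap1)

lemma len_mono_prefix:
  assumes "i \<le> j"
  shows "len m (map w [0..<i]) \<le> len m (map w [0..<j])"
proof -
  have "map w [0..<j] = map w [0..<i] @ map w [i..<j]"
    unfolding map_append[symmetric] using upt_add_eq_append[of 0 i "j - i"] assms by simp
  then show ?thesis by (simp add: len_append)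
qed

text \<open>The position of the \<open>m\<close>-th selected descendant inside the
  \<open>m\<close>-th image of the letter \<open>c\<close>. It depends on the letter only, and not
  on where the letter occurs.\<close>

fun drift :: "(nat \<Rightarrow> nat) \<Rightarrow> nat \<Rightarrow> nat \<Rightarrow> nat" where
  "drift \<iota> 0 c = 0"
| "drift \<iota> (Suc m) c = len m (take (\<iota> c) (g c)) + drift \<iota> m (g c ! \<iota> c)"

lemma take_block: "t \<le> length (g (w p)) \<Longrightarrow> map w [0..<\<phi> p + t] = morph g (map w [0..<p]) @ take t (g (w p))"
proof -
  assume t: "t \<le> length (g (w p))"
  have "take t (g (w p)) = map w [\<phi> p..<\<phi> p + t]"
    using t by (subst block) (simp add: take_map phi_Suc)
  then show ?thesis by (simp add: phi_prefix upt_add_eq_append[of 0])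
qed

lemma child_iterate:
  assumes "selects \<iota>" "w p \<notin> D"
  shows "(child \<iota> ^^ m) p = len m (map w [0..<p]) + drift \<iota> m (w p)"
  using assms(2)
proof (induction m arbitrary: p)
  case 0
  then show ?case by (simp add: len_def)
next
  case (Suc m)
  note c = child_delim[OF assms(1) Suc.prems]
  have "(child \<iota> ^^ Suc m) p = (child \<iota> ^^ m) (child \<iota> p)" by (simp add: funpow_swap1)
  also have "\<dots> = len m (map w [0..<child \<iota> p]) + drift \<iota> m (w (child \<iota> p))" by (rule Suc.IH[OF c(1)])
  also have "map w [0..<child \<iota> p] = morph g (map w [0..<p]) @ take (\<iota> (w p)) (g (w p))"
    unfolding child_def using c(5) by (intro take_block) simp
  finally show ?case by (simp add: len_append len_Suc c(4))
qed

text \<open>The first summand depends on the place \<open>i\<close> and is the same for every offset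
  and every selection; the rest depends on \<open>i\<close> only through the letter
  \<open>w i\<close>. In the difference of two descendants of one block the place drops out.\<close>

lemma block_iterate:
  assumes "selects \<iota>" "t < length (g (w i))" "w (\<phi> i + t) \<notin> D"
  shows "(child \<iota> ^^ m) (\<phi> i + t) =
    len (Suc m) (map w [0..<i]) + (len m (take t (g (w i))) + drift \<iota> m (g (w i) ! t))"
  using assms by (simp add: child_iterate take_block len_append len_Suc block_nth)

definition roots :: "(nat \<times> nat) set" where
  "roots = {(p, q). consec p q \<and> (\<exists>i. \<phi> i \<le> p \<and> q < \<phi> (Suc i) \<and> (\<forall>k<i. w k \<noteq> w i))}"

lemma finite_roots: "finite roots"
proof -
  define I where "I = {i. \<forall>k<i. w k \<noteq> w i}"
  have "inj_on w I" by (auto simp: I_def inj_on_def) (metis linorder_neqE_nat)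
  then have "finite I" using finite_letters by (meson finite_imageD finite_subset image_mono subset_UNIV)
  define N where "N = \<phi> (Suc (Max (insert 0 I)))"
  have bound: "\<phi> (Suc i) \<le> N" if "i \<in> I" for i
    unfolding N_def using that \<open>finite I\<close> by (intro phi_mono) simp
  have "roots \<subseteq> {..<N} \<times> {..<N}"
  proof clarify
    fix p q assume "(p, q) \<in> roots"
    then obtain i where i: "p < q" "q < \<phi> (Suc i)" "i \<in> I" by (auto simp: roots_def consec_def I_def)
    then have "q < N" using bound[of i] by simp
    then show "p \<in> {..<N} \<and> q \<in> {..<N}" using i by simp
  qed
  then show ?thesis by (rule finite_subset) auto
qed

lemma roots_base: "(p, q) \<in> roots \<Longrightarrow> base p q"
  by (auto simp: roots_def base_def)

text \<open>Moving a run to the first occurrence of its parent letter shifts all descendants of both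
  ends by the same amount.\<close>

lemma base_to_root:
  assumes "base p q"
  obtains p0 q0 where "(p0, q0) \<in> roots"
    "\<And>m. (F ^^ m) p0 \<le> (F ^^ m) p"
    "\<And>m. (G ^^ m) q - (F ^^ m) p = (G ^^ m) q0 - (F ^^ m) p0"
proof -
  obtain i where pq: "consec p q" "\<phi> i \<le> p" "q < \<phi> (Suc i)" using assms by (auto simp: base_def)
  define j where "j = (LEAST j. w j = w i)"
  have "w j = w i" unfolding j_def by (rule LeastI[of "\<lambda>j. w j = w i" i]) simp
  moreover have "j \<le> i" unfolding j_def by (rule Least_le) simp
  moreover have "w k \<noteq> w i" if "k < j" for k using that not_less_Least unfolding j_def by blast
  ultimately have j: "w j = w i" "j \<le> i" "\<And>k. k < j \<Longrightarrow> w k \<noteq> w j" by simp_all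
  define s t where "s = p - \<phi> i" and "t = q - \<phi> i"
  have "p < q" using pq(1) by (simp add: consec_def)
  then have st: "p = \<phi> i + s" "q = \<phi> i + t" "s < t" "t < length (g (w i))"
    using pq by (auto simp: s_def t_def phi_Suc)
  have same: "w (\<phi> j + k) = w (\<phi> i + k)" if "k < length (g (w i))" for k
    using that by (simp add: block_nth j(1))
  have delims: "w (\<phi> j + s) \<notin> D" "w (\<phi> j + t) \<notin> D" "w (\<phi> i + s) \<notin> D" "w (\<phi> i + t) \<notin> D"
    using pq(1) same[of s] same[of t] st by (auto simp: consec_def)
  have "consec (\<phi> j + s) (\<phi> j + t)"
    unfolding consec_def
  proof (intro conjI allI impI)
    fix k assume k: "\<phi> j + s < k \<and> k < \<phi> j + t"
    then obtain l where l: "k = \<phi> j + l" "s < l" "l < t"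
      by (metis add_less_cancel_left le_add1 le_less_trans less_imp_le_nat nat_le_iff_add)
    then have "w k = w (\<phi> i + l)" using st(4) same[of l] by simp
    moreover have "w (\<phi> i + l) \<in> D" using pq(1) l st(1,2) by (simp add: consec_def)
    ultimately show "w k \<in> D" by simp
  qed (use delims st in auto)
  then have "(\<phi> j + s, \<phi> j + t) \<in> roots"
    using j st by (auto simp: roots_def phi_Suc intro!: exI[of _ j])
  moreover have *: "(F ^^ m) (\<phi> j + s) + len (Suc m) (map w [0..<i]) = (F ^^ m) p + len (Suc m) (map w [0..<j])"
    "(G ^^ m) (\<phi> j + t) + len (Suc m) (map w [0..<i]) = (G ^^ m) q + len (Suc m) (map w [0..<j])" for m
  proof -
    note st' = less_trans[OF st(3,4)] st(4)
    have jl: "s < length (g (w j))" "t < length (g (w j))" using st' by (simp_all add: j(1))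
    show "(F ^^ m) (\<phi> j + s) + len (Suc m) (map w [0..<i]) = (F ^^ m) p + len (Suc m) (map w [0..<j])"
      unfolding st(1) block_iterate[OF selects_last st'(1) delims(3)] block_iterate[OF selects_last jl(1) delims(1)]
      by (simp add: j(1))
    show "(G ^^ m) (\<phi> j + t) + len (Suc m) (map w [0..<i]) = (G ^^ m) q + len (Suc m) (map w [0..<j])"
      unfolding st(2) block_iterate[OF selects_first st'(2) delims(4)] block_iterate[OF selects_first jl(2) delims(2)]
      by (simp add: j(1))
  qed
  moreover have "len (Suc m) (map w [0..<j]) \<le> len (Suc m) (map w [0..<i])" for m
    using j(2) by (rule len_mono_prefix)
  ultimately show ?thesis
  proof (intro that[of "\<phi> j + s" "\<phi> j + t"])
    fix m
    have l: "len (Suc m) (map w [0..<j]) \<le> len (Suc m) (map w [0..<i])"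
      using j(2) by (rule len_mono_prefix)
    show "(F ^^ m) (\<phi> j + s) \<le> (F ^^ m) p" using *[of m] l by linarith
    show "(G ^^ m) q - (F ^^ m) p = (G ^^ m) (\<phi> j + t) - (F ^^ m) (\<phi> j + s)" using *[of m] by linarith
  qed
qed

section \<open>Runs over \<open>B\<close> compared with runs over \<open>D\<close>\<close>

definition run :: "nat \<Rightarrow> nat" where
  "run n = (LEAST l. w (n + l) \<notin> B)"

lemma run_end: "w (n + run n) \<notin> B"
proof -
  obtain k where "k \<ge> n" "w k \<notin> B" using exists_compl by blast
  then have "w (n + (k - n)) \<notin> B" by simp
  then show ?thesis unfolding run_def by (rule LeastI)
qed

lemma run_inside: "l < run n \<Longrightarrow> w (n + l) \<in> B"
  unfolding run_def using not_less_Least by blast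

lemma run_ge:
  assumes "\<And>l. l < m \<Longrightarrow> w (n + l) \<in> B"
  shows "m \<le> run n"
proof (rule ccontr)
  assume "\<not> m \<le> run n"
  then show False using assms[of "run n"] run_end[of n] by simp
qed

text \<open>The letter ending the run lies in the block of a delimiter \<open>j\<close>. The block
  of the preceding delimiter \<open>p\<close> begins no later than \<open>n\<close>, since a block
  contained in the run would put \<open>w p\<close> into \<open>D\<close>. Hence the run is confined
  to the blocks from \<open>p\<close> to \<open>j\<close>, whose inner ends are \<open>F p\<close>
  and \<open>G j\<close> up to block lengths. The first alternative is a run that ends in the block
  where it starts.\<close>

lemma run_upper:
  "run n \<le> K \<or> (\<exists>P Q. consec P Q \<and> run n + P \<le> Q + 2 * K \<and> P \<le> n + K)"
proof -
  obtain i where i: "\<phi> i \<le> n" "n < \<phi> (Suc i)" using in_block by blast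
  obtain j where j: "\<phi> j \<le> n + run n" "n + run n < \<phi> (Suc j)" using in_block by blast
  have wj: "w j \<notin> D" using delim_if_compl j run_end by blast
  have "i \<le> j" using block_order[of i n "n + run n" j] i j by simp
  show ?thesis
  proof (cases "i = j")
    case True
    then have "\<phi> j \<le> n" using i by simp
    then have "run n \<le> K" using j phi_Suc_le[of j] by linarith
    then show ?thesis by simp
  next
    case False
    then have ij: "i < j" using \<open>i \<le> j\<close> by simp
    define p where "p = Max {k. k < j \<and> w k \<notin> D}"
    have fin: "finite {k. k < j \<and> w k \<notin> D}" by simp
    have "0 \<in> {k. k < j \<and> w k \<notin> D}" using delim_0 ij by simp
    then have "p \<in> {k. k < j \<and> w k \<notin> D}" unfolding p_def using fin by (intro Max_in) auto
    then have p: "p < j" "w p \<notin> D" by auto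
    have "w k \<in> D" if "p < k" "k < j" for k
    proof (rule ccontr)
      assume "w k \<notin> D"
      then have "k \<le> p" unfolding p_def using that fin by (intro Max_ge) auto
      then show False using that by simp
    qed
    then have c: "consec p j" using p wj by (simp add: consec_def)
    have "p \<le> i"
    proof (rule ccontr)
      assume "\<not> p \<le> i"
      then have pi: "i < p" by simp
      have "set (g (w p)) \<subseteq> B" unfolding block_set
      proof (clarify)
        fix k assume k: "k \<in> {\<phi> p..<\<phi> (Suc p)}"
        have "n < k" using i(2) k pi phi_mono[of "Suc i" p] by auto
        moreover have "k < n + run n" using j(1) k p(1) phi_mono[of "Suc p" j] by auto
        ultimately show "w k \<in> B" using run_inside[of "k - n" n] by simp
      qed
      then show False using p(2) D_iff_B by blast
    qed
    then have "\<phi> p \<le> n" using phi_mono i(1) le_trans by blast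
    then show ?thesis
      using consec_children[OF c] F_delim[OF p(2)] G_delim[OF wj] j phi_Suc_le[of p] phi_Suc_le[of j]
      by (intro disjI2 exI[of _ "F p"] exI[of _ "G j"]) auto
  qed
qed

text \<open>All letters strictly between \<open>p\<close> and \<open>q\<close> are in
  \<open>D\<close>, so their blocks are words over \<open>B\<close> and form a run starting right
  after the block of \<open>p\<close>.\<close>

lemma run_lower:
  assumes "consec p q"
  shows "\<exists>n. F p < n \<and> n \<le> F p + K \<and> G q \<le> F p + run n + 2 * K"
proof (intro exI[of _ "\<phi> (Suc p)"] conjI)
  have pq: "p < q" "w p \<notin> D" "w q \<notin> D" "\<And>k. p < k \<Longrightarrow> k < q \<Longrightarrow> w k \<in> D"
    using assms by (auto simp: consec_def)
  show "F p < \<phi> (Suc p)" by (rule F_delim(3)[OF pq(2)])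
  show n: "\<phi> (Suc p) \<le> F p + K" using F_delim(2)[OF pq(2)] phi_Suc_le[of p] by linarith
  have "\<phi> q - \<phi> (Suc p) \<le> run (\<phi> (Suc p))"
  proof (rule run_ge)
    fix l assume l: "l < \<phi> q - \<phi> (Suc p)"
    obtain i where i: "\<phi> i \<le> \<phi> (Suc p) + l" "\<phi> (Suc p) + l < \<phi> (Suc i)" using in_block by blast
    have "p < i" using block_order[of "Suc p" "\<phi> (Suc p) + l" "\<phi> (Suc p) + l" i] i by simp
    moreover have "i < q"
    proof (rule ccontr)
      assume "\<not> i < q"
      then show False using phi_mono[of q i] i l by simp
    qed
    ultimately have "set (g (w i)) \<subseteq> B" using pq(4) D_iff_B by blast
    then show "w (\<phi> (Suc p) + l) \<in> B" using letter_in_block[OF i] by blast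
  qed
  moreover have "\<phi> (Suc p) \<le> \<phi> q" using pq(1) by (intro phi_mono) simp
  ultimately show "G q \<le> F p + run (\<phi> (Suc p)) + 2 * K"
    using G_delim(3)[OF pq(3)] phi_Suc_le[of q] n by linarith
qed

lemma F_gt: "w p \<notin> D \<Longrightarrow> p \<ge> 1 \<Longrightarrow> F p > p"
  using F_delim(2)[of p] phi_gt[of p] by linarith

lemma G_gt: "w p \<notin> D \<Longrightarrow> p \<ge> 1 \<Longrightarrow> G p > p"
  using G_delim(2)[of p] phi_gt[of p] by linarith

text \<open>If the left end remained at position 0, the right end could never pass a fixed delimiter
  \<open>d \<ge> 1\<close>, although it increases strictly. Once positive, the left end increases
  strictly as well.\<close>

lemma left_end_grows:
  assumes "consec p q"
  obtains t where "\<And>s. (F ^^ (t + s)) p \<ge> Suc s"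
proof -
  have cons: "consec ((F ^^ m) p) ((G ^^ m) q)" for m by (rule consec_iterate[OF assms])
  have "\<exists>t. (F ^^ t) p \<ge> 1"
  proof (rule ccontr)
    assume "\<not> ?thesis"
    then have zero: "(F ^^ m) p = 0" for m by (simp add: not_le)
    have Gm: "(G ^^ m) q \<ge> Suc m" for m
    proof (induction m)
      case 0
      then show ?case using assms by (simp add: consec_def)
    next
      case (Suc m)
      then show ?case using G_gt[of "(G ^^ m) q"] cons[of m] by (simp add: consec_def)
    qed
    obtain d where d: "d \<ge> 1" "w d \<notin> D" using exists_delim by blast
    have "(G ^^ d) q \<le> d" using cons[of d] zero d by (intro consec_unique_right[of 0]) auto
    then show False using Gm[of d] by simp
  qed
  then obtain t where t: "(F ^^ t) p \<ge> 1" by auto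
  have "(F ^^ (t + s)) p \<ge> Suc s" for s
  proof (induction s)
    case (Suc s)
    then show ?case using F_gt[of "(F ^^ (t + s)) p"] cons[of "t + s"] by (simp add: consec_def)
  qed (use t in simp)
  then show ?thesis using that by blast
qed

end

context stationary_word
begin

text \<open>The predicate \<open>Pr\<close> stands for being algebraic or rational. The upper limit
  is the largest among 0 and the values belonging to the finitely many roots: passing from an
  arbitrary run to its root keeps the length and does not increase the left end, so a bound
  \<open>(r + \<epsilon>) * P + C\<close> transfers.\<close>

lemma run_limsup:
  assumes base_limsup: "\<And>p q. base p q \<Longrightarrow>
      \<exists>R. Pr R \<and> is_limsup (\<lambda>m. real ((G ^^ m) q - (F ^^ m) p) / real ((F ^^ m) p)) R"
    and Pr_0: "Pr 0"
  shows "\<exists>r. Pr r \<and> is_limsup (\<lambda>n. real (run n) / real n) r"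
proof -
  define x where "x p q m = real ((G ^^ m) q - (F ^^ m) p) / real ((F ^^ m) p)" for p q m
  have "\<forall>p q. \<exists>R. base p q \<longrightarrow> Pr R \<and> is_limsup (x p q) R"
    using base_limsup unfolding x_def[abs_def] by blast
  then obtain R where R: "\<And>p q. base p q \<Longrightarrow> Pr (R p q)" "\<And>p q. base p q \<Longrightarrow> is_limsup (x p q) (R p q)"
    by metis
  define S where "S = insert 0 ((\<lambda>(p, q). R p q) ` roots)"
  have S: "finite S" "S \<noteq> {}" using finite_roots by (auto simp: S_def)
  define r where "r = Max S"
  have r0: "r \<ge> 0" unfolding r_def using S by (intro Max_ge) (auto simp: S_def)
  have R_le: "R p q \<le> r" if "(p, q) \<in> roots" for p q
    unfolding r_def using S that by (intro Max_ge) (auto simp: S_def)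
  have "r \<in> S" unfolding r_def using S by (rule Max_in)
  then have "Pr r" using Pr_0 R(1) roots_base by (auto simp: S_def)
  have root_bound: "\<exists>C. \<forall>m. real ((G ^^ m) q - (F ^^ m) p) \<le> (r + \<epsilon>) * real ((F ^^ m) p) + C \<and> C \<ge> 0"
    if pq: "(p, q) \<in> roots" and \<epsilon>: "\<epsilon> > 0" for p q \<epsilon>
  proof -
    note b = roots_base[OF pq]
    then obtain t where t: "\<And>s. (F ^^ (t + s)) p \<ge> Suc s" using left_end_grows by (auto simp: base_def)
    obtain M where M: "\<And>m. m \<ge> M \<Longrightarrow> x p q m \<le> R p q + \<epsilon>"
      using R(2)[OF b] \<epsilon> by (auto simp: is_limsup_def eventually_sequentially)
    \<comment> \<open>Covers the finitely many \<open>m\<close> where the ratio has not settled or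
      the left end may still be 0.\<close>
    define C where "C = (\<Sum>m<M + t. real ((G ^^ m) q - (F ^^ m) p))"
    have "C \<ge> 0" unfolding C_def by (intro sum_nonneg) auto
    have "real ((G ^^ m) q - (F ^^ m) p) \<le> (r + \<epsilon>) * real ((F ^^ m) p) + C" for m
    proof (cases "m < M + t")
      case True
      then have "real ((G ^^ m) q - (F ^^ m) p) \<le> C" unfolding C_def
        by (intro member_le_sum[of m "{..<M + t}" "\<lambda>m. real ((G ^^ m) q - (F ^^ m) p)"]) auto
      moreover have "(r + \<epsilon>) * real ((F ^^ m) p) \<ge> 0" using r0 \<epsilon> by simp
      ultimately show ?thesis by linarith
    next
      case False
      have pos: "(F ^^ m) p > 0" using t[of "m - t"] False by simp
      have "x p q m \<le> R p q + \<epsilon>" using M False by simp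
      also have "\<dots> \<le> r + \<epsilon>" using R_le[OF pq] by simp
      finally have "real ((G ^^ m) q - (F ^^ m) p) \<le> (r + \<epsilon>) * real ((F ^^ m) p)"
        using pos by (simp add: x_def divide_le_eq)
      then show ?thesis using \<open>C \<ge> 0\<close> by linarith
    qed
    then show ?thesis using \<open>C \<ge> 0\<close> by blast
  qed
  have consec_bound: "\<exists>C\<ge>0. \<forall>P Q. consec P Q \<longrightarrow> real (Q - P) \<le> (r + \<epsilon>) * real P + C" if \<epsilon>: "\<epsilon> > 0" for \<epsilon>
  proof -
    have "\<forall>p q. \<exists>C. (p, q) \<in> roots \<longrightarrow>
        (\<forall>m. real ((G ^^ m) q - (F ^^ m) p) \<le> (r + \<epsilon>) * real ((F ^^ m) p) + C \<and> C \<ge> 0)"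
      using root_bound[OF _ \<epsilon>] by blast
    then obtain C where C: "\<And>p q m. (p, q) \<in> roots \<Longrightarrow>
        real ((G ^^ m) q - (F ^^ m) p) \<le> (r + \<epsilon>) * real ((F ^^ m) p) + C p q"
      "\<And>p q. (p, q) \<in> roots \<Longrightarrow> C p q \<ge> 0"
      by metis
    define C' where "C' = (\<Sum>(p, q)\<in>roots. C p q)"
    have "C' \<ge> 0" unfolding C'_def using C(2) by (intro sum_nonneg) auto
    moreover have "real (Q - P) \<le> (r + \<epsilon>) * real P + C'" if PQ: "consec P Q" for P Q
    proof -
      obtain n p q where n: "base p q" "P = (F ^^ n) p" "Q = (G ^^ n) q"
        using consec_origin[OF PQ] by blast
      obtain p0 q0 where root: "(p0, q0) \<in> roots" "\<And>m. (F ^^ m) p0 \<le> (F ^^ m) p"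
        "\<And>m. (G ^^ m) q - (F ^^ m) p = (G ^^ m) q0 - (F ^^ m) p0"
        using base_to_root[OF n(1)] by blast
      have "real (Q - P) = real ((G ^^ n) q0 - (F ^^ n) p0)" using n root(3) by simp
      also have "\<dots> \<le> (r + \<epsilon>) * real ((F ^^ n) p0) + C p0 q0" by (rule C(1)[OF root(1)])
      also have "\<dots> \<le> (r + \<epsilon>) * real P + C'"
      proof (intro add_mono mult_left_mono)
        show "C p0 q0 \<le> C'" unfolding C'_def
          using member_le_sum[of "(p0, q0)" roots "\<lambda>(p, q). C p q"] root(1) C(2) finite_roots by auto
      qed (use root(2)[of n] n r0 \<epsilon> in auto)
      finally show ?thesis .
    qed
    ultimately show ?thesis by blast
  qed
  have "is_limsup (\<lambda>n. real (run n) / real n) r"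
    unfolding is_limsup_def
  proof (intro allI impI conjI)
    fix \<epsilon> :: real assume \<epsilon>: "\<epsilon> > 0"
    obtain C where C: "C \<ge> 0" "\<And>P Q. consec P Q \<Longrightarrow> real (Q - P) \<le> (r + \<epsilon> / 2) * real P + C"
      using consec_bound[of "\<epsilon> / 2"] \<epsilon> by auto
    \<comment> \<open>Collects the displacement of \<open>P\<close> by \<open>K\<close> and the loss
      \<open>2 * K\<close> from \<open>run_upper\<close>.\<close>
    define C' where "C' = (r + \<epsilon> / 2) * real K + C + 2 * real K"
    have nn: "(r + \<epsilon> / 2) * y \<ge> 0" if "y \<ge> 0" for y using r0 \<epsilon> that by simp
    have bound: "real (run n) \<le> (r + \<epsilon> / 2) * real n + C'" for n
    proof -
      consider "run n \<le> K" | P Q where "consec P Q" "run n + P \<le> Q + 2 * K" "P \<le> n + K"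
        using run_upper by blast
      then show ?thesis
      proof cases
        case 1
        then show ?thesis using C(1) nn[of "real n"] nn[of "real K"] by (simp add: C'_def)
      next
        case 2
        have "P < Q" using 2(1) by (simp add: consec_def)
        then have "real (run n) \<le> real (Q - P) + 2 * real K" using 2(2) by linarith
        also have "\<dots> \<le> (r + \<epsilon> / 2) * real P + C + 2 * real K" using C(2)[OF 2(1)] by simp
        also have "(r + \<epsilon> / 2) * real P \<le> (r + \<epsilon> / 2) * (real n + real K)"
          using 2(3) r0 \<epsilon> by (intro mult_left_mono) auto
        finally show ?thesis by (simp add: C'_def distrib_left)
      qed
    qed
    have "\<forall>\<^sub>F n in sequentially. 2 * C' / \<epsilon> \<le> real n"
      by (rule eventually_mono[OF eventually_ge_at_top[of "nat \<lceil>2 * C' / \<epsilon>\<rceil>"]]) linarith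
    then show "\<forall>\<^sub>F n in sequentially. real (run n) / real n \<le> r + \<epsilon>"
      using eventually_gt_at_top[of 0]
    proof eventually_elim
      case (elim n)
      have "C' \<le> \<epsilon> / 2 * real n" using elim(1) \<epsilon> by (simp add: field_simps)
      then have "real (run n) \<le> (r + \<epsilon>) * real n" using bound[of n] by (simp add: algebra_simps)
      then show ?case using elim(2) by (simp add: divide_le_eq)
    qed
    show "\<exists>\<^sub>F n in sequentially. real (run n) / real n \<ge> r - \<epsilon>"
    \<comment> \<open>The first case includes \<open>r = 0\<close>, for which there may be no root
      realizing the upper limit.\<close>
    proof (cases "r - \<epsilon> / 2 \<le> 0")
      case True
      have "real (run n) / real n \<ge> r - \<epsilon>" for n
      proof -
        have "r - \<epsilon> \<le> 0" using True \<epsilon> by linarith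
        then show ?thesis by (rule order_trans) simp
      qed
      then show ?thesis by (simp add: frequently_sequentially) blast
    next
      case False
      then have "r \<noteq> 0" using \<epsilon> by auto
      then obtain p q where pq: "(p, q) \<in> roots" "r = R p q" using \<open>r \<in> S\<close> by (auto simp: S_def)
      note b = roots_base[OF pq(1)]
      then have cons: "consec p q" by (simp add: base_def)
      obtain t where t: "\<And>s. (F ^^ (t + s)) p \<ge> Suc s" using left_end_grows[OF cons] by blast
      show ?thesis unfolding frequently_sequentially
      proof
        fix N
        \<comment> \<open>Beyond \<open>Y\<close> the bounded errors are at most
          \<open>\<epsilon> / 2\<close> times the position.\<close>
        define Y where "Y = 2 * ((r - \<epsilon> / 2) * real K + 2 * real K) / \<epsilon>"
        define N' where "N' = t + N + nat \<lceil>Y\<rceil> + 1"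
        obtain m where m: "m \<ge> N'" "x p q m \<ge> r - \<epsilon> / 2"
          using R(2)[OF b] \<epsilon> unfolding is_limsup_def frequently_sequentially pq(2)
          by (metis half_gt_zero)
        define A where "A = (F ^^ m) p"
        have A: "A \<ge> N'- t" using t[of "m - t"] m(1) by (simp add: A_def N'_def)
        then have A_pos: "A > 0" by (simp add: N'_def)
        \<comment> \<open>\<open>run_lower\<close> passes to the children, so it is applied one
          generation earlier to reach the ends of generation \<open>m\<close>.\<close>
        obtain m' where m': "m = Suc m'" using m(1) by (cases m) (auto simp: N'_def)
        obtain n where n: "F ((F ^^ m') p) < n" "n \<le> F ((F ^^ m') p) + K"
          "G ((G ^^ m') q) \<le> F ((F ^^ m') p) + run n + 2 * K"
          using run_lower[OF consec_iterate[OF cons, of m']] by blast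
        then have n: "A < n" "n \<le> A + K" "(G ^^ m) q \<le> A + run n + 2 * K" by (auto simp: A_def m')
        have "(r - \<epsilon> / 2) * real A \<le> real ((G ^^ m) q - A)"
          using m(2) A_pos by (simp add: x_def A_def[symmetric] le_divide_eq)
        also have "\<dots> \<le> real (run n) + 2 * real K" using n(3) by linarith
        finally have "(r - \<epsilon> / 2) * real A - 2 * real K \<le> real (run n)" by simp
        moreover have "(r - \<epsilon> / 2) * (real n - real K) \<le> (r - \<epsilon> / 2) * real A"
          using n(2) False by (intro mult_left_mono) auto
        ultimately have "(r - \<epsilon> / 2) * real n - ((r - \<epsilon> / 2) * real K + 2 * real K) \<le> real (run n)"
          by (simp add: right_diff_distrib)
        moreover have "(r - \<epsilon> / 2) * real K + 2 * real K \<le> \<epsilon> / 2 * real n"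
        proof -
          have "n \<ge> nat \<lceil>Y\<rceil>" using A n(1) unfolding N'_def by linarith
          then have "Y \<le> real n" by linarith
          then show ?thesis using \<epsilon> by (simp add: Y_def field_simps)
        qed
        ultimately have "(r - \<epsilon>) * real n \<le> real (run n)" by (simp add: algebra_simps)
        moreover have "n > 0" using n(1) by simp
        ultimately have "r - \<epsilon> \<le> real (run n) / real n" by (simp add: le_divide_eq)
        moreover have "n \<ge> N" using A n(1) by (simp add: N'_def)
        ultimately show "\<exists>n\<ge>N. r - \<epsilon> \<le> real (run n) / real n" by blast
      qed
    qed
  qed
  then show ?thesis using \<open>Pr r\<close> by blast
qed

end

section \<open>Morphic words\<close>

lemma list_system:
  fixes y :: "'i \<Rightarrow> nat \<Rightarrow> nat"
  assumes "finite I" "\<And>i. i \<in> I \<Longrightarrow> set (e i) \<subseteq> I"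
    "\<And>i n. i \<in> I \<Longrightarrow> y i (Suc n) = (\<Sum>j\<leftarrow>e i. y j n)"
    "set u \<subseteq> I" "\<And>n. p n = (\<Sum>j\<leftarrow>u. y j n)"
  shows "rat_recurrent (\<lambda>n. p (m * n + r))" "quasi_regular (\<lambda>n. real (p n))"
proof -
  have y: "y i (Suc n) = (\<Sum>j\<in>I. count_list (e i) j * y j n)" if "i \<in> I" for i n
    using sum_list_map_eq_sum_count2[OF assms(2)[OF that] assms(1)] assms(3)[OF that] by simp
  have p: "p n = (\<Sum>j\<in>I. count_list u j * y j n)" for n
    using sum_list_map_eq_sum_count2[OF assms(4,1)] assms(5) by simp
  show "rat_recurrent (\<lambda>n. p (m * n + r))"
    using assms(1) y p
    by (rule rat_recurrent_linear_system[where I = I and y = y and A = "\<lambda>i j. count_list (e i) j"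
          and u = "count_list u"])
  have "quasi_regular (\<lambda>n. \<Sum>j\<in>I. real (count_list u j) * real (y j n))"
    using quasi_regular_linear_system[where I = I and y = y and A = "\<lambda>i j. count_list (e i) j", OF assms(1) y]
    by (intro quasi_regular_sum quasi_regular_cmult) auto
  then show "quasi_regular (\<lambda>n. real (p n))" by (simp add: p)
qed

context stationary_word
begin

text \<open>The vector consists of the image lengths of all letters, tagged 0, and the drifts of the
  delimiters, tagged 1. One application of \<open>g\<close> expresses each entry as a sum of entries
  of the same vector, because the selected child of a delimiter is again a delimiter.\<close>

lemma child_iterate_system:
  assumes "selects \<iota>" "w p \<notin> D"
  shows "rat_recurrent (\<lambda>n. (child \<iota> ^^ (m * n + r)) p)" "quasi_regular (\<lambda>n. real ((child \<iota> ^^ n) p))"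
proof -
  define I where "I = {0::nat} \<times> range w \<union> {1} \<times> (range w - D)"
  define y where "y = (\<lambda>(k, c) n. if k = (0::nat) then len n [c] else drift \<iota> n c)"
  define e where "e = (\<lambda>(k, c). if k = (0::nat) then map (Pair (0::nat)) (g c)
    else map (Pair 0) (take (\<iota> c) (g c)) @ [(1, g c ! \<iota> c)])"
  define u where "u = map (Pair (0::nat)) (map w [0..<p]) @ [(1, w p)]"
  have len_sum: "len n z = (\<Sum>c\<leftarrow>z. len n [c])" for n z
    unfolding len_def by (rule length_morph_funpow)
  have fin: "finite I" using finite_letters by (auto simp: I_def)
  have closed: "set (g (w i)) \<subseteq> range w" for i by (auto simp: block_set)
  have e: "set (e i) \<subseteq> I" if "i \<in> I" for i
  proof -
    from that consider j where "i = (0, w j)" | j where "i = (1, w j)" "w j \<notin> D" by (auto simp: I_def)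
    then show ?thesis
    proof cases
      case 1
      then show ?thesis using closed by (auto simp: e_def I_def)
    next
      case (2 j)
      have "g (w j) ! \<iota> (w j) \<in> range w - D"
        using child_delim(1,4)[OF assms(1) 2(2)] closed[of j] nth_mem[OF child_delim(5)[OF assms(1) 2(2)]]
        by auto
      moreover have "set (take (\<iota> (w j)) (g (w j))) \<subseteq> range w"
        using set_take_subset closed by (rule subset_trans)
      ultimately show ?thesis using 2 by (auto simp: e_def I_def)
    qed
  qed
  have y: "y i (Suc n) = (\<Sum>j\<leftarrow>e i. y j n)" if "i \<in> I" for i n
  proof -
    from that consider j where "i = (0, w j)" | j where "i = (1, w j)" by (auto simp: I_def)
    then show ?thesis
    proof cases
      case 1
      then show ?thesis
        by (simp add: y_def e_def len_Suc len_sum[of n "g _"] o_def)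
    next
      case (2 j)
      then show ?thesis
        by (simp add: y_def e_def len_sum[of n "take _ _"] o_def)
    qed
  qed
  have u: "set u \<subseteq> I" using assms(2) by (auto simp: u_def I_def)
  have p: "(child \<iota> ^^ n) p = (\<Sum>j\<leftarrow>u. y j n)" for n
    unfolding child_iterate[OF assms] by (simp add: u_def y_def o_def len_sum[of n "map _ _"])
  note system = list_system[where I = I and e = e and y = y and u = u and p = "\<lambda>n. (child \<iota> ^^ n) p"]
  show "rat_recurrent (\<lambda>n. (child \<iota> ^^ (m * n + r)) p)"
    using fin e y u p by (rule system(1))
  show "quasi_regular (\<lambda>n. real ((child \<iota> ^^ n) p))"
    using fin e y u p by (rule system(2))
qed

lemma child_le: "selects \<iota> \<Longrightarrow> w p \<notin> D \<Longrightarrow> Suc (child \<iota> p) \<le> K * Suc p"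
  using child_delim(3)[of \<iota> p] phi_le[of "Suc p"] by linarith

section \<open>Comparable growth of the two ends of a run\<close>

lemma phi_funpow_mono: "i \<le> j \<Longrightarrow> (\<phi> ^^ n) i \<le> (\<phi> ^^ n) j"
  by (induction n) (auto intro: phi_mono)

lemma phi_funpow_le: "(\<phi> ^^ n) i \<le> K ^ n * i"
proof (induction n)
  case (Suc n)
  have "(\<phi> ^^ Suc n) i \<le> K * (\<phi> ^^ n) i" using phi_le by simp
  also have "\<dots> \<le> K * (K ^ n * i)" using Suc by simp
  finally show ?case by simp
qed simp

lemma phi_funpow_ge: "(\<phi> ^^ n) 1 \<ge> Suc n"
proof (induction n)
  case (Suc n)
  then have "(\<phi> ^^ Suc n) 1 > (\<phi> ^^ n) 1" using phi_gt by simp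
  then show ?case using Suc by simp
qed simp

text \<open>Both ends are squeezed by iterates of \<open>\<phi>\<close>: from \<open>t\<close> on
  the left end is at least \<open>(\<phi> ^^ s) 1\<close>, and the right end is below
  \<open>(\<phi> ^^ (t + s)) (Suc q)\<close>. Since \<open>Suc q \<le> (\<phi> ^^ q) 1\<close>, only
  \<open>t + q\<close> further applications separate them, each costing a factor \<open>K\<close>.
  This makes the upper limit finite.\<close>

lemma ends_comparable:
  assumes "consec p q" and t: "(F ^^ t) p \<ge> 1"
  shows "\<exists>C. \<forall>s. (G ^^ (t + s)) q \<le> C * (F ^^ (t + s)) p"
proof -
  have cons: "consec ((F ^^ m) p) ((G ^^ m) q)" for m by (rule consec_iterate[OF assms(1)])
  have G: "Suc ((G ^^ m) q) \<le> (\<phi> ^^ m) (Suc q)" for m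
  proof (induction m)
    case (Suc m)
    have "Suc (G ((G ^^ m) q)) \<le> \<phi> (Suc ((G ^^ m) q))"
      using G_delim(3)[of "(G ^^ m) q"] cons[of m] by (simp add: consec_def)
    also have "\<dots> \<le> \<phi> ((\<phi> ^^ m) (Suc q))" using Suc by (rule phi_mono)
    finally show ?case by simp
  qed simp
  have F: "(\<phi> ^^ s) 1 \<le> (F ^^ (t + s)) p" for s
  proof (induction s)
    case (Suc s)
    have "(\<phi> ^^ Suc s) 1 \<le> \<phi> ((F ^^ (t + s)) p)" using Suc by (simp add: phi_mono)
    also have "\<dots> \<le> F ((F ^^ (t + s)) p)"
      using F_delim(2)[of "(F ^^ (t + s)) p"] cons[of "t + s"] by (simp add: consec_def)
    finally show ?case by simp
  qed (use t in simp)
  have "(G ^^ (t + s)) q \<le> K ^ (t + q) * (F ^^ (t + s)) p" for s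
  proof -
    have "(G ^^ (t + s)) q \<le> (\<phi> ^^ (t + s)) (Suc q)" using G[of "t + s"] by simp
    also have "\<dots> \<le> (\<phi> ^^ (t + s)) ((\<phi> ^^ q) 1)" using phi_funpow_ge by (intro phi_funpow_mono)
    also have "\<dots> = (\<phi> ^^ (t + q)) ((\<phi> ^^ s) 1)"
    proof -
      have "t + s + q = t + q + s" by simp
      then show ?thesis by (metis comp_apply funpow_add)
    qed
    also have "\<dots> \<le> K ^ (t + q) * (\<phi> ^^ s) 1" by (rule phi_funpow_le)
    also have "\<dots> \<le> K ^ (t + q) * (F ^^ (t + s)) p" using F by simp
    finally show ?thesis .
  qed
  then show ?thesis by blast
qed

lemma base_limsup_algebraic:
  assumes "consec p q"
  shows "\<exists>R. algebraic R \<and> is_limsup (\<lambda>m. real ((G ^^ m) q - (F ^^ m) p) / real ((F ^^ m) p)) R"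
proof -
  have pq: "w p \<notin> D" "w q \<notin> D" using assms by (auto simp: consec_def)
  have cons: "consec ((F ^^ m) p) ((G ^^ m) q)" for m by (rule consec_iterate[OF assms])
  define a b where "a m = (F ^^ m) p" and "b m = (G ^^ m) q" for m
  obtain t where t: "\<And>s. a (t + s) \<ge> Suc s" using left_end_grows[OF assms] unfolding a_def by blast
  obtain C where C: "\<And>s. b (t + s) \<le> C * a (t + s)"
    using ends_comparable[OF assms, of t] t[of 0] by (auto simp: a_def b_def)
  have qr: "quasi_regular (\<lambda>n. real (a n))" "quasi_regular (\<lambda>n. real (b n))"
    unfolding a_def b_def using child_iterate_system(2) selects_last selects_first pq by auto
  obtain m where m: "m > 0" "\<And>r. regular (\<lambda>n. real (a (m * n + r)))" "\<And>r. regular (\<lambda>n. real (b (m * n + r)))"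
    using quasi_regular_common[OF qr] by blast
  have a_pos: "a (m * n + (t + r)) > 0" for n r
    using t[of "m * n + r"] by (simp add: add.left_commute)
  have le: "b (m * n + (t + r)) \<le> C * a (m * n + (t + r))" for n r
    using C[of "m * n + r"] by (simp add: add.left_commute)
  \<comment> \<open>The factor 2 turns \<open>Suc (a n)\<close> into a multiple of
    \<open>a n\<close>, which is possible as soon as \<open>a n\<close> is positive.\<close>
  have growth: "a (Suc n) \<le> 2 * K * a n" if "a n > 0" for n
  proof -
    have "Suc (a (Suc n)) \<le> K * Suc (a n)"
      using child_le[OF selects_last, of "a n"] cons[of n] by (simp add: a_def consec_def)
    also have "\<dots> \<le> K * (2 * a n)" using that by (intro mult_left_mono) auto
    finally show ?thesis by simp
  qed
  have growth': "a (t + r + n) \<le> (2 * K) ^ n * a (t + r)" for r n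
  proof (induction n)
    case (Suc n)
    have "a (t + r + Suc n) \<le> 2 * K * a (t + r + n)" using growth[of "t + r + n"] t[of "r + n"] by (simp add: add.assoc)
    also have "\<dots> \<le> 2 * K * ((2 * K) ^ n * a (t + r))" using Suc by (intro mult_left_mono) auto
    finally show ?case by simp
  qed simp
  have "\<exists>L. algebraic L \<and> (\<lambda>n. real (b (m * n + (t + r))) / real (a (m * n + (t + r)))) \<longlonglongrightarrow> L" for r
  proof -
    have "convergent (\<lambda>n. real (b (m * n + (t + r))) / real (a (m * n + (t + r))))"
    proof (rule regular_ratio_convergent[OF m(2,3), where K = "real C"])
      show "0 < real (a (m * n + (t + r)))" for n using a_pos by simp
      show "0 \<le> real (b (m * n + (t + r))) \<and> real (b (m * n + (t + r))) \<le> real C * real (a (m * n + (t + r)))" for n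
        using le[of n r] by (simp flip: of_nat_mult)
    qed
    then obtain L where L: "(\<lambda>n. real (b (m * n + (t + r))) / real (a (m * n + (t + r)))) \<longlonglongrightarrow> L"
      by (auto simp: convergent_def)
    have "algebraic L"
    proof (rule algebraic_limit_ratio[OF _ _ _ _ L])
      show "rat_recurrent (\<lambda>n. a (m * n + (t + r)))" "rat_recurrent (\<lambda>n. b (m * n + (t + r)))"
        unfolding a_def b_def using child_iterate_system(1) selects_last selects_first pq by auto
      show "0 < a (m * n + (t + r))" for n by (rule a_pos)
      show "real (a (m * Suc n + (t + r))) \<le> real ((2 * K) ^ m) * real (a (m * n + (t + r)))" for n
      proof -
        have "a (t + (m * n + r) + m) \<le> (2 * K) ^ m * a (t + (m * n + r))" by (rule growth')
        moreover have "t + (m * n + r) + m = m * Suc n + (t + r)" "t + (m * n + r) = m * n + (t + r)" by auto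
        ultimately show ?thesis by (metis of_nat_le_iff of_nat_mult)
      qed
    qed
    then show ?thesis using L by blast
  qed
  then obtain L where L: "\<And>r. algebraic (L r)"
    "\<And>r. (\<lambda>n. real (b (m * n + (t + r))) / real (a (m * n + (t + r)))) \<longlonglongrightarrow> L r" by metis
  have "is_limsup (\<lambda>n. real (b n - a n) / real (a n)) (Max ((\<lambda>r. L r - 1) ` {..<m}))"
  proof (rule is_limsup_residues[OF m(1), where t = t])
    fix r
    have "(\<lambda>n. real (b (m * n + (t + r))) / real (a (m * n + (t + r))) - 1) \<longlonglongrightarrow> L r - 1"
      by (intro tendsto_diff L tendsto_const)
    moreover have "real (b (m * n + (t + r))) / real (a (m * n + (t + r))) - 1
        = real (b (m * n + (t + r)) - a (m * n + (t + r))) / real (a (m * n + (t + r)))" for n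
    proof -
      have "a (m * n + (t + r)) < b (m * n + (t + r))"
        using cons[of "m * n + (t + r)"] by (simp add: consec_def a_def b_def)
      then show ?thesis using a_pos[of n r] by (simp add: of_nat_diff field_simps)
    qed
    ultimately show "(\<lambda>n. real (b (m * n + (t + r)) - a (m * n + (t + r))) / real (a (m * n + (t + r)))) \<longlonglongrightarrow> L r - 1"
      by simp
  qed
  moreover have "Max ((\<lambda>r. L r - 1) ` {..<m}) \<in> (\<lambda>r. L r - 1) ` {..<m}"
    using m(1) by (intro Max_in) auto
  then have "algebraic (Max ((\<lambda>r. L r - 1) ` {..<m}))"
    using algebraic_add[OF L(1) algebraic_minus[OF algebraic_1]] by auto
  ultimately show ?thesis unfolding a_def b_def by blast
qed

section \<open>Uniform morphisms\<close>

text \<open>Here \<open>x (Suc m) = k * x m + \<iota> (c m)\<close>, so \<open>P\<close> is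
  \<open>p\<close> plus the number with base-\<open>k\<close> digits \<open>\<iota> (c m)\<close>.
  The letters \<open>c m\<close> follow a deterministic map on a finite set, so the digits are
  eventually periodic and \<open>P\<close> is rational. That the quotients stay below
  \<open>P\<close> is recorded because it later yields \<open>P > 0\<close>.\<close>

lemma uniform_child_limit:
  assumes uniform: "\<And>i. length (g (w i)) = k" and \<iota>: "selects \<iota>" "w p \<notin> D"
  shows "\<exists>P\<in>\<rat>. (\<lambda>m. real ((child \<iota> ^^ m) p) / real k ^ m) \<longlonglongrightarrow> P \<and>
    (\<forall>m. real ((child \<iota> ^^ m) p) / real k ^ m \<le> P)"
proof -
  have phi: "\<phi> i = k * i" for i by (induction i) (auto simp: phi_Suc uniform)
  have k: "k \<ge> 2" using phi_gt[of 1] by (simp add: phi)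
  define x c where "x m = (child \<iota> ^^ m) p" and "c m = w (x m)" for m
  have delim: "c m \<notin> D" for m
  proof (induction m)
    case (Suc m)
    then show ?case using child_delim(1)[OF \<iota>(1), of "x m"] by (simp add: c_def x_def)
  qed (use \<iota> in \<open>simp add: c_def x_def\<close>)
  have x_Suc: "x (Suc m) = k * x m + \<iota> (c m)" for m by (simp add: x_def c_def child_def phi)
  have c_Suc: "c (Suc m) = g (c m) ! \<iota> (c m)" for m
    using child_delim(4)[OF \<iota>(1), of "x m"] delim[of m] by (simp add: c_def x_def)
  have iota_less: "\<iota> (c m) < k" for m
    using child_delim(5)[OF \<iota>(1), of "x m"] delim[of m] uniform by (simp add: c_def)
  have "incseq (\<lambda>m. real (x m) / real k ^ m)"
  proof (rule incseq_SucI)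
    fix m
    have "real k * real (x m) \<le> real (x (Suc m))" by (simp add: x_Suc)
    then have "real k * real (x m) / real k ^ Suc m \<le> real (x (Suc m)) / real k ^ Suc m"
      by (intro divide_right_mono) auto
    then show "real (x m) / real k ^ m \<le> real (x (Suc m)) / real k ^ Suc m" using k by simp
  qed
  moreover have "real (x m) / real k ^ m \<le> real (Suc p)" for m
  proof -
    have "Suc (x m) \<le> k ^ m * Suc p"
    proof (induction m)
      case (Suc m)
      have "Suc (x (Suc m)) \<le> k * Suc (x m)" using iota_less[of m] by (simp add: x_Suc)
      also have "\<dots> \<le> k * (k ^ m * Suc p)" using Suc by (rule mult_left_mono) simp
      finally show ?case by (simp only: power_Suc mult.assoc)
    qed (simp add: x_def)
    then have "real (Suc (x m)) \<le> real (k ^ m * Suc p)" by (simp only: of_nat_le_iff)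
    then have "real (x m) \<le> real (k ^ m * Suc p)" by linarith
    also have "\<dots> = real (Suc p) * real k ^ m" by (simp add: algebra_simps)
    finally have "real (x m) \<le> real (Suc p) * real k ^ m" .
    then show ?thesis using k by (subst pos_divide_le_eq) auto
  qed
  ultimately obtain P where P: "(\<lambda>m. real (x m) / real k ^ m) \<longlonglongrightarrow> P" "\<And>m. real (x m) / real k ^ m \<le> P"
    using incseq_convergent[of "\<lambda>m. real (x m) / real k ^ m" "real (Suc p)"] by metis
  have "range c \<subseteq> range w" by (auto simp: c_def)
  then have "finite (range c)" using finite_letters finite_subset by blast
  then have "\<not> inj c" using finite_imageD infinite_UNIV_nat by blast
  then obtain i j where "i < j" "c i = c j" by (metis injI linorder_neqE_nat)
  then obtain d where d: "d > 0" "c (i + d) = c i" by (metis less_imp_add_positive)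
  have shift: "c (i' + s) = c (i + s) \<and> real (x (i' + s)) - real k ^ s * real (x i') = real (x (i + s)) - real k ^ s * real (x i)"
    if "c i' = c i" for i' s
  proof (induction s)
    case (Suc s)
    then have "c (i' + Suc s) = c (i + Suc s)" by (simp add: c_Suc)
    moreover have "real (x (i' + Suc s)) - real k ^ Suc s * real (x i')
        = real k * (real (x (i' + s)) - real k ^ s * real (x i')) + real (\<iota> (c (i' + s)))"
      by (simp add: x_Suc algebra_simps)
    moreover have "real (x (i + Suc s)) - real k ^ Suc s * real (x i)
        = real k * (real (x (i + s)) - real k ^ s * real (x i)) + real (\<iota> (c (i + s)))"
      by (simp add: x_Suc algebra_simps)
    ultimately show ?case using Suc by simp
  qed (use that in simp)
  define C where "C = real (x (i + d)) - real k ^ d * real (x i)"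
  have per: "c (i + d * n) = c i" for n
  proof (induction n)
    case (Suc n)
    have "c (i + d * n + d) = c (i + d)" using shift[OF Suc] by blast
    moreover have "i + d * Suc n = i + d * n + d" by simp
    ultimately show ?case using d(2) by (simp only:)
  qed simp
  \<comment> \<open>The shift by \<open>e\<close> turns the affine recurrence with slope
    \<open>real k ^ d\<close> and constant \<open>C\<close> into a geometric one.\<close>
  define e where "e = C / (real k ^ d - 1)"
  have kd: "real k ^ d > 1" using k d by (intro one_less_power) auto
  have x_per: "real (x (i + d * n)) + e = real k ^ (d * n) * (real (x i) + e)" for n
  proof (induction n)
    case (Suc n)
    have "real (x (i + d * n + d)) = real k ^ d * real (x (i + d * n)) + C"
      using shift[OF per[of n], of d] by (simp add: C_def)
    moreover have "C = e * (real k ^ d - 1)" using kd by (simp add: e_def)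
    ultimately have "real (x (i + d * n + d)) + e = real k ^ d * (real (x (i + d * n)) + e)"
      by (simp add: algebra_simps)
    also have "\<dots> = real k ^ (d * Suc n) * (real (x i) + e)" unfolding Suc by (simp add: power_add)
    finally show ?case by (simp add: algebra_simps)
  qed simp
  have smono: "strict_mono (\<lambda>n. i + d * n)" using d by (auto simp: strict_mono_def)
  have "(\<lambda>n. real (x (i + d * n)) / real k ^ (i + d * n)) \<longlonglongrightarrow> P"
    using LIMSEQ_subseq_LIMSEQ[OF P(1) smono] by (simp add: o_def)
  moreover have "(\<lambda>n. real (x (i + d * n)) / real k ^ (i + d * n)) \<longlonglongrightarrow> (real (x i) + e) / real k ^ i"
  proof -
    have "(\<lambda>n. inverse (real k ^ d) ^ n) \<longlonglongrightarrow> 0"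
    proof (intro LIMSEQ_power_zero)
      have "inverse (real k ^ d) < 1" "inverse (real k ^ d) \<ge> 0" using kd by (simp_all add: inverse_less_1_iff)
      then show "norm (inverse (real k ^ d)) < 1" by simp
    qed
    then have "(\<lambda>n. (real (x i) + e) / real k ^ i - e / real k ^ i * inverse (real k ^ d) ^ n) \<longlonglongrightarrow> (real (x i) + e) / real k ^ i - e / real k ^ i * 0"
      by (intro tendsto_diff tendsto_mult tendsto_const)
    moreover have "(real (x i) + e) / real k ^ i - e / real k ^ i * inverse (real k ^ d) ^ n = real (x (i + d * n)) / real k ^ (i + d * n)" for n
    proof -
      have "real (x (i + d * n)) = real k ^ (d * n) * (real (x i) + e) - e" using x_per[of n] by simp
      moreover have "inverse (real k ^ d) ^ n = inverse (real k ^ (d * n))" by (simp add: power_inverse power_mult)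
      moreover have "s / I - e / I * inverse E = (E * s - e) / (I * E)" if "I > 0" "E > 0" for s I E :: real
        using that by (simp add: field_simps)
      ultimately show ?thesis using k by (simp add: power_add)
    qed
    ultimately show ?thesis by simp
  qed
  ultimately have "P = (real (x i) + e) / real k ^ i" by (rule LIMSEQ_unique)
  then have "P \<in> \<rat>" by (auto simp: e_def C_def)
  then show ?thesis using P unfolding x_def by blast
qed

lemma base_limsup_rational:
  assumes "\<And>i. length (g (w i)) = k" and "consec p q"
  shows "\<exists>R\<in>\<rat>. is_limsup (\<lambda>m. real ((G ^^ m) q - (F ^^ m) p) / real ((F ^^ m) p)) R"
proof -
  have pq: "w p \<notin> D" "w q \<notin> D" using assms(2) by (auto simp: consec_def)
  obtain P where P: "P \<in> \<rat>" "(\<lambda>m. real ((F ^^ m) p) / real k ^ m) \<longlonglongrightarrow> P"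
    "\<And>m. real ((F ^^ m) p) / real k ^ m \<le> P"
    using uniform_child_limit[OF assms(1) selects_last pq(1)] by blast
  obtain Q where Q: "Q \<in> \<rat>" "(\<lambda>m. real ((G ^^ m) q) / real k ^ m) \<longlonglongrightarrow> Q"
    using uniform_child_limit[OF assms(1) selects_first pq(2)] by blast
  have k: "k > 0" using phi_gt[of 1] assms(1) by (simp add: phi_Suc)
  obtain t where t: "\<And>s. (F ^^ (t + s)) p \<ge> Suc s" using left_end_grows[OF assms(2)] by blast
  have "0 < real ((F ^^ t) p) / real k ^ t" using t[of 0] k by simp
  then have "P > 0" using P(3)[of t] by linarith
  have "(\<lambda>m. real ((G ^^ m) q) / real k ^ m / (real ((F ^^ m) p) / real k ^ m) - 1) \<longlonglongrightarrow> Q / P - 1"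
    using \<open>P > 0\<close> by (intro tendsto_intros P Q) auto
  then have "(\<lambda>m. real ((G ^^ m) q - (F ^^ m) p) / real ((F ^^ m) p)) \<longlonglongrightarrow> Q / P - 1"
  proof (rule Lim_transform_eventually)
    show "\<forall>\<^sub>F m in sequentially. real ((G ^^ m) q) / real k ^ m / (real ((F ^^ m) p) / real k ^ m) - 1
        = real ((G ^^ m) q - (F ^^ m) p) / real ((F ^^ m) p)"
      using eventually_ge_at_top[of t]
    proof eventually_elim
      case (elim m)
      have "(F ^^ m) p > 0" using t[of "m - t"] elim by simp
      moreover have "(F ^^ m) p < (G ^^ m) q" using consec_iterate[OF assms(2), of m] by (simp add: consec_def)
      ultimately show ?case using k by (simp add: of_nat_diff diff_divide_distrib)
    qed
  qed
  then have "is_limsup (\<lambda>m. real ((G ^^ m) q - (F ^^ m) p) / real ((F ^^ m) p)) (Max ((\<lambda>r::nat. Q / P - 1) ` {..<1}))"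
    by (intro is_limsup_residues[of 1 _ 0]) auto
  moreover have "(\<lambda>r::nat. Q / P - 1) ` {..<1} = {Q / P - 1}" by auto
  ultimately show ?thesis using P Q by (intro bexI[of _ "Q / P - 1"]) auto
qed

end

lemma length_uniform_power:
  assumes "\<And>c. c \<in> \<Sigma> \<Longrightarrow> set (h c) \<subseteq> \<Sigma>" "\<And>c. c \<in> \<Sigma> \<Longrightarrow> length (h c) = k" "c \<in> \<Sigma>"
  shows "length ((morph h ^^ m) [c]) = k ^ m"
proof -
  have len: "length (morph h z) = k * length z" if "set z \<subseteq> \<Sigma>" for z
    using that by (induction z) (auto simp: morph_Cons assms(2))
  have "set ((morph h ^^ m) [c]) \<subseteq> \<Sigma>" for m
  proof (induction m)
    case (Suc m)
    then show ?case using assms(1) by (fastforce simp: morph_def)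
  qed (use assms(3) in simp)
  then show ?thesis by (induction m) (auto simp: len)
qed

theorem pure_morphic_run_limsup:
  assumes pm: "pure_morphic_by \<Sigma> h a w" and inf: "infinite {i. w i \<notin> B}"
  shows "\<exists>r. algebraic r \<and> is_limsup (\<lambda>n. real (LEAST l. w (n + l) \<notin> B) / real n) r"
    and "\<forall>c\<in>\<Sigma>. length (h c) = k \<Longrightarrow>
      \<exists>r. r \<in> \<rat> \<and> is_limsup (\<lambda>n. real (LEAST l. w (n + l) \<notin> B) / real n) r"
proof -
  obtain m D where m: "m \<ge> 1" and D: "\<And>c. c \<in> \<Sigma> \<Longrightarrow> c \<in> D \<longleftrightarrow> set ((morph h ^^ m) [c]) \<subseteq> B"
    "\<And>c. c \<in> \<Sigma> \<Longrightarrow> c \<in> D \<longleftrightarrow> set ((morph h ^^ m) [c]) \<subseteq> D"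
    using stationary_power[OF pm] by metis
  define g where "g = (\<lambda>c. (morph h ^^ m) [c])"
  have pm': "pure_morphic_by \<Sigma> g a w" unfolding g_def by (rule pure_morphic_power[OF pm m])
  have letters: "w i \<in> \<Sigma>" for i by (rule word_letters[OF pm])
  interpret stationary_word w g B D
  proof
    have "range w \<subseteq> \<Sigma>" using letters by auto
    moreover have "finite \<Sigma>" using pm by (simp add: pure_morphic_by_def)
    ultimately show "finite (range w)" by (rule finite_subset)
    show "morph g (map w [0..<i]) = map w [0..<length (morph g (map w [0..<i]))]" for i
      by (rule morph_prefix[OF pm'])
    show "i < length (morph g (map w [0..<i]))" if "1 \<le> i" for i
      using that by (rule morph_prefix_longer[OF pm'])
  qed (use D letters inf in \<open>auto simp: g_def\<close>)
  show "\<exists>r. algebraic r \<and> is_limsup (\<lambda>n. real (LEAST l. w (n + l) \<notin> B) / real n) r"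
    using run_limsup[of algebraic] base_limsup_algebraic unfolding run_def base_def by blast
  assume "\<forall>c\<in>\<Sigma>. length (h c) = k"
  then have "length (g c) = k ^ m" if "c \<in> \<Sigma>" for c
    unfolding g_def using that pm by (intro length_uniform_power[of \<Sigma>]) (auto simp: pure_morphic_by_def)
  then have len: "length (g (w i)) = k ^ m" for i using letters by simp
  have "\<exists>r. r \<in> \<rat> \<and> is_limsup (\<lambda>n. real (run n) / real n) r"
  proof (rule run_limsup)
    fix p q assume "base p q"
    then have "consec p q" by (simp add: base_def)
    then show "\<exists>R. R \<in> \<rat> \<and> is_limsup (\<lambda>m. real ((G ^^ m) q - (F ^^ m) p) / real ((F ^^ m) p)) R"
      using base_limsup_rational[OF len] by blast
  qed simp
  then show "\<exists>r. r \<in> \<rat> \<and> is_limsup (\<lambda>n. real (LEAST l. w (n + l) \<notin> B) / real n) r"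
    by (simp add: run_def)
qed

section \<open>Digits and distances to the nearest integer\<close>

lemma dist_int_eq_min: "dist_int x = min (frac x) (1 - frac x)"
  unfolding dist_int_def
proof (rule antisym)
  have bdd: "bdd_below ((\<lambda>k. \<bar>x - k\<bar>) ` \<int>)" by (rule bdd_belowI[of _ 0]) auto
  have "(INF k\<in>\<int>. \<bar>x - k\<bar>) \<le> \<bar>x - of_int \<lfloor>x\<rfloor>\<bar>" by (rule cINF_lower[OF bdd]) simp
  moreover have "(INF k\<in>\<int>. \<bar>x - k\<bar>) \<le> \<bar>x - of_int (\<lfloor>x\<rfloor> + 1)\<bar>" by (rule cINF_lower[OF bdd]) (rule Ints_of_int)
  moreover have "\<bar>x - of_int \<lfloor>x\<rfloor>\<bar> = frac x" "\<bar>x - of_int (\<lfloor>x\<rfloor> + 1)\<bar> = 1 - frac x"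
    unfolding frac_def by linarith+
  ultimately show "(INF k\<in>\<int>. \<bar>x - k\<bar>) \<le> min (frac x) (1 - frac x)" by simp
  show "min (frac x) (1 - frac x) \<le> (INF k\<in>\<int>. \<bar>x - k\<bar>)"
  proof (rule cINF_greatest)
    fix y :: real assume "y \<in> \<int>"
    then obtain k where k: "y = of_int k" by (auto elim: Ints_cases)
    show "min (frac x) (1 - frac x) \<le> \<bar>x - y\<bar>"
    proof (cases "k \<le> \<lfloor>x\<rfloor>")
      case True
      then have "frac x \<le> x - y" unfolding frac_def k by simp
      then show ?thesis by linarith
    next
      case False
      then have "\<lfloor>x\<rfloor> + 1 \<le> k" by simp
      then have "of_int (\<lfloor>x\<rfloor> + 1) \<le> (of_int k :: real)" by (simp only: of_int_le_iff)
      then have "1 - frac x \<le> y - x" unfolding frac_def k by simp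
      then show ?thesis by linarith
    qed
  qed auto
qed

text \<open>Strict bounds on both sides make the setting symmetric under replacing \<open>f\<close>
  by \<open>1 - f\<close> and \<open>e\<close> by \<open>b - 1 - e\<close>. Runs of the digit
  \<open>b - 1\<close> are thereby reduced to runs of the digit 0.\<close>

locale expansion =
  fixes b :: nat and f :: "nat \<Rightarrow> real" and e :: "nat \<Rightarrow> nat"
  assumes base: "b \<ge> 2" and unit: "\<And>n. 0 < f n" "\<And>n. f n < 1"
    and step: "\<And>n. f (Suc n) = real b * f n - real (e n)"
begin

lemma zeros: "(\<And>i. i < l \<Longrightarrow> e (n + i) = 0) \<Longrightarrow> f (n + l) = real b ^ l * f n"
  by (induction l) (auto simp: step)

lemma infinite_nonzero: "infinite {n. e n \<noteq> 0}"
proof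
  assume "finite {n. e n \<noteq> 0}"
  then obtain N where N: "\<And>n. e n \<noteq> 0 \<Longrightarrow> n < N"
    by (auto simp: finite_nat_set_iff_bounded)
  have zero: "e (N + i) = 0" for i using N[of "N + i"] by auto
  obtain l where "1 / f N < real b ^ l" using real_arch_pow[of "real b" "1 / f N"] base by auto
  then have "1 < real b ^ l * f N" using unit(1)[of N] by (simp add: divide_less_eq)
  then show False using zeros[of l N, OF zero] unit(2)[of "N + l"] by simp
qed

lemma exists_nonzero: "\<exists>l. e (n + l) \<noteq> 0"
proof -
  obtain k where "k \<ge> n" "e k \<noteq> 0"
    using infinite_nonzero unfolding infinite_nat_iff_unbounded_le by auto
  then show ?thesis by (metis le_add_diff_inverse)
qed

text \<open>Along a run of \<open>l n\<close> zeros the remainder is multiplied by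
  \<open>real b ^ l n\<close>. Staying below 1 gives the upper bound; the nonzero digit after the
  run forces \<open>real b * f (n + l n) \<ge> 1\<close> and gives the lower one.\<close>

lemma run_bounds:
  defines "l \<equiv> \<lambda>n. LEAST l. e (n + l) \<noteq> 0"
  shows "f n < real b powr (- real (l n))" "real b powr (- real (l n) - 1) \<le> f n"
proof -
  have nz: "e (n + l n) \<noteq> 0" unfolding l_def using exists_nonzero by (rule LeastI_ex)
  have z: "e (n + i) = 0" if "i < l n" for i using not_less_Least[OF that[unfolded l_def]] by simp
  have eq: "f (n + l n) = real b ^ l n * f n" using z by (rule zeros)
  have bpos: "real b ^ l n > 0" using base by simp
  have pw: "real b powr (- real (l n)) = 1 / real b ^ l n"
    using base by (simp add: powr_minus powr_realpow inverse_eq_divide)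
  show "f n < real b powr (- real (l n))"
    using eq unit(2)[of "n + l n"] bpos by (simp add: pw field_simps)
  have "real b * f (n + l n) \<ge> 1"
    using step[of "n + l n"] unit(1)[of "Suc (n + l n)"] nz by linarith
  then have "1 \<le> real b * (real b ^ l n * f n)" by (simp add: eq)
  moreover have "real b powr (- real (l n) - 1) = 1 / (real b * real b ^ l n)"
    using base by (simp add: powr_diff pw)
  ultimately show "real b powr (- real (l n) - 1) \<le> f n"
    using base by (simp add: divide_le_eq mult_ac)
qed

end

lemma digit_expansions:
  fixes \<xi> :: real
  assumes irr: "\<xi> \<notin> \<rat>" and b: "b \<ge> 2"
  shows "expansion b (\<lambda>n. frac (real b ^ n * \<xi>)) (digit_word b \<xi>)"
    and "expansion b (\<lambda>n. 1 - frac (real b ^ n * \<xi>)) (\<lambda>n. b - 1 - digit_word b \<xi> n)"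
    and "digit_word b \<xi> n \<le> b - 1"
proof -
  define f where "f n = frac (real b ^ n * \<xi>)" for n
  have f: "0 < f n" "f n < 1" for n
  proof -
    have "real b ^ n * \<xi> \<notin> \<int>"
    proof
      assume "real b ^ n * \<xi> \<in> \<int>"
      then have "real b ^ n * \<xi> / real b ^ n \<in> \<rat>" by (intro Rats_divide) (auto simp: Ints_subset_Rats[THEN subsetD])
      then show False using irr b by simp
    qed
    then show "0 < f n" by (simp add: f_def frac_gt_0_iff)
    show "f n < 1" by (simp add: f_def frac_lt_1)
  qed
  have floor: "\<lfloor>real b ^ Suc n * \<xi>\<rfloor> = int b * \<lfloor>real b ^ n * \<xi>\<rfloor> + \<lfloor>real b * f n\<rfloor>" for n
  proof -
    have "real b ^ Suc n * \<xi> = of_int (int b * \<lfloor>real b ^ n * \<xi>\<rfloor>) + real b * f n"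
      by (simp add: f_def frac_def algebra_simps)
    then show ?thesis unfolding int_add_floor by (rule arg_cong)
  qed
  have d: "digit_word b \<xi> n = nat \<lfloor>real b * f n\<rfloor>" for n
    unfolding digit_word_def digit_def floor by simp
  have d_real: "real (digit_word b \<xi> n) = of_int \<lfloor>real b * f n\<rfloor>" for n
    using f[of n] b by (simp add: d)
  have step: "f (Suc n) = real b * f n - real (digit_word b \<xi> n)" for n
    unfolding d_real f_def[of "Suc n"] frac_def floor by (simp add: f_def frac_def algebra_simps)
  have le: "digit_word b \<xi> n \<le> b - 1" for n
  proof -
    have "real b * f n < real b * 1" using f b by (intro mult_strict_left_mono) auto
    then have "\<lfloor>real b * f n\<rfloor> < int b" by (simp add: floor_less_iff)
    then show ?thesis using b by (simp add: d)
  qed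
  show "digit_word b \<xi> n \<le> b - 1" by (rule le)
  show "expansion b (\<lambda>n. frac (real b ^ n * \<xi>)) (digit_word b \<xi>)"
    unfolding f_def[symmetric] by standard (use b f step in auto)
  show "expansion b (\<lambda>n. 1 - frac (real b ^ n * \<xi>)) (\<lambda>n. b - 1 - digit_word b \<xi> n)"
    unfolding f_def[symmetric]
  proof
    show "1 - f (Suc n) = real b * (1 - f n) - real (b - 1 - digit_word b \<xi> n)" for n
      using le[of n] b by (simp add: step of_nat_diff algebra_simps)
  qed (use b f in auto)
qed

text \<open>The fractional part and its complement to 1 are the remainders of the two expansions, so
  their minimum is governed by the longer run.\<close>

lemma dist_int_run_bounds:
  fixes \<xi> :: real
  assumes irr: "\<xi> \<notin> \<rat>" and b: "b \<ge> 2"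
  defines "L \<equiv> \<lambda>n. max (LEAST l. digit_word b \<xi> (n + l) \<noteq> 0) (LEAST l. digit_word b \<xi> (n + l) \<noteq> b - 1)"
  shows "dist_int (real b ^ n * \<xi>) < real b powr (- real (L n))"
    and "real b powr (- real (L n) - 1) \<le> dist_int (real b ^ n * \<xi>)"
proof -
  define l0 l1 where "l0 = (LEAST l. digit_word b \<xi> (n + l) \<noteq> 0)"
    and "l1 = (LEAST l. digit_word b \<xi> (n + l) \<noteq> b - 1)"
  have L: "L n = max l0 l1" by (simp add: L_def l0_def l1_def)
  have "b - 1 - digit_word b \<xi> k \<noteq> 0 \<longleftrightarrow> digit_word b \<xi> k \<noteq> b - 1" for k
    using digit_expansions(3)[OF irr b, of k] by auto
  then have l1: "l1 = (LEAST l. b - 1 - digit_word b \<xi> (n + l) \<noteq> 0)" by (simp add: l1_def)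
  note r0 = expansion.run_bounds[OF digit_expansions(1)[OF irr b], of n, folded l0_def]
  note r1 = expansion.run_bounds[OF digit_expansions(2)[OF irr b], of n, folded l1]
  have mono: "real b powr s \<le> real b powr t" if "s \<le> t" for s t
    using b that by (intro powr_mono) auto
  have "max l0 l1 = l0 \<or> max l0 l1 = l1" by linarith
  then show "dist_int (real b ^ n * \<xi>) < real b powr (- real (L n))"
    unfolding dist_int_eq_min L using r0(1) r1(1) by auto
  show "real b powr (- real (L n) - 1) \<le> dist_int (real b ^ n * \<xi>)"
    unfolding dist_int_eq_min L
    using order_trans[OF mono r0(2), of "- real (max l0 l1) - 1"] order_trans[OF mono r1(2), of "- real (max l0 l1) - 1"]
    by auto
qed

text \<open>By the bounds for the distance, the condition with exponent \<open>v\<close> compares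
  \<open>v * n\<close> with \<open>L n\<close> up to an additive 1, which is negligible against
  \<open>n\<close>. So every \<open>v\<close> below the upper limit of \<open>L n / n\<close> is
  admissible and none above it.\<close>

lemma irr_exp_eq_limsup:
  fixes \<xi> :: real
  assumes irr: "\<xi> \<notin> \<rat>" and b: "b \<ge> 2"
    and r0: "is_limsup (\<lambda>n. real (LEAST l. digit_word b \<xi> (n + l) \<noteq> 0) / real n) r0"
    and r1: "is_limsup (\<lambda>n. real (LEAST l. digit_word b \<xi> (n + l) \<noteq> b - 1) / real n) r1"
  shows "irr_exp b \<xi> = ereal (max r0 r1)"
proof -
  define l0 l1 where "l0 n = (LEAST l. digit_word b \<xi> (n + l) \<noteq> 0)"
    and "l1 n = (LEAST l. digit_word b \<xi> (n + l) \<noteq> b - 1)" for n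
  define L where "L n = max (l0 n) (l1 n)" for n
  define r where "r = max r0 r1"
  note bounds = dist_int_run_bounds[OF irr b, folded l0_def l1_def, folded L_def]
  have pw: "(real b ^ n) powr (- v) = real b powr (- (v * real n))" for n v
    using b by (simp add: powr_realpow[symmetric] powr_powr mult.commute)
  define V where "V = {v. infinite {n::nat. n > 0 \<and> dist_int (real b ^ n * \<xi>) < (real b ^ n) powr (- v)}}"
  have upper: "v \<le> r" if "v \<in> V" for v
  proof (rule ccontr)
    assume "\<not> v \<le> r"
    \<comment> \<open>Half of the gap is spent on the upper limits and half on the additive
      1.\<close>
    define \<epsilon> where "\<epsilon> = (v - r) / 2"
    have \<epsilon>: "\<epsilon> > 0" using \<open>\<not> v \<le> r\<close> by (simp add: \<epsilon>_def)
    have "\<forall>\<^sub>F n in sequentially. real (l0 n) / real n \<le> r0 + \<epsilon>"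
      using r0 \<epsilon> by (auto simp: is_limsup_def l0_def)
    moreover have "\<forall>\<^sub>F n in sequentially. real (l1 n) / real n \<le> r1 + \<epsilon>"
      using r1 \<epsilon> by (auto simp: is_limsup_def l1_def)
    moreover have "\<forall>\<^sub>F n in sequentially. 1 / \<epsilon> \<le> real n"
      by (rule eventually_mono[OF eventually_ge_at_top[of "nat \<lceil>1 / \<epsilon>\<rceil>"]]) linarith
    ultimately have "\<forall>\<^sub>F n in sequentially. \<not> (n > 0 \<and> dist_int (real b ^ n * \<xi>) < (real b ^ n) powr (- v))"
    proof eventually_elim
      case (elim n)
      show ?case
      proof
        assume n: "n > 0 \<and> dist_int (real b ^ n * \<xi>) < (real b ^ n) powr (- v)"
        have "r0 \<le> r" "r1 \<le> r" by (auto simp: r_def)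
        then have "real (l0 n) / real n \<le> r + \<epsilon>" "real (l1 n) / real n \<le> r + \<epsilon>" using elim by linarith+
        then have "real (l0 n) \<le> (r + \<epsilon>) * real n" "real (l1 n) \<le> (r + \<epsilon>) * real n"
          using n by (simp_all add: divide_le_eq)
        then have "real (L n) \<le> (r + \<epsilon>) * real n" by (simp add: L_def max_def)
        moreover have "1 \<le> \<epsilon> * real n" using elim(3) \<epsilon> by (simp add: field_simps)
        ultimately have "real (L n) + 1 \<le> (r + \<epsilon>) * real n + \<epsilon> * real n" by linarith
        also have "\<dots> = v * real n" by (simp add: \<epsilon>_def field_simps)
        finally have "real b powr (- (v * real n)) \<le> real b powr (- real (L n) - 1)"
          using b by (intro powr_mono) auto
        then show False using bounds(2)[of n] n unfolding pw by linarith
      qed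
    qed
    then have "finite {n. n > 0 \<and> dist_int (real b ^ n * \<xi>) < (real b ^ n) powr (- v)}"
      unfolding cofinite_eq_sequentially[symmetric] eventually_cofinite by simp
    then show False using that by (simp add: V_def)
  qed
  have lower: "v \<in> V" if "v < r" for v
  proof -
    \<comment> \<open>The larger of the two upper limits is realized by one of the two sequences of
      run lengths, and \<open>L\<close> dominates both.\<close>
    have "\<exists>l s. is_limsup (\<lambda>n. real (l n) / real n) s \<and> r = s \<and> (\<forall>n. l n \<le> L n)"
    proof (cases "r = r0")
      case True
      then show ?thesis using r0 by (intro exI[of _ l0] exI[of _ r0]) (auto simp: L_def l0_def)
    next
      case False
      then have "r = r1" by (auto simp: r_def)
      then show ?thesis using r1 by (intro exI[of _ l1] exI[of _ r1]) (auto simp: L_def l1_def)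
    qed
    then obtain l where l: "is_limsup (\<lambda>n. real (l n) / real n) r" "\<And>n. l n \<le> L n" by blast
    have freq: "\<exists>\<^sub>F n in sequentially. real (l n) / real n \<ge> v"
      using l(1) that unfolding is_limsup_def by (metis diff_diff_eq2 add_diff_cancel_left' diff_gt_0_iff_gt)
    have "\<exists>n\<ge>N. n > 0 \<and> dist_int (real b ^ n * \<xi>) < (real b ^ n) powr (- v)" for N
    proof -
      obtain n where n: "n \<ge> Suc N" "real (l n) / real n \<ge> v"
        using freq unfolding frequently_sequentially by blast
      then have "v * real n \<le> real (l n)" by (simp add: le_divide_eq)
      also have "\<dots> \<le> real (L n)" using l(2) by simp
      finally have "real b powr (- real (L n)) \<le> real b powr (- (v * real n))"
        using b by (intro powr_mono) auto
      then show ?thesis using bounds(1)[of n] n unfolding pw by (intro exI[of _ n]) auto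
    qed
    then show ?thesis unfolding V_def infinite_nat_iff_unbounded_le by blast
  qed
  have "irr_exp b \<xi> = Sup (ereal ` V)"
    unfolding irr_exp_def V_def by (rule arg_cong[of _ _ Sup]) auto
  also have "\<dots> = ereal r"
  proof (rule antisym)
    show "Sup (ereal ` V) \<le> ereal r" using upper by (intro Sup_least) auto
    show "ereal r \<le> Sup (ereal ` V)"
    proof (rule ccontr)
      assume "\<not> ?thesis"
      then have "Sup (ereal ` V) < ereal r" by simp
      then obtain v where v: "Sup (ereal ` V) < ereal v" "ereal v < ereal r" using ereal_dense2 by blast
      then have "ereal v \<le> Sup (ereal ` V)" using lower by (intro Sup_upper) auto
      then show False using v by simp
    qed
  qed
  finally show ?thesis by (simp add: r_def)
qed

lemma morphic_irr_exp:
  fixes \<xi> :: real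
  assumes irr: "\<xi> \<notin> \<rat>" and b: "b \<ge> 2"
    and pm: "pure_morphic_by \<Sigma> h a w" and u: "digit_word b \<xi> = \<tau> \<circ> w"
  shows "\<exists>r. algebraic r \<and> irr_exp b \<xi> = ereal r"
    and "\<forall>c\<in>\<Sigma>. length (h c) = k \<Longrightarrow> \<exists>r\<in>\<rat>. irr_exp b \<xi> = ereal r"
proof -
  have set: "digit_word b \<xi> n = s \<longleftrightarrow> w n \<in> {c. \<tau> c = s}" for n s by (simp add: u)
  have inf0: "infinite {i. w i \<notin> {c. \<tau> c = 0}}"
    unfolding set[symmetric] using expansion.infinite_nonzero[OF digit_expansions(1)[OF irr b]] .
  have "b - 1 - digit_word b \<xi> n \<noteq> 0 \<longleftrightarrow> digit_word b \<xi> n \<noteq> b - 1" for n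
    using digit_expansions(3)[OF irr b, of n] by auto
  then have inf1: "infinite {i. w i \<notin> {c. \<tau> c = b - 1}}"
    unfolding set[symmetric] using expansion.infinite_nonzero[OF digit_expansions(2)[OF irr b]] by simp
  note eq = irr_exp_eq_limsup[OF irr b, unfolded set]
  show "\<exists>r. algebraic r \<and> irr_exp b \<xi> = ereal r"
  proof -
    obtain r0 r1 where "algebraic r0" "algebraic r1"
      "is_limsup (\<lambda>n. real (LEAST l. w (n + l) \<notin> {c. \<tau> c = 0}) / real n) r0"
      "is_limsup (\<lambda>n. real (LEAST l. w (n + l) \<notin> {c. \<tau> c = b - 1}) / real n) r1"
      using pure_morphic_run_limsup(1)[OF pm inf0] pure_morphic_run_limsup(1)[OF pm inf1] by blast
    then show ?thesis using eq[of r0 r1] by (intro exI[of _ "max r0 r1"]) (auto simp: max_def)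
  qed
  assume k: "\<forall>c\<in>\<Sigma>. length (h c) = k"
  obtain r0 r1 where "r0 \<in> \<rat>" "r1 \<in> \<rat>"
    "is_limsup (\<lambda>n. real (LEAST l. w (n + l) \<notin> {c. \<tau> c = 0}) / real n) r0"
    "is_limsup (\<lambda>n. real (LEAST l. w (n + l) \<notin> {c. \<tau> c = b - 1}) / real n) r1"
    using pure_morphic_run_limsup(2)[OF pm inf0 k] pure_morphic_run_limsup(2)[OF pm inf1 k] by blast
  then show "\<exists>r\<in>\<rat>. irr_exp b \<xi> = ereal r" using eq[of r0 r1] by (intro bexI[of _ "max r0 r1"]) (auto simp: max_def)
qed

theorem theorem1:
  fixes \<xi> :: real and b :: nat
  assumes "\<xi> \<notin> \<rat>" and "b \<ge> 2"
  shows "(automatic (digit_word b \<xi>) \<longrightarrow> (\<exists>r\<in>\<rat>. irr_exp b \<xi> = ereal r))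
       \<and> (morphic (digit_word b \<xi>) \<longrightarrow> (\<exists>r. algebraic r \<and> irr_exp b \<xi> = ereal r))"
  using morphic_irr_exp[OF assms] unfolding automatic_def morphic_def by blast

end
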